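(* Assume that the moving boundary is non-increasing ($A_t\subset A_s$ for $s\le t$) with $A_\infty:=\bigcap_{t\in I}A_t\neq\emptyset$, and that Assumptions (A'), $(H_{hom})$, $(H_\infty)$ and $(H'_\infty)$ stated in the context hold. Then for every $\mu\in\mathcal M_1(E_0)$, $$\frac1t\int_0^t\mathbb P_\mu(X_s\in\cdot\mid\tau_A>t)\,ds\longrightarrow\beta_\infty\quad\text{weakly as }t\to\infty,$$ where $\beta_\infty$ is the unique invariant probability measure of the $Q$-process of $(X_t)_{t\in I}$ absorbed by $A_\infty$, i.e. of the Markov process with laws $(\mathbb Q^\infty_x)_{x\in E_\infty}$ given by $\mathbb Q^\infty_x(X_t\in\cdot)=\lim_{T\to\infty}\mathbb P_x(X_t\in\cdot\mid\tau_{A_\infty}>T)$.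
   Context: Let $I=\mathbb Z_+$ or $\mathbb R_+$; when $I=\mathbb Z_+$ the average $\frac1t\int_0^t\cdot\,ds$ is read as $\frac1n\sum_{k=0}^n$. $(X_t)_{t\in I}$ is a time-homogeneous Markov process on a metric space $(E,d)$ equipped with a $\sigma$-algebra $\mathcal E$, and $\mathcal F_t=\sigma(X_u,\,0\le u\le t)$. For $s\in I$, $x\in E$, $\mathbb P_{s,x}$ is the law of the process started from $x$ at time $s$ ($\mathbb P_{s,x}(X_s=x)=1$; by time-homogeneity $(X_{s+u})_{u\in I}$ under $\mathbb P_{s,x}$ has the law of $(X_u)_{u\in I}$ under $\mathbb P_{0,x}$). Put $\mathbb P_{s,\mu}=\int\mathbb P_{s,x}\,\mu(dx)$, $\mathbb P_x=\mathbb P_{0,x}$, $\mathbb P_\mu=\mathbb P_{0,\mu}$, with expectations $\mathbb E_{s,x}$, etc. For $F\subset E$, $\mathcal M_1(F)$ is the set of probability measures on $F$. For each $t\in I$, $A_t\in\mathcal E$, $E_t=E\setminus A_t$, and $\tau_A=\inf\{t\in I: X_t\in A_t\}$ (under $\mathbb P_{s,\cdot}$ the infimum is over $t\ge s$). It is assumed throughout that $\tau_A$ is an $(\mathcal F_t)$-stopping time, $\mathbb P_{s,x}(\tau_A<\infty)=1$ for all $s\in I$, $x\in E_s$, and $\mathbb P_{s,x}(\tau_A>t)>0$ for all $s\le t$, $x\in E_s$. Put $E_\infty=E\setminus A_\infty$ and $\tau_{A_\infty}=\inf\{t\ge0:X_t\in A_\infty\}$. The total variation distance is $\|\mu-\nu\|_{TV}=\sup\{|\mu(f)-\nu(f)|: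 f\text{ measurable},\ \|f\|_\infty\le1\}$. Assumption (A'): there exist $\nu_s\in\mathcal M_1(E_s)$ ($s\in I$) and $t_0\in I$, $t_0>0$, $c_1,c_2>0$ such that (A'1) for all $s\in I$, $x\in E_s$: $\mathbb P_{s,x}(X_{s+t_0}\in\cdot\mid\tau_A>s+t_0)\ge c_1\nu_{s+t_0}$; (A'2) for all $s\le t$, $x\in E_s$: $\mathbb P_{s,\nu_s}(\tau_A>t)\ge c_2\mathbb P_{s,x}(\tau_A>t)$. Assumption $(H_{hom})$: (a) strong Markov property: for any $(\mathcal F_t)$-stopping time $\tau$ and any $x\in E$, $\mathbb P_x((X_{\tau+t})_{t\in I}\in\cdot,\tau<\infty\mid\mathcal F_\tau)=\mathbf 1_{\tau<\infty}\mathbb P_{X_\tau}((X_t)_{t\in I}\in\cdot)$; (b) for any $x\in E_0$, $t\in I$, $\mathbb P_{s,x}(\tau_A>s+t)\to\mathbb P_x(\tau_{A_\infty}>t)$ as $s\to\infty$; (c) for any $x\in E_0$ and $s\ge0$, the functions $t\mapsto\mathbb P_{s,x}(\tau_A>t)$ and $t\mapsto\mathbb P_x(\tau_{A_\infty}>t)$ are continuous. Assumption $(H_\infty)$: there exist a unique $\alpha_\infty\in\mathcal M_1(E_\infty)$ and constants $C_\infty,\gamma_\infty>0$ such that for any $\mu\in\mathcal M_1(E_\infty)$ and $t\ge0$, $\|\mathbb P_\mu(X_t\in\cdot\mid\tau_{A_\infty}>t)-\alpha_\infty\|_{TV}\le C_\infty e^{-\gamma_\infty t}$. Under $(H_\infty)$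 it is known that there is $\lambda_\infty>0$ with $\mathbb P_{\alpha_\infty}(\tau_{A_\infty}>t)=e^{-\lambda_\infty t}$ for all $t\in I$, and a function $\eta_\infty$, positive on $E_\infty$ and vanishing on $A_\infty$, with $\eta_\infty(x)=\lim_{t\to\infty}e^{\lambda_\infty t}\mathbb P_x(\tau_{A_\infty}>t)$ for $x\in E_\infty$; moreover the laws $\mathbb Q^\infty_x$ are well defined and admit a unique invariant probability measure (Champagnat-Villemonais). Assumption $(H'_\infty)$: there exist $s_0\in I$ and $x_0\in E_{s_0}$ such that for any $s\ge s_0$, $\mathbb E_{s,x_0}[e^{\lambda_\infty\tau_A}\eta_\infty(X_{\tau_A})]<+\infty$, and $\lim_{s\to\infty}\mathbb E_{s,x_0}[e^{\lambda_\infty(\tau_A-s)}\eta_\infty(X_{\tau_A})]=0$. *)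

theory Defs
  imports "HOL-Probability.Probability"
begin

definition total_variation :: "'e measure \<Rightarrow> 'e measure \<Rightarrow> 'e measure \<Rightarrow> real" where
  "total_variation \<E> \<mu> \<nu> =
     (SUP f\<in>{f \<in> borel_measurable \<E>. \<forall>x\<in>space \<E>. \<bar>f x\<bar> \<le> (1::real)}.
        \<bar>(\<integral>x. f x \<partial>\<mu>) - (\<integral>x. f x \<partial>\<nu>)\<bar>)"

text \<open>Since \<open>\<E>\<close> is not required to contain the Borel sets of the metric, the test functions are
  the bounded continuous functions that are \<open>\<E>\<close>-measurable; these are all bounded continuous
  functions as soon as \<open>\<E>\<close> contains the Borel sets.\<close>

definition weakly_converges ::
    "'e::metric_space measure \<Rightarrow> ('t \<Rightarrow> 'e measure) \<Rightarrow> 'e measure \<Rightarrow> 't filter \<Rightarrow> bool" where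
  "weakly_converges \<E> \<mu> \<beta> F \<longleftrightarrow>
     (\<forall>f :: 'e \<Rightarrow> real. f \<in> borel_measurable \<E> \<and> continuous_on UNIV f \<and> bounded (range f) \<longrightarrow>
        ((\<lambda>t. \<integral>x. f x \<partial>(\<mu> t)) \<longlongrightarrow> (\<integral>x. f x \<partial>\<beta>)) F)"

text \<open>Histories and hitting times of a process \<open>X\<close> on \<open>(\<Omega>, M)\<close> with values in \<open>\<E>\<close>.
  The \<open>\<sigma>\<close>-algebra \<open>hist s t\<close> is generated by \<open>X u\<close> for \<open>s \<le> u \<le> t\<close>. Times are reals in the set
  \<open>I\<close>; random times are extended reals, and the infimum of the empty set is \<open>\<infinity>\<close>.\<close>

locale process =
  fixes I :: "real set"
    and \<E> :: "'e::metric_space measure"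
    and M :: "'w measure"
    and X :: "real \<Rightarrow> 'w \<Rightarrow> 'e"
begin

definition time_top :: "real filter" where
  "time_top = inf at_top (principal I)"

definition hist :: "real \<Rightarrow> ereal \<Rightarrow> 'w measure" where
  "hist s t = sigma (space M)
     (\<Union>u\<in>{u\<in>I. s \<le> u \<and> ereal u \<le> t}. {X u -` B \<inter> space M | B. B \<in> sets \<E>})"

definition path_from :: "real \<Rightarrow> 'w \<Rightarrow> real \<Rightarrow> 'e" where
  "path_from s \<omega> = (\<lambda>u\<in>I. X (s + u) \<omega>)"

definition path_space :: "(real \<Rightarrow> 'e) measure" where
  "path_space = Pi\<^sub>M I (\<lambda>_. \<E>)"

definition hitting :: "(real \<Rightarrow> 'e set) \<Rightarrow> real \<Rightarrow> 'w \<Rightarrow> ereal" where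
  "hitting B s \<omega> = (INF t\<in>{t\<in>I. s \<le> t \<and> X t \<omega> \<in> B t}. ereal t)"

definition at_time :: "('w \<Rightarrow> ereal) \<Rightarrow> 'w \<Rightarrow> 'e" where
  "at_time T \<omega> = X (real_of_ereal (T \<omega>)) \<omega>"

definition prob_measures :: "'e set \<Rightarrow> 'e measure set" where
  "prob_measures F = {\<mu> \<in> space (prob_algebra \<E>). emeasure \<mu> F = 1}"

definition survival :: "'w measure \<Rightarrow> ('w \<Rightarrow> ereal) \<Rightarrow> real \<Rightarrow> real" where
  "survival N T t = measure N {\<omega> \<in> space M. T \<omega> > ereal t}"

text \<open>\<open>law_given N T t r\<close> is the conditional law \<open>N(X\<^sub>r \<in> \<cdot> | T > t)\<close>.\<close>

definition law_given :: "'w measure \<Rightarrow> ('w \<Rightarrow> ereal) \<Rightarrow> real \<Rightarrow> real \<Rightarrow> 'e measure" where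
  "law_given N T t r = distr (uniform_measure N {\<omega> \<in> space M. T \<omega> > ereal t}) \<E> (X r)"

end

text \<open>A time-homogeneous Markov process; \<open>P s x\<close> is the law under which the process starts from
  \<open>x\<close> at time \<open>s\<close>, and only the variables \<open>X u\<close> with \<open>u \<ge> s\<close> are meaningful under it.

  Two regularity properties are needed in continuous time for the objects below to be meaningful.
  Progressive measurability makes \<open>X\<close> evaluated at a stopping time a random variable and makes
  \<open>r \<mapsto> X r\<close> integrable in time. The equation \<open>shift_paths\<close>, which says that the set of
  trajectories is the same from every starting time, holds on the usual canonical spaces (all
  functions, right-continuous functions, continuous functions). It is needed because a
  hitting-time event is measurable on \<open>\<Omega>\<close> only, not in the full product space, so that the
  identity of finite-dimensional laws alone would not carry it from \<open>P s x\<close> to \<open>P 0 x\<close>.\<close>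

locale markov_process = process I \<E> M X
  for I :: "real set"
    and \<E> :: "'e::metric_space measure"
    and M :: "'w measure"
    and X :: "real \<Rightarrow> 'w \<Rightarrow> 'e" +
  fixes P :: "real \<Rightarrow> 'e \<Rightarrow> 'w measure"
  assumes time_set: "I = range real \<or> I = {0..}"
    and space_states: "space \<E> = UNIV"
    and measurable_X: "\<And>t. t \<in> I \<Longrightarrow> X t \<in> M \<rightarrow>\<^sub>M \<E>"
    and kernel: "\<And>s. s \<in> I \<Longrightarrow> P s \<in> \<E> \<rightarrow>\<^sub>M prob_algebra M"
    and start: "\<And>s x. s \<in> I \<Longrightarrow> AE \<omega> in P s x. X s \<omega> = x"
    and homogeneous: "\<And>s x. s \<in> I \<Longrightarrow>
          distr (P s x) path_space (path_from s) = distr (P 0 x) path_space (path_from 0)"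
    and markov: "\<And>s t x C. s \<in> I \<Longrightarrow> t \<in> I \<Longrightarrow> s \<le> t \<Longrightarrow> C \<in> sets path_space \<Longrightarrow>
          AE \<omega> in P s x.
            real_cond_exp (P s x) (hist s t) (indicat_real {\<omega> \<in> space M. path_from t \<omega> \<in> C}) \<omega>
              = measure (P t (X t \<omega>)) {\<omega>' \<in> space M. path_from t \<omega>' \<in> C}"
    and progressive: "\<And>t. t \<in> I \<Longrightarrow>
          (\<lambda>(u, \<omega>). X u \<omega>) \<in> restrict_space borel {u\<in>I. u \<le> t} \<Otimes>\<^sub>M hist 0 t \<rightarrow>\<^sub>M \<E>"
    and shift_paths: "\<And>s. s \<in> I \<Longrightarrow> path_from s ` space M = path_from 0 ` space M"
begin

definition strong_markov :: bool where
  "strong_markov \<longleftrightarrow>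
     (\<forall>x T. stopping_time (hist 0) T \<and> (\<forall>\<omega>\<in>space M. T \<omega> \<in> ereal ` I \<union> {\<infinity>}) \<longrightarrow>
       (\<forall>C\<in>sets path_space. AE \<omega> in P 0 x.
          real_cond_exp (P 0 x) (filtration.pre_sigma (space M) (hist 0) T)
            (indicat_real {\<omega> \<in> space M. path_from (real_of_ereal (T \<omega>)) \<omega> \<in> C \<and> T \<omega> < \<infinity>}) \<omega>
          = indicat_real {\<omega> \<in> space M. T \<omega> < \<infinity>} \<omega>
              * measure (P 0 (at_time T \<omega>)) {\<omega>' \<in> space M. path_from 0 \<omega>' \<in> C}))"

definition law_from :: "real \<Rightarrow> 'e measure \<Rightarrow> 'w measure" where
  "law_from s \<mu> = \<mu> \<bind> P s"

end

text \<open>The moving boundary. Under \<open>P s x\<close> the hitting time \<open>tau_A s\<close> only looks at times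
  \<open>t \<ge> s\<close>, and it is a stopping time of the history started at \<open>s\<close>. The stopping-time property of
  \<open>tau_inf\<close> is what makes the events \<open>tau_inf > t\<close> measurable.\<close>

locale moving_boundary = markov_process I \<E> M X P
  for I :: "real set"
    and \<E> :: "'e::metric_space measure"
    and M :: "'w measure"
    and X :: "real \<Rightarrow> 'w \<Rightarrow> 'e"
    and P :: "real \<Rightarrow> 'e \<Rightarrow> 'w measure" +
  fixes A :: "real \<Rightarrow> 'e set"
  assumes sets_A: "\<And>t. t \<in> I \<Longrightarrow> A t \<in> sets \<E>"
    and stopping_A: "\<And>s. s \<in> I \<Longrightarrow> stopping_time (hist s) (hitting A s)"
    and stopping_inf: "stopping_time (hist 0) (hitting (\<lambda>_. \<Inter>t\<in>I. A t) 0)"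
    and absorbed: "\<And>s x. s \<in> I \<Longrightarrow> x \<notin> A s \<Longrightarrow> AE \<omega> in P s x. hitting A s \<omega> < \<infinity>"
    and survives: "\<And>s t x. s \<in> I \<Longrightarrow> t \<in> I \<Longrightarrow> s \<le> t \<Longrightarrow> x \<notin> A s \<Longrightarrow>
          survival (P s x) (hitting A s) t > 0"
begin

definition E :: "real \<Rightarrow> 'e set" where
  "E t = - A t"

definition A_inf :: "'e set" where
  "A_inf = (\<Inter>t\<in>I. A t)"

definition E_inf :: "'e set" where
  "E_inf = - A_inf"

definition tau_A :: "real \<Rightarrow> 'w \<Rightarrow> ereal" where
  "tau_A s = hitting A s"

definition tau_inf :: "'w \<Rightarrow> ereal" where
  "tau_inf = hitting (\<lambda>_. A_inf) 0"

definition cond_A' :: bool where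
  "cond_A' \<longleftrightarrow> (\<exists>\<nu> t0 c1 c2.
     (\<forall>s\<in>I. \<nu> s \<in> prob_measures (E s)) \<and> t0 \<in> I \<and> t0 > 0 \<and> c1 > 0 \<and> c2 > 0 \<and>
     (\<forall>s\<in>I. \<forall>x\<in>E s. \<forall>B\<in>sets \<E>.
        measure (law_given (P s x) (tau_A s) (s + t0) (s + t0)) B \<ge> c1 * measure (\<nu> (s + t0)) B) \<and>
     (\<forall>s\<in>I. \<forall>t\<in>I. \<forall>x\<in>E s. s \<le> t \<longrightarrow>
        survival (law_from s (\<nu> s)) (tau_A s) t \<ge> c2 * survival (P s x) (tau_A s) t))"

definition H_hom :: bool where
  "H_hom \<longleftrightarrow>
     strong_markov \<and>
     (\<forall>x\<in>E 0. \<forall>t\<in>I.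
        ((\<lambda>s. survival (P s x) (tau_A s) (s + t)) \<longlongrightarrow> survival (P 0 x) tau_inf t) time_top) \<and>
     (\<forall>x\<in>E 0. \<forall>s\<in>I.
        continuous_on {t\<in>I. s \<le> t} (survival (P s x) (tau_A s)) \<and>
        continuous_on I (survival (P 0 x) tau_inf))"

definition attracting :: "'e measure \<Rightarrow> bool" where
  "attracting \<alpha> \<longleftrightarrow> \<alpha> \<in> prob_measures E_inf \<and>
     (\<exists>C>0. \<exists>\<gamma>>0. \<forall>\<mu>\<in>prob_measures E_inf. \<forall>t\<in>I.
        total_variation \<E> (law_given (law_from 0 \<mu>) tau_inf t t) \<alpha> \<le> C * exp (- \<gamma> * t))"

definition H_inf :: bool where
  "H_inf \<longleftrightarrow> (\<exists>!\<alpha>. attracting \<alpha>)"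

definition alpha_inf :: "'e measure" where
  "alpha_inf = (THE \<alpha>. attracting \<alpha>)"

text \<open>The rate is determined by the displayed identity alone (at \<open>t = 1\<close>), so its positivity is
  not part of the definition.\<close>

definition lambda_inf :: real where
  "lambda_inf = (THE l. \<forall>t\<in>I. survival (law_from 0 alpha_inf) tau_inf t = exp (- l * t))"

definition eta_inf :: "'e \<Rightarrow> real" where
  "eta_inf x = (if x \<in> E_inf
     then Lim time_top (\<lambda>t. exp (lambda_inf * t) * survival (P 0 x) tau_inf t) else 0)"

definition H'_inf :: bool where
  "H'_inf \<longleftrightarrow> (\<exists>s0\<in>I. \<exists>x0\<in>E s0.
     (\<forall>s\<in>I. s0 \<le> s \<longrightarrow>
        (\<integral>\<^sup>+\<omega>. ennreal (exp (lambda_inf * real_of_ereal (tau_A s \<omega>))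
                     * eta_inf (at_time (tau_A s) \<omega>)) \<partial>(P s x0)) < \<infinity>) \<and>
     ((\<lambda>s. \<integral>\<^sup>+\<omega>. ennreal (exp (lambda_inf * (real_of_ereal (tau_A s \<omega>) - s))
                     * eta_inf (at_time (tau_A s) \<omega>)) \<partial>(P s x0)) \<longlongrightarrow> 0) time_top)"

text \<open>\<open>Q t x\<close> is the law of \<open>X\<^sub>t\<close> for the \<open>Q\<close>-process started from \<open>x\<close>; only \<open>x \<in> E_inf\<close> is
  constrained.\<close>

definition Q_process :: "(real \<Rightarrow> 'e \<Rightarrow> 'e measure) \<Rightarrow> bool" where
  "Q_process Q \<longleftrightarrow> (\<forall>t\<in>I. \<forall>x\<in>E_inf. Q t x \<in> prob_measures E_inf \<and>
     (\<forall>B\<in>sets \<E>.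
        ((\<lambda>T. measure (law_given (P 0 x) tau_inf T t) B) \<longlongrightarrow> measure (Q t x) B) time_top))"

definition invariant :: "(real \<Rightarrow> 'e \<Rightarrow> 'e measure) \<Rightarrow> 'e measure \<Rightarrow> bool" where
  "invariant Q \<beta> \<longleftrightarrow> \<beta> \<in> prob_measures E_inf \<and>
     (\<forall>t\<in>I. \<forall>B\<in>sets \<E>. (LINT x:E_inf|\<beta>. measure (Q t x) B) = measure \<beta> B)"

text \<open>The time average; in discrete time it is \<open>1/n\<close> times the sum over \<open>k = 0, \<dots>, n\<close>, of total
  mass \<open>(n + 1)/n\<close>.\<close>

definition time_measure :: "real \<Rightarrow> real measure" where
  "time_measure t =
     (if I = {0..} then restrict_space lborel {0..t} else count_space {k\<in>I. k \<le> t})"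

definition average_law :: "'e measure \<Rightarrow> real \<Rightarrow> 'e measure" where
  "average_law \<mu> t = scale_measure (ennreal (1 / t))
     (time_measure t \<bind> (\<lambda>r. law_given (law_from 0 \<mu>) (tau_A 0) t r))"

end

end

theory Submission
  imports Defs
begin

text \<open>Let \<open>\<eta>\<close> be the right eigenfunction of the semigroup killed at \<open>A_inf\<close>. The exponential
  convergence to \<open>\<alpha>_inf\<close> yields \<open>\<eta>\<close> as a bounded uniform limit of the rescaled survival
  probabilities, the \<open>Q\<close>-process as the \<open>\<eta>\<close>-transform, and \<open>\<beta> = \<eta> \<alpha>_inf\<close> as its only
  invariant law. By the strong Markov property the two conditions on \<open>\<eta>(X) exp (\<lambda> \<tau>)\<close> say that
  the \<open>Q\<close>-process started from \<open>x0\<close> at a late time \<open>s\<close> has a small probability of ever meeting the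
  moving boundary, so that conditioning on \<open>\<tau>_A > t\<close> and on \<open>\<tau>_{A_inf} > t\<close> is nearly the same for
  this starting point. The two parts of \<open>cond_A'\<close> give a Doeblin contraction, uniform in the
  horizon, for the process conditioned to survive, whence any initial law may be replaced by \<open>x0\<close>
  at a late time. Hence the conditional law of \<open>X\<^sub>s\<close> given \<open>\<tau>_A > t\<close> tends to \<open>\<beta>\<close> when \<open>s\<close> and
  \<open>t - s\<close> tend to infinity, and time averages follow.\<close>

subsection \<open>Killed semigroups with exponential ergodicity\<close>

text \<open>The cost in \<open>H'_inf\<close> bounds the mass lost at the moving boundary only when
  weighted by \<eta>, and \<eta> need not have a positive lower bound on \<open>E_inf\<close>. What
  saves the comparison is that the killed law, rescaled by exp (\<lambda> t), puts little mass where
  \<eta> is small. The scale exp (- \<lambda> t) is the order of the survival probability from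
  \<open>x0\<close>, so an error small on this scale stays small after division by that probability.
  The contraction and the limit have to meet at one time. A lag K, long enough for the contraction,
  is fixed first; the comparison with \<open>x0\<close> is then made at time s - K, and it must hold
  uniformly once the starting time, the lag and the remaining time are all large. In continuous time
  a hitting event need not be a measurable set of arbitrary paths. Each event is therefore placed in
  the \<sigma>-algebra of a history, where it becomes the trace on \<Omega> of a product-measurable
  set of paths; in this form homogeneity and the Markov properties apply to it.\<close>

lemma integrable_subprob_bounded:
  fixes f :: "'e \<Rightarrow> real"
  assumes "N \<in> space (subprob_algebra S)" "f \<in> borel_measurable S" "\<And>x. x \<in> space S \<Longrightarrow> \<bar>f x\<bar> \<le> c"
  shows "integrable N f"
proof -
  interpret subprob_space N using assms(1) by (simp add: space_subprob_algebra)
  have [measurable_cong]: "sets N = sets S" using assms(1) by (simp add: space_subprob_algebra)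
  have "space N = space S" using assms(1) by (auto simp: space_subprob_algebra dest: sets_eq_imp_space_eq)
  then show ?thesis
    using assms(2,3) by (intro integrable_const_bound[where B = c]) auto
qed

lemma abs_integral_subprob_le:
  fixes f :: "'e \<Rightarrow> real"
  assumes "N \<in> space (subprob_algebra S)" "f \<in> borel_measurable S" "\<And>x. x \<in> space S \<Longrightarrow> \<bar>f x\<bar> \<le> c"
  shows "\<bar>\<integral>x. f x \<partial>N\<bar> \<le> c * measure N (space S)"
proof -
  interpret subprob_space N using assms(1) by (simp add: space_subprob_algebra)
  have sp: "space N = space S" using assms(1) by (auto simp: space_subprob_algebra dest: sets_eq_imp_space_eq)
  have "\<bar>\<integral>x. f x \<partial>N\<bar> \<le> (\<integral>x. \<bar>f x\<bar> \<partial>N)" by (rule integral_abs_bound)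
  also have "\<dots> \<le> (\<integral>x. c \<partial>N)"
    using integrable_subprob_bounded[OF assms] assms(3) sp by (intro integral_mono) auto
  finally show ?thesis using sp by (simp add: mult.commute)
qed

lemma diff_integral_subprob_le:
  fixes f g :: "'e \<Rightarrow> real"
  assumes N: "N \<in> space (subprob_algebra S)" and f: "f \<in> borel_measurable S" and g: "g \<in> borel_measurable S"
    and f': "\<And>x. x \<in> space S \<Longrightarrow> \<bar>f x\<bar> \<le> c" and g': "\<And>x. x \<in> space S \<Longrightarrow> \<bar>g x\<bar> \<le> d"
    and "\<And>x. x \<in> space S \<Longrightarrow> \<bar>f x - g x\<bar> \<le> \<delta>"
  shows "\<bar>(\<integral>x. f x \<partial>N) - (\<integral>x. g x \<partial>N)\<bar> \<le> \<delta> * measure N (space S)"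
proof -
  have "(\<integral>x. f x \<partial>N) - (\<integral>x. g x \<partial>N) = (\<integral>x. f x - g x \<partial>N)"
    by (intro Bochner_Integration.integral_diff[symmetric] integrable_subprob_bounded[OF N f f'] integrable_subprob_bounded[OF N g g'])
  also have "\<bar>\<dots>\<bar> \<le> \<delta> * measure N (space S)"
    using assms by (intro abs_integral_subprob_le[OF N]) auto
  finally show ?thesis .
qed

lemma integral_bind_kernel:
  fixes f :: "'e \<Rightarrow> real"
  assumes "N \<in> space (subprob_algebra S)" "K \<in> S \<rightarrow>\<^sub>M subprob_algebra B"
    and "f \<in> borel_measurable B" "\<And>x. x \<in> space B \<Longrightarrow> \<bar>f x\<bar> \<le> c"
  shows "(\<integral>x. f x \<partial>(N \<bind> K)) = (\<integral>x. \<integral>y. f y \<partial>K x \<partial>N)"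
proof (rule integral_bind[where B = c and B' = 1 and K = B])
  interpret subprob_space N using assms(1) by (simp add: space_subprob_algebra)
  show "finite_measure N" by unfold_locales
  have s: "sets N = sets S" using assms(1) by (simp add: space_subprob_algebra)
  then show "K \<in> N \<rightarrow>\<^sub>M subprob_algebra B" using assms(2) by (simp cong: measurable_cong_sets)
  show "AE x in N. emeasure (K x) (space (K x)) \<le> ennreal 1"
    using subprob_space_kernel[OF assms(2)] sets_eq_imp_space_eq[OF s]
    by (auto simp: subprob_space.emeasure_space_le_1)
qed (use assms in auto)

lemma (in prob_space) expectation_pos:
  fixes f :: "'a \<Rightarrow> real"
  assumes "integrable M f" "AE x in M. 0 < f x"
  shows "0 < expectation f"
  using integral_less_AE_space[of "\<lambda>_. 0" f] assms emeasure_space_1 by simp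

text \<open>Pointwise g w differs from a w by at most d w, and the common factor cancels on dividing
  by the total weight. It serves for averages over a killed kernel as well as over an initial law,
  the weight being a survival probability in both cases.\<close>

lemma weighted_mean_close:
  fixes g w :: "'a \<Rightarrow> real"
  assumes w: "integrable N w" and gw: "integrable N (\<lambda>x. g x * w x)"
    and close: "AE x in N. 0 \<le> w x \<and> \<bar>g x - a\<bar> \<le> d" and pos: "0 < (\<integral>x. w x \<partial>N)"
  shows "\<bar>(\<integral>x. g x * w x \<partial>N) / (\<integral>x. w x \<partial>N) - a\<bar> \<le> d"
proof -
  have "\<bar>(\<integral>x. g x * w x \<partial>N) - a * (\<integral>x. w x \<partial>N)\<bar> = \<bar>\<integral>x. g x * w x - a * w x \<partial>N\<bar>"
    using w gw by simp
  also have "\<dots> \<le> (\<integral>x. \<bar>g x * w x - a * w x\<bar> \<partial>N)" by (rule integral_abs_bound)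
  also have "\<dots> \<le> (\<integral>x. d * w x \<partial>N)"
  proof (rule integral_mono_AE)
    show "AE x in N. \<bar>g x * w x - a * w x\<bar> \<le> d * w x"
      using close by eventually_elim
        (auto simp: abs_mult simp flip: left_diff_distrib intro: mult_right_mono)
  qed (use w gw in auto)
  finally have "\<bar>(\<integral>x. g x * w x \<partial>N) - a * (\<integral>x. w x \<partial>N)\<bar> \<le> d * (\<integral>x. w x \<partial>N)" by simp
  moreover have "(\<integral>x. g x * w x \<partial>N) / (\<integral>x. w x \<partial>N) - a
      = ((\<integral>x. g x * w x \<partial>N) - a * (\<integral>x. w x \<partial>N)) / (\<integral>x. w x \<partial>N)"
    using pos by (simp add: diff_divide_distrib)
  ultimately show ?thesis using pos by (simp add: abs_divide pos_divide_le_eq)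
qed

section \<open>Time sets and limits along them\<close>

locale time_domain =
  fixes I :: "real set"
  assumes time_cases: "I = range real \<or> I = {0..}"
begin

text \<open>The filter of \<open>time_top\<close>, restated without a process so that the analysis
  of semigroups does not depend on one.\<close>

abbreviation to_infinity :: "real filter" where
  "to_infinity \<equiv> inf at_top (principal I)"

lemma time_nonneg: "t \<in> I \<Longrightarrow> 0 \<le> t"
  and time_of_nat [simp]: "real n \<in> I"
  and time_0 [simp]: "0 \<in> I"
  and time_1 [simp]: "1 \<in> I"
  using time_cases range_eqI[of 0 real 0] range_eqI[of 1 real 1] by auto

lemma time_add [simp]: "s \<in> I \<Longrightarrow> t \<in> I \<Longrightarrow> s + t \<in> I"
  using time_cases by (auto simp flip: of_nat_add)

lemma time_diff: "s \<in> I \<Longrightarrow> t \<in> I \<Longrightarrow> s \<le> t \<Longrightarrow> t - s \<in> I"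
  using time_cases by (auto simp flip: of_nat_diff)

lemma eventually_to_infinity:
  "eventually P to_infinity \<longleftrightarrow> (\<exists>N. \<forall>t\<in>I. N \<le> t \<longrightarrow> P t)"
  unfolding eventually_inf_principal eventually_at_top_linorder by auto

lemma to_infinity_neq_bot: "to_infinity \<noteq> bot"
proof -
  have "\<exists>t\<in>I. N \<le> t" for N
    by (metis real_arch_simple time_of_nat)
  then show ?thesis
    by (auto simp: trivial_limit_def eventually_to_infinity)
qed

lemma eventually_time: "eventually (\<lambda>t. t \<in> I \<and> N \<le> t) to_infinity"
  by (auto simp: eventually_to_infinity)

lemma exp_decay: "0 < \<gamma> \<Longrightarrow> ((\<lambda>t. exp (- (\<gamma> * t))) \<longlongrightarrow> (0::real)) to_infinity"
proof (rule tendsto_mono[of _ at_top])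
  assume "0 < \<gamma>"
  then have "LIM t at_top. - (\<gamma> * t) :> at_bot"
    by (intro filterlim_uminus_at_bot_at_top[THEN filterlim_compose] filterlim_tendsto_pos_mult_at_top[OF tendsto_const]) (auto simp: filterlim_ident)
  then show "((\<lambda>t. exp (- (\<gamma> * t))) \<longlongrightarrow> (0::real)) at_top"
    by (rule filterlim_compose[OF exp_at_bot])
qed auto

lemma sequence_to_infinity: "filterlim real to_infinity sequentially"
  unfolding filterlim_inf filterlim_principal by (auto simp: filterlim_real_sequentially)

end

text \<open>Sandwiching \<open>n t\<close> between consecutive integers gives \<open>n |g t - t g 1| \<le> g 1\<close> for all \<open>n\<close>.\<close>

lemma (in time_domain) additive_monotone_linear:
  fixes g :: "real \<Rightarrow> real"
  assumes add: "\<And>s t. s \<in> I \<Longrightarrow> t \<in> I \<Longrightarrow> g (s + t) = g s + g t"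
    and nonneg: "\<And>t. t \<in> I \<Longrightarrow> 0 \<le> g t" and t: "t \<in> I"
  shows "g t = g 1 * t"
proof -
  have g0: "g 0 = 0" using add[of 0 0] by simp
  have mult: "real n * s \<in> I \<and> g (real n * s) = real n * g s" if "s \<in> I" for n s
    by (induction n) (use g0 that add in \<open>auto simp: algebra_simps\<close>)
  have mono: "g s \<le> g r" if "s \<in> I" "r \<in> I" "s \<le> r" for s r
    using add[of s "r - s"] nonneg[of "r - s"] time_diff[of s r] that by auto
  have nat: "g (real n) = real n * g 1" for n using mult[of 1 n] by simp
  have "real n * \<bar>g t - g 1 * t\<bar> \<le> g 1" for n
  proof -
    define k where "k = nat \<lfloor>real n * t\<rfloor>"
    have "0 \<le> real n * t" using time_nonneg[OF t] by auto
    then have k: "real k \<le> real n * t" "real n * t \<le> real (Suc k)"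
      unfolding k_def by linarith+
    have "g (real k) \<le> g (real n * t)" "g (real n * t) \<le> g (real (Suc k))"
      by (intro mono; use mult[OF t, of n] k in auto)+
    then have "real k * g 1 \<le> real n * g t" "real n * g t \<le> real (Suc k) * g 1"
      unfolding nat using mult[OF t, of n] by auto
    moreover have "real k * g 1 \<le> real n * t * g 1" "real n * t * g 1 \<le> real (Suc k) * g 1"
      using k nonneg[of 1] by (auto intro: mult_right_mono simp del: of_nat_Suc)
    ultimately have "\<bar>real n * g t - real n * t * g 1\<bar> \<le> g 1"
      by (simp add: algebra_simps abs_le_iff)
    moreover have "real n * \<bar>g t - g 1 * t\<bar> = \<bar>real n * g t - real n * t * g 1\<bar>"
      by (subst abs_of_nat[symmetric], subst abs_mult[symmetric]) (simp add: algebra_simps)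
    ultimately show ?thesis by simp
  qed
  then have "\<not> 0 < \<bar>g t - g 1 * t\<bar>"
    by (meson not_le reals_Archimedean3)
  then show ?thesis by simp
qed

section \<open>Semigroups killed outside a fixed set\<close>

text \<open>\<open>\<kappa> t x\<close> stands for the law of the position at time t on the event of
  survival. It is left unnormalised: the total mass is the survival probability, and the semigroup
  property stays linear. The kernels vanish off \<open>F\<close> in the starting point as well as in
  the target, so that integrals can be taken over the whole space.\<close>

locale killed_semigroup = time_domain I
  for I :: "real set" +
  fixes S :: "'e measure" and F :: "'e set" and \<kappa> :: "real \<Rightarrow> 'e \<Rightarrow> 'e measure"
  assumes space_S [simp]: "space S = UNIV"
    and sets_F [measurable]: "F \<in> sets S"
    and kernel [measurable]: "\<And>t. t \<in> I \<Longrightarrow> \<kappa> t \<in> S \<rightarrow>\<^sub>M subprob_algebra S"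
    and support: "\<And>t x. t \<in> I \<Longrightarrow> emeasure (\<kappa> t x) (- F) = 0"
    and dead: "\<And>t x. t \<in> I \<Longrightarrow> x \<notin> F \<Longrightarrow> measure (\<kappa> t x) UNIV = 0"
    and alive: "\<And>t x. t \<in> I \<Longrightarrow> x \<in> F \<Longrightarrow> 0 < measure (\<kappa> t x) UNIV"
    and chapman_kolmogorov: "\<And>s t x. s \<in> I \<Longrightarrow> t \<in> I \<Longrightarrow> \<kappa> (s + t) x = \<kappa> s x \<bind> \<kappa> t"
begin

definition surv :: "real \<Rightarrow> 'e \<Rightarrow> real" where
  "surv t x = measure (\<kappa> t x) UNIV"

lemma kernel_space: "t \<in> I \<Longrightarrow> \<kappa> t x \<in> space (subprob_algebra S)"
  using measurable_space[OF kernel, of t x] by simp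

lemma sets_kernel_eq [simp, measurable_cong]: "t \<in> I \<Longrightarrow> sets (\<kappa> t x) = sets S"
  using kernel_space by (simp add: space_subprob_algebra)

lemma space_kernel_eq [simp]: "t \<in> I \<Longrightarrow> space (\<kappa> t x) = UNIV"
  using sets_eq_imp_space_eq[OF sets_kernel_eq] by simp

lemma subprob_kernel: "t \<in> I \<Longrightarrow> subprob_space (\<kappa> t x)"
  using kernel_space by (simp add: space_subprob_algebra)

lemma measurable_kernel_integral [measurable]:
  fixes f :: "'e \<Rightarrow> real"
  assumes "f \<in> borel_measurable S" "t \<in> I"
  shows "(\<lambda>x. \<integral>y. f y \<partial>\<kappa> t x) \<in> borel_measurable S"
  using measurable_compose[OF kernel integral_measurable_subprob_algebra] assms by blast

lemma measurable_surv [measurable]: "t \<in> I \<Longrightarrow> surv t \<in> borel_measurable S"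
  unfolding surv_def
  using measurable_compose[OF kernel measurable_measure_subprob_algebra, of t UNIV] sets.top[of S] by simp

lemma surv_nonneg: "0 \<le> surv t x" by (simp add: surv_def)

lemma surv_le_1: "t \<in> I \<Longrightarrow> surv t x \<le> 1"
  using subprob_space.subprob_measure_le_1[OF subprob_kernel] by (simp add: surv_def)

lemma surv_pos: "t \<in> I \<Longrightarrow> x \<in> F \<Longrightarrow> 0 < surv t x" by (simp add: surv_def alive)

lemma surv_dead: "t \<in> I \<Longrightarrow> x \<notin> F \<Longrightarrow> surv t x = 0" by (simp add: surv_def dead)

lemma integrable_kernel:
  fixes f :: "'e \<Rightarrow> real"
  assumes "t \<in> I" "f \<in> borel_measurable S" "\<And>x. \<bar>f x\<bar> \<le> c"
  shows "integrable (\<kappa> t x) f"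
  by (rule integrable_subprob_bounded[OF kernel_space]) (use assms in auto)

lemma abs_kernel_integral_le:
  fixes f :: "'e \<Rightarrow> real"
  assumes "t \<in> I" "f \<in> borel_measurable S" "\<And>x. \<bar>f x\<bar> \<le> c"
  shows "\<bar>\<integral>y. f y \<partial>\<kappa> t x\<bar> \<le> c * surv t x"
  using abs_integral_subprob_le[OF kernel_space assms(2), of t c x] assms by (simp add: surv_def)

lemma kernel_integral_bounded:
  fixes f :: "'e \<Rightarrow> real"
  assumes "t \<in> I" "f \<in> borel_measurable S" "\<And>x. \<bar>f x\<bar> \<le> c"
  shows "\<bar>\<integral>y. f y \<partial>\<kappa> t x\<bar> \<le> c"
proof -
  have "c \<ge> 0" using assms(3)[of undefined] by linarith
  then have "c * surv t x \<le> c * 1" using surv_le_1[OF assms(1), of x] by (intro mult_left_mono) auto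
  then show ?thesis using abs_kernel_integral_le[OF assms, of x] by simp
qed

lemma kernel_integral_add:
  fixes f :: "'e \<Rightarrow> real"
  assumes "s \<in> I" "t \<in> I" "f \<in> borel_measurable S" "\<And>x. \<bar>f x\<bar> \<le> c"
  shows "(\<integral>y. f y \<partial>\<kappa> (s + t) x) = (\<integral>y. \<integral>z. f z \<partial>\<kappa> t y \<partial>\<kappa> s x)"
  unfolding chapman_kolmogorov[OF assms(1,2)]
  by (rule integral_bind_kernel[OF kernel_space kernel]) (use assms in auto)

lemma surv_add:
  assumes "s \<in> I" "t \<in> I"
  shows "surv (s + t) x = (\<integral>y. surv t y \<partial>\<kappa> s x)"
  using kernel_integral_add[OF assms, of "\<lambda>_. 1" 1 x] assms by (simp add: surv_def)

lemma AE_kernel: "t \<in> I \<Longrightarrow> AE y in \<kappa> t x. y \<in> F"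
  by (rule AE_I[where N = "- F"]) (use support sets.compl_sets[OF sets_F] in \<open>auto simp: Compl_eq_Diff_UNIV\<close>)

end

section \<open>Consequences of exponential ergodicity\<close>

text \<open>\<open>ergodic\<close> is convergence in total variation of the conditioned law started
  from a point, with the conditioned mean written as a quotient so that no conditional measure has
  to be formed.\<close>

locale exp_ergodic = killed_semigroup I S F \<kappa>
  for I :: "real set" and S :: "'e measure" and F and \<kappa> +
  fixes \<alpha> :: "'e measure" and C \<gamma> :: real
  assumes \<alpha>_prob: "\<alpha> \<in> space (prob_algebra S)" and \<alpha>_F: "emeasure \<alpha> F = 1"
    and C_pos: "0 < C" and \<gamma>_pos: "0 < \<gamma>"
    and ergodic: "\<And>x t f. x \<in> F \<Longrightarrow> t \<in> I \<Longrightarrow> f \<in> borel_measurable S \<Longrightarrow> (\<And>y. \<bar>f y\<bar> \<le> 1) \<Longrightarrow>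
      \<bar>(\<integral>y. f y \<partial>\<kappa> t x) / measure (\<kappa> t x) UNIV - (\<integral>y. f y \<partial>\<alpha>)\<bar> \<le> C * exp (- \<gamma> * t)"
begin

sublocale \<alpha>: prob_space \<alpha> using \<alpha>_prob by (simp add: space_prob_algebra)

lemma sets_\<alpha> [simp, measurable_cong]: "sets \<alpha> = sets S"
  using \<alpha>_prob by (simp add: space_prob_algebra)

lemma space_\<alpha> [simp]: "space \<alpha> = UNIV"
  using sets_eq_imp_space_eq[OF sets_\<alpha>] by simp

lemma \<alpha>_subprob: "\<alpha> \<in> space (subprob_algebra S)"
  by (simp add: space_subprob_algebra \<alpha>.subprob_space_axioms)

lemma AE_\<alpha>: "AE y in \<alpha>. y \<in> F"
  by (rule \<alpha>.AE_prob_1) (simp add: \<alpha>_F measure_def)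

lemma integrable_\<alpha>:
  fixes f :: "'e \<Rightarrow> real"
  assumes "f \<in> borel_measurable S" "\<And>x. \<bar>f x\<bar> \<le> c"
  shows "integrable \<alpha> f"
  by (rule integrable_subprob_bounded[OF \<alpha>_subprob]) (use assms in auto)

lemma F_nonempty: "F \<noteq> {}" using \<alpha>_F by auto

text \<open>Multiplying \<open>ergodic\<close> by the survival probability clears the denominator;
  the estimate then holds off \<open>F\<close> too, where both sides vanish, and it can be used at
  every starting point.\<close>

lemma ergodic_bounded:
  fixes f :: "'e \<Rightarrow> real"
  assumes "t \<in> I" "f \<in> borel_measurable S" "\<And>y. \<bar>f y\<bar> \<le> c"
  shows "\<bar>(\<integral>y. f y \<partial>\<kappa> t x) - (\<integral>y. f y \<partial>\<alpha>) * surv t x\<bar> \<le> c * C * exp (- \<gamma> * t) * surv t x"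
proof (cases "x \<in> F \<and> 0 < c")
  case True
  then have c: "0 < c" and x: "x \<in> F" by auto
  have "\<bar>(\<integral>y. f y / c \<partial>\<kappa> t x) / surv t x - (\<integral>y. f y / c \<partial>\<alpha>)\<bar> \<le> C * exp (- \<gamma> * t)"
    unfolding surv_def by (rule ergodic) (use assms x c in auto)
  moreover have "(\<integral>y. f y \<partial>\<kappa> t x) - (\<integral>y. f y \<partial>\<alpha>) * surv t x
      = ((\<integral>y. f y / c \<partial>\<kappa> t x) / surv t x - (\<integral>y. f y / c \<partial>\<alpha>)) * (c * surv t x)"
    using c surv_pos[OF assms(1) x] by (simp add: field_simps)
  then have "\<bar>(\<integral>y. f y \<partial>\<kappa> t x) - (\<integral>y. f y \<partial>\<alpha>) * surv t x\<bar>
      = \<bar>(\<integral>y. f y / c \<partial>\<kappa> t x) / surv t x - (\<integral>y. f y / c \<partial>\<alpha>)\<bar> * (c * surv t x)"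
    using c surv_pos[OF assms(1) x] by (simp only: abs_mult abs_of_pos)
  ultimately have "\<bar>(\<integral>y. f y \<partial>\<kappa> t x) - (\<integral>y. f y \<partial>\<alpha>) * surv t x\<bar> \<le> C * exp (- \<gamma> * t) * (c * surv t x)"
    using c surv_pos[OF assms(1) x] by (metis mult_right_mono mult_pos_pos less_imp_le)
  also have "\<dots> = c * C * exp (- \<gamma> * t) * surv t x" by simp
  finally show ?thesis .
next
  case False
  show ?thesis
  proof (cases "0 < c")
    case True
    with False have "surv t x = 0" using surv_dead assms by auto
    then show ?thesis using abs_kernel_integral_le[OF assms, of x] by simp
  next
    case False
    then have "\<And>y. f y = 0" using assms(3) by (smt (verit))
    moreover have "c \<ge> 0" using assms(3)[of undefined] by linarith
    ultimately show ?thesis using C_pos surv_nonneg by simp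
  qed
qed

lemma ergodic_tendsto:
  fixes f :: "'e \<Rightarrow> real"
  assumes x: "x \<in> F" and f: "f \<in> borel_measurable S" "\<And>y. \<bar>f y\<bar> \<le> c"
  shows "((\<lambda>t. (\<integral>y. f y \<partial>\<kappa> t x) / surv t x) \<longlongrightarrow> (\<integral>y. f y \<partial>\<alpha>)) to_infinity"
proof (rule LIM_zero_cancel, rule Lim_null_comparison)
  show "\<forall>\<^sub>F t in to_infinity. norm ((\<integral>y. f y \<partial>\<kappa> t x) / surv t x - (\<integral>y. f y \<partial>\<alpha>)) \<le> c * C * exp (- (\<gamma> * t))"
    using eventually_time[of 0]
  proof eventually_elim
    case (elim t)
    then have p: "0 < surv t x" using surv_pos x by auto
    have "(\<integral>y. f y \<partial>\<kappa> t x) / surv t x - (\<integral>y. f y \<partial>\<alpha>) = ((\<integral>y. f y \<partial>\<kappa> t x) - (\<integral>y. f y \<partial>\<alpha>) * surv t x) / surv t x"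
      using p by (simp add: field_simps)
    then show ?case
      using ergodic_bounded[of t f c x] elim f p by (simp add: abs_divide pos_divide_le_eq)
  qed
  show "((\<lambda>t. c * C * exp (- (\<gamma> * t))) \<longlongrightarrow> 0) to_infinity"
    by (rule tendsto_mult_right_zero) (rule exp_decay[OF \<gamma>_pos])
qed

lemma to_infinity_shift: "s \<in> I \<Longrightarrow> filterlim (\<lambda>t. t + s) to_infinity to_infinity"
  unfolding filterlim_inf filterlim_principal
  by (auto simp: eventually_to_infinity filterlim_at_top) (metis add.commute diff_le_eq)

text \<open>For a fixed x in \<open>F\<close>, the mean of the function \<integral>f
  d\<open>\<kappa> s\<close> under the conditioned law at time t has two limits. Ergodicity at time
  t gives the left-hand side. By Chapman-Kolmogorov the same quantity is the conditioned mean of f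
  at time t + s times the ratio of the survival probabilities at t + s and t, which gives the
  right-hand side.\<close>

lemma quasi_stationary:
  fixes f :: "'e \<Rightarrow> real"
  assumes s: "s \<in> I" and f: "f \<in> borel_measurable S" "\<And>y. \<bar>f y\<bar> \<le> c"
  shows "(\<integral>y. \<integral>z. f z \<partial>\<kappa> s y \<partial>\<alpha>) = (\<integral>y. f y \<partial>\<alpha>) * (\<integral>y. surv s y \<partial>\<alpha>)"
proof -
  obtain x where x: "x \<in> F" using F_nonempty by auto
  have "((\<lambda>t. (\<integral>y. f y \<partial>\<kappa> (t + s) x) / surv (t + s) x) \<longlongrightarrow> (\<integral>y. f y \<partial>\<alpha>)) to_infinity"
    using filterlim_compose[OF ergodic_tendsto[OF x f] to_infinity_shift[OF s]] .
  moreover have "((\<lambda>t. (\<integral>y. surv s y \<partial>\<kappa> t x) / surv t x) \<longlongrightarrow> (\<integral>y. surv s y \<partial>\<alpha>)) to_infinity"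
    by (rule ergodic_tendsto[OF x, where c = 1]) (use s surv_nonneg surv_le_1 in auto)
  ultimately have "((\<lambda>t. (\<integral>y. f y \<partial>\<kappa> (t + s) x) / surv (t + s) x * ((\<integral>y. surv s y \<partial>\<kappa> t x) / surv t x))
      \<longlongrightarrow> (\<integral>y. f y \<partial>\<alpha>) * (\<integral>y. surv s y \<partial>\<alpha>)) to_infinity"
    by (rule tendsto_mult)
  moreover have "\<forall>\<^sub>F t in to_infinity.
     (\<integral>y. f y \<partial>\<kappa> (t + s) x) / surv (t + s) x * ((\<integral>y. surv s y \<partial>\<kappa> t x) / surv t x)
      = (\<integral>y. \<integral>z. f z \<partial>\<kappa> s y \<partial>\<kappa> t x) / surv t x"
    using eventually_time[of 0]
  proof eventually_elim
    case (elim t)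
    then have "surv (t + s) x \<noteq> 0" using surv_pos[of "t + s" x] x s by auto
    then show ?case using elim s f surv_add[of t s x] kernel_integral_add[of t s f c x] by simp
  qed
  ultimately have "((\<lambda>t. (\<integral>y. \<integral>z. f z \<partial>\<kappa> s y \<partial>\<kappa> t x) / surv t x)
      \<longlongrightarrow> (\<integral>y. f y \<partial>\<alpha>) * (\<integral>y. surv s y \<partial>\<alpha>)) to_infinity"
    by (rule Lim_transform_eventually)
  moreover have "((\<lambda>t. (\<integral>y. \<integral>z. f z \<partial>\<kappa> s y \<partial>\<kappa> t x) / surv t x)
      \<longlongrightarrow> (\<integral>y. \<integral>z. f z \<partial>\<kappa> s y \<partial>\<alpha>)) to_infinity"
    by (rule ergodic_tendsto[OF x, where c = c]) (use s f kernel_integral_bounded in auto)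
  ultimately show ?thesis
    using tendsto_unique[OF to_infinity_neq_bot] by blast
qed

section \<open>Decay rate and right eigenfunction\<close>

definition rate :: real where
  "rate = - ln (\<integral>y. surv 1 y \<partial>\<alpha>)"

lemma integrable_surv_\<alpha>: "t \<in> I \<Longrightarrow> integrable \<alpha> (surv t)"
  by (rule integrable_\<alpha>[where c = 1]) (auto simp: surv_nonneg surv_le_1)

lemma surv_\<alpha>_pos: "t \<in> I \<Longrightarrow> 0 < (\<integral>y. surv t y \<partial>\<alpha>)"
  using AE_\<alpha> surv_pos by (intro \<alpha>.expectation_pos integrable_surv_\<alpha>) (auto elim!: eventually_mono)

text \<open>Quasi-stationarity makes the survival probability from \<alpha> multiplicative in time,
  so its negative logarithm is additive; being non-negative as well, it is linear by
  \<open>additive_monotone_linear\<close>. Non-negativity takes the place of regularity in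
  t.\<close>

lemma surv_\<alpha>: assumes t: "t \<in> I" shows "(\<integral>y. surv t y \<partial>\<alpha>) = exp (- rate * t)"
proof -
  define g where "g t = - ln (\<integral>y. surv t y \<partial>\<alpha>)" for t
  have "g t = g 1 * t"
  proof (rule additive_monotone_linear[OF _ _ t])
    fix s t assume st: "s \<in> I" "t \<in> I"
    have "(\<integral>y. surv (s + t) y \<partial>\<alpha>) = (\<integral>y. surv t y \<partial>\<alpha>) * (\<integral>y. surv s y \<partial>\<alpha>)"
      using quasi_stationary[OF st(1), of "surv t" 1] st surv_add[OF st] surv_nonneg surv_le_1 by simp
    then show "g (s + t) = g s + g t"
      using surv_\<alpha>_pos[OF st(1)] surv_\<alpha>_pos[OF st(2)] by (simp add: g_def ln_mult)
  next
    fix t assume t: "t \<in> I"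
    have "(\<integral>y. surv t y \<partial>\<alpha>) \<le> (\<integral>y. 1 \<partial>\<alpha>)"
      by (intro integral_mono integrable_surv_\<alpha>) (auto simp: t surv_le_1)
    then show "0 \<le> g t"
      using surv_\<alpha>_pos[OF t] \<alpha>.prob_space by (simp add: g_def)
  qed
  then have "ln (\<integral>y. surv t y \<partial>\<alpha>) = - rate * t" by (simp add: g_def rate_def)
  then show ?thesis using surv_\<alpha>_pos[OF t] by (metis exp_ln)
qed

lemma rate_nonneg: "0 \<le> rate"
proof -
  have "(\<integral>y. surv 1 y \<partial>\<alpha>) \<le> (\<integral>y. 1 \<partial>\<alpha>)"
    by (intro integral_mono integrable_surv_\<alpha>) (auto simp: surv_le_1)
  then show ?thesis
    using surv_\<alpha>_pos[of 1] \<alpha>.prob_space by (simp add: rate_def)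
qed

text \<open>The normalisation for which the mean under \<alpha> is 1 at every time, see
  \<open>resc_\<alpha>\<close>.\<close>

definition resc :: "real \<Rightarrow> 'e \<Rightarrow> real" where
  "resc t x = exp (rate * t) * surv t x"

lemma resc_nonneg: "0 \<le> resc t x" by (simp add: resc_def surv_nonneg)

lemma measurable_resc [measurable]: "t \<in> I \<Longrightarrow> resc t \<in> borel_measurable S"
  unfolding resc_def[abs_def] by measurable

lemma resc_add: "s \<in> I \<Longrightarrow> t \<in> I \<Longrightarrow> resc (s + t) x = exp (rate * s) * (\<integral>y. resc t y \<partial>\<kappa> s x)"
  by (simp add: resc_def surv_add exp_add distrib_left)

lemma resc_\<alpha>: "t \<in> I \<Longrightarrow> (\<integral>y. resc t y \<partial>\<alpha>) = 1"
  by (simp add: resc_def surv_\<alpha> flip: exp_add)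

text \<open>By \<open>resc_add\<close>, \<open>resc (s + t) x\<close> is exp (rate s) times the
  integral of \<open>resc t\<close> against the killed law at time s; ergodicity replaces this
  integral by the \<alpha>-mean, which is 1, times the survival probability. The error is relative
  to \<open>resc s x\<close>: this allows the bounds over successive steps to be multiplied and
  later keeps the limit positive.\<close>

lemma resc_increment:
  assumes "s \<in> I" "t \<in> I" "\<And>y. resc t y \<le> m"
  shows "\<bar>resc (s + t) x - resc s x\<bar> \<le> m * C * exp (- \<gamma> * s) * resc s x"
proof -
  have "\<bar>(\<integral>y. resc t y \<partial>\<kappa> s x) - surv s x\<bar> \<le> m * C * exp (- \<gamma> * s) * surv s x"
    using ergodic_bounded[of s "resc t" m x] assms resc_nonneg by (simp add: resc_\<alpha>)
  then have "exp (rate * s) * \<bar>(\<integral>y. resc t y \<partial>\<kappa> s x) - surv s x\<bar> \<le> exp (rate * s) * (m * C * exp (- \<gamma> * s) * surv s x)"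
    by (intro mult_left_mono) auto
  moreover have "exp (rate * s) * \<bar>(\<integral>y. resc t y \<partial>\<kappa> s x) - surv s x\<bar> = \<bar>resc (s + t) x - resc s x\<bar>"
    by (subst abs_of_pos[symmetric, of "exp (rate * s)"], simp, subst abs_mult[symmetric])
      (simp add: resc_add assms right_diff_distrib resc_def[of s x])
  moreover have "exp (rate * s) * (m * C * exp (- \<gamma> * s) * surv s x) = m * C * exp (- \<gamma> * s) * resc s x"
    by (simp add: resc_def)
  ultimately show ?thesis by linarith
qed

text \<open>Over a time step of length at most 1 the rescaled survival probability is trivially at most
  \<open>exp rate\<close>, so that \<open>resc_increment\<close> multiplies it by a factor \<open>1 + O(exp (- \<gamma> s))\<close>, and
  the product of these factors converges.\<close>

lemma resc_bounded: "\<exists>B>0. \<forall>t\<in>I. \<forall>x. resc t x \<le> B"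
proof -
  define m where "m = exp rate"
  define q where "q = exp (- \<gamma>)"
  have q: "0 < q" "q < 1" using \<gamma>_pos by (auto simp: q_def)
  have m: "resc s x \<le> m" if "s \<in> I" "s \<le> 1" for s x
  proof -
    have "resc s x \<le> exp (rate * s) * 1"
      unfolding resc_def using surv_le_1[OF that(1)] by (intro mult_left_mono) auto
    also have "\<dots> \<le> exp rate" using that rate_nonneg by (simp add: mult_left_le)
    finally show ?thesis by (simp add: m_def)
  qed
  have m0: "m > 0" by (simp add: m_def)
  have step: "resc (s + t) x \<le> (1 + m * C * exp (- \<gamma> * s)) * resc s x" if "s \<in> I" "t \<in> I" "t \<le> 1" for s t x
    using resc_increment[OF that(1,2), of m x] m that by (simp add: algebra_simps abs_le_iff)
  have n: "resc (real n) x \<le> exp (\<Sum>k<n. m * C * q ^ k)" for n x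
  proof (induction n)
    case 0
    then show ?case using surv_le_1[of 0 x] by (simp add: resc_def)
  next
    case (Suc n)
    have e: "exp (- \<gamma> * real n) = q ^ n" by (simp add: q_def mult.commute flip: exp_of_nat_mult)
    have "resc (real (Suc n)) x \<le> (1 + m * C * q ^ n) * resc (real n) x"
      using step[of "real n" 1 x] unfolding e by (simp add: add.commute)
    also have "\<dots> \<le> exp (m * C * q ^ n) * exp (\<Sum>k<n. m * C * q ^ k)"
      using Suc m0 C_pos q by (intro mult_mono resc_nonneg) (auto simp: exp_ge_add_one_self_aux)
    finally show ?case by (simp add: add.commute exp_add)
  qed
  \<comment> \<open>The exponential bounds the product over the integer steps through the full
    geometric series; the factor \<open>1 + m * C\<close> pays for the remaining fractional
    step.\<close>
  define B where "B = (1 + m * C) * exp (m * C * (1 / (1 - q)))"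
  have "resc t x \<le> B" if t: "t \<in> I" for t x
  proof -
    define k where "k = nat \<lfloor>t\<rfloor>"
    have k: "real k \<le> t" "t - real k \<le> 1" using time_nonneg[OF t] unfolding k_def by linarith+
    have "(\<Sum>j<k. m * C * q ^ j) = m * C * (\<Sum>j<k. q ^ j)" by (simp add: sum_distrib_left)
    also have "(\<Sum>j<k. q ^ j) \<le> 1 / (1 - q)"
      using sum_le_suminf[OF summable_geometric[of q], of "{..<k}"] suminf_geometric[of q] q by auto
    finally have le: "(\<Sum>j<k. m * C * q ^ j) \<le> m * C * (1 / (1 - q))" using m0 C_pos by auto
    have "resc t x \<le> (1 + m * C * exp (- \<gamma> * real k)) * resc (real k) x"
      using step[of "real k" "t - real k" x] k time_diff[OF _ t] by simp
    also have "\<dots> \<le> (1 + m * C) * exp (m * C * (1 / (1 - q)))"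
      using n[of k x] le m0 C_pos \<gamma>_pos
      by (intro mult_mono resc_nonneg) (auto intro: order_trans)
    finally show ?thesis by (simp add: B_def)
  qed
  moreover have "0 < B" using m0 C_pos by (auto simp: B_def intro!: mult_pos_pos add_pos_pos)
  ultimately show ?thesis by blast
qed

definition resc_sup :: real where
  "resc_sup = (SOME B. 0 < B \<and> (\<forall>t\<in>I. \<forall>x. resc t x \<le> B))"

lemma resc_sup_pos: "0 < resc_sup" and resc_le: "t \<in> I \<Longrightarrow> resc t x \<le> resc_sup"
  using someI_ex[OF resc_bounded[unfolded Bex_def, simplified]] unfolding resc_sup_def by blast+

text \<open>Relative error of \<open>resc t\<close> against all its later values, uniform in the
  starting point.\<close>

definition err :: "real \<Rightarrow> real" where
  "err t = resc_sup * C * exp (- (\<gamma> * t))"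

lemma err_nonneg: "0 \<le> err t" using resc_sup_pos C_pos by (simp add: err_def)

lemma err_tendsto_0: "(err \<longlongrightarrow> 0) to_infinity"
  unfolding err_def[abs_def] by (intro tendsto_mult_right_zero exp_decay \<gamma>_pos)

lemma resc_later:
  assumes "s \<in> I" "t \<in> I" "s \<le> t"
  shows "\<bar>resc t x - resc s x\<bar> \<le> err s * resc s x"
  using resc_increment[OF assms(1) time_diff[OF assms], of resc_sup x] resc_le[OF time_diff[OF assms]]
  by (simp add: err_def)

text \<open>The limit runs along the integers so that measurability is that of a limit of a
  sequence; \<open>resc_tendsto\<close> extends it to all times of \<open>I\<close>.\<close>

definition eta :: "'e \<Rightarrow> real" where
  "eta x = lim (\<lambda>n. resc (real n) x)"

lemma resc_seq_tendsto: "(\<lambda>n. resc (real n) x) \<longlonglongrightarrow> eta x"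
proof -
  have "Cauchy (\<lambda>n. resc (real n) x)"
  proof (rule metric_CauchyI)
    fix e :: real assume e: "0 < e"
    have "(\<lambda>n. err (real n) * resc_sup) \<longlonglongrightarrow> 0"
      by (rule tendsto_mult_left_zero) (rule filterlim_compose[OF err_tendsto_0 sequence_to_infinity])
    then have "\<forall>\<^sub>F n in sequentially. err (real n) * resc_sup < e / 2"
      using e by (intro order_tendstoD) auto
    then obtain N where N: "err (real N) * resc_sup < e / 2"
      by (auto simp: eventually_sequentially)
    have "dist (resc (real n) x) (resc (real N) x) < e / 2" if "N \<le> n" for n
    proof -
      have "\<bar>resc (real n) x - resc (real N) x\<bar> \<le> err (real N) * resc (real N) x"
        using resc_later[of "real N" "real n" x] that by simp
      also have "\<dots> \<le> err (real N) * resc_sup"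
        using err_nonneg resc_le by (intro mult_left_mono) auto
      finally show ?thesis using N by (simp add: dist_real_def)
    qed
    then show "\<exists>M. \<forall>m\<ge>M. \<forall>n\<ge>M. dist (resc (real m) x) (resc (real n) x) < e"
      using dist_triangle_half_l by blast
  qed
  then show ?thesis
    unfolding eta_def using Cauchy_convergent convergent_LIMSEQ_iff by blast
qed

lemma measurable_eta [measurable]: "eta \<in> borel_measurable S"
  by (rule borel_measurable_LIMSEQ_real[OF resc_seq_tendsto]) auto

lemma eta_nonneg: "0 \<le> eta x"
  by (rule LIMSEQ_le_const[OF resc_seq_tendsto]) (auto simp: resc_nonneg)

lemma eta_le: "eta x \<le> resc_sup"
  by (rule LIMSEQ_le_const2[OF resc_seq_tendsto]) (auto simp: resc_le)

lemma eta_dead: "x \<notin> F \<Longrightarrow> eta x = 0"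
  using resc_seq_tendsto[of x] by (simp add: resc_def surv_dead LIMSEQ_const_iff)

lemma eta_resc_relative:
  assumes "t \<in> I" shows "\<bar>eta x - resc t x\<bar> \<le> err t * resc t x"
proof (rule LIMSEQ_le_const2)
  show "(\<lambda>n. \<bar>resc (real n) x - resc t x\<bar>) \<longlonglongrightarrow> \<bar>eta x - resc t x\<bar>"
    by (intro tendsto_intros resc_seq_tendsto)
  show "\<exists>N. \<forall>n\<ge>N. \<bar>resc (real n) x - resc t x\<bar> \<le> err t * resc t x"
    using resc_later[OF assms] by (metis linorder_linear nat_le_real_less less_eq_real_def not_less
      of_nat_le_iff real_arch_simple time_of_nat order_trans)
qed

lemma eta_resc:
  assumes "t \<in> I" shows "\<bar>resc t x - eta x\<bar> \<le> err t * resc_sup"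
  using eta_resc_relative[OF assms, of x] mult_left_mono[OF resc_le[OF assms, of x] err_nonneg[of t]]
  by linarith

lemma resc_tendsto: "((\<lambda>t. resc t x) \<longlongrightarrow> eta x) to_infinity"
proof (rule LIM_zero_cancel, rule Lim_null_comparison)
  show "\<forall>\<^sub>F t in to_infinity. norm (resc t x - eta x) \<le> err t * resc_sup"
    using eventually_time[of 0] by eventually_elim (use eta_resc in auto)
  show "((\<lambda>t. err t * resc_sup) \<longlongrightarrow> 0) to_infinity"
    by (rule tendsto_mult_left_zero[OF err_tendsto_0])
qed

text \<open>Since the error in \<open>eta_resc_relative\<close> is relative, as soon as
  \<open>err t < 1\<close> the limit keeps a positive fraction of \<open>resc t x\<close>.\<close>

lemma eta_pos:
  assumes x: "x \<in> F" shows "0 < eta x"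
proof -
  have "\<forall>\<^sub>F t in to_infinity. err t < 1"
    by (rule order_tendstoD[OF err_tendsto_0]) simp
  then have "\<forall>\<^sub>F t in to_infinity. t \<in> I \<and> err t < 1"
    using eventually_time[of 0] by eventually_elim auto
  then obtain t where t: "t \<in> I" "err t < 1"
    using eventually_happens to_infinity_neq_bot by blast
  have "0 < resc t x" using surv_pos[OF t(1) x] by (simp add: resc_def)
  then have "err t * resc t x < resc t x" using t by simp
  then show ?thesis using eta_resc_relative[OF t(1), of x] by linarith
qed

lemma abs_eta: "\<bar>eta x\<bar> \<le> resc_sup" using eta_nonneg[of x] eta_le[of x] by simp

lemma abs_resc: "t \<in> I \<Longrightarrow> \<bar>resc t x\<bar> \<le> resc_sup" using resc_nonneg[of t x] resc_le[of t x] by simp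

text \<open>The bound is proportional to the mass of \<open>N\<close>, so it survives division by
  that mass when \<open>N\<close> is a killed law at a late time.\<close>

lemma integral_resc_diff:
  fixes f :: "'e \<Rightarrow> real"
  assumes N: "N \<in> space (subprob_algebra S)" and t: "t \<in> I" and f: "f \<in> borel_measurable S" "\<And>y. \<bar>f y\<bar> \<le> c"
  shows "\<bar>(\<integral>y. f y * resc t y \<partial>N) - (\<integral>y. f y * eta y \<partial>N)\<bar> \<le> c * (err t * resc_sup) * measure N UNIV"
proof -
  have c: "0 \<le> c" using f(2)[of undefined] by linarith
  show ?thesis
    using diff_integral_subprob_le[OF N, where f = "\<lambda>y. f y * resc t y" and g = "\<lambda>y. f y * eta y"
      and c = "c * resc_sup" and d = "c * resc_sup" and \<delta> = "c * (err t * resc_sup)"] t f c abs_eta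
    by (simp add: abs_mult abs_resc eta_resc mult_mono flip: right_diff_distrib)
qed

lemma integral_resc_tendsto:
  fixes f :: "'e \<Rightarrow> real"
  assumes N: "N \<in> space (subprob_algebra S)" and f: "f \<in> borel_measurable S" "\<And>y. \<bar>f y\<bar> \<le> c"
  shows "((\<lambda>t. \<integral>y. f y * resc t y \<partial>N) \<longlongrightarrow> (\<integral>y. f y * eta y \<partial>N)) to_infinity"
proof (rule LIM_zero_cancel, rule Lim_null_comparison)
  show "\<forall>\<^sub>F t in to_infinity. norm ((\<integral>y. f y * resc t y \<partial>N) - (\<integral>y. f y * eta y \<partial>N)) \<le> c * (err t * resc_sup) * measure N UNIV"
    using eventually_time[of 0] by eventually_elim (use integral_resc_diff[OF N _ f] in auto)
  show "((\<lambda>t. c * (err t * resc_sup) * measure N UNIV) \<longlongrightarrow> 0) to_infinity"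
    by (intro tendsto_mult_left_zero tendsto_mult_right_zero err_tendsto_0)
qed

lemma \<alpha>_eta: "(\<integral>y. eta y \<partial>\<alpha>) = 1"
proof -
  have "((\<lambda>t. \<integral>y. 1 * resc t y \<partial>\<alpha>) \<longlongrightarrow> (\<integral>y. 1 * eta y \<partial>\<alpha>)) to_infinity"
    by (rule integral_resc_tendsto[OF \<alpha>_subprob, where c = 1]) auto
  moreover have "((\<lambda>t. \<integral>y. 1 * resc t y \<partial>\<alpha>) \<longlongrightarrow> 1) to_infinity"
    by (rule tendsto_eventually) (use eventually_time[of 0] in \<open>eventually_elim, auto simp: resc_\<alpha>\<close>)
  ultimately show ?thesis using tendsto_unique[OF to_infinity_neq_bot] by force
qed

text \<open>Both sides are limits of the two sides of \<open>resc_add\<close> as the second time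
  tends to infinity.\<close>

lemma eta_eigenfunction:
  assumes s: "s \<in> I" shows "exp (rate * s) * (\<integral>y. eta y \<partial>\<kappa> s x) = eta x"
proof -
  have "((\<lambda>t. \<integral>y. 1 * resc t y \<partial>\<kappa> s x) \<longlongrightarrow> (\<integral>y. 1 * eta y \<partial>\<kappa> s x)) to_infinity"
    by (rule integral_resc_tendsto[OF kernel_space[OF s], where c = 1]) auto
  then have "((\<lambda>t. exp (rate * s) * (\<integral>y. resc t y \<partial>\<kappa> s x)) \<longlongrightarrow> exp (rate * s) * (\<integral>y. eta y \<partial>\<kappa> s x)) to_infinity"
    by (intro tendsto_mult_left) simp
  moreover have "((\<lambda>t. resc (t + s) x) \<longlongrightarrow> eta x) to_infinity"
    using filterlim_compose[OF resc_tendsto to_infinity_shift[OF s]] .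
  then have "((\<lambda>t. exp (rate * s) * (\<integral>y. resc t y \<partial>\<kappa> s x)) \<longlongrightarrow> eta x) to_infinity"
    by (rule Lim_transform_eventually)
      (use eventually_time[of 0] in \<open>eventually_elim, auto simp: s add.commute simp flip: resc_add\<close>)
  ultimately show ?thesis using tendsto_unique[OF to_infinity_neq_bot] by blast
qed

end

section \<open>Conditioning on survival up to a distant horizon\<close>

context exp_ergodic
begin

text \<open>The product filter asks that K and L be large without any relation between them. In the
  auxiliary quotient \<open>g\<close> the numerator is rescaled by exp (rate L) and the denominator
  is survival until K only: the convergence of \<open>resc L\<close> to \<open>eta\<close> is
  uniform and turns the numerator into the killed integral of f \<open>eta\<close>, and ergodicity
  at time K then gives the limit. The remaining factor \<open>resc K x / resc (K + L) x\<close>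
  tends to 1.\<close>

lemma conditioned_tendsto:
  fixes f :: "'e \<Rightarrow> real"
  assumes x: "x \<in> F" and f: "f \<in> borel_measurable S" "\<And>y. \<bar>f y\<bar> \<le> c"
  shows "((\<lambda>(K, L). (\<integral>y. f y * surv L y \<partial>\<kappa> K x) / surv (K + L) x) \<longlongrightarrow> (\<integral>y. f y * eta y \<partial>\<alpha>))
    (to_infinity \<times>\<^sub>F to_infinity)"
proof -
  let ?G = "to_infinity \<times>\<^sub>F to_infinity"
  have c: "0 \<le> c" using f(2)[of undefined] by linarith
  have fst: "filterlim fst to_infinity ?G" and snd: "filterlim snd to_infinity ?G"
    by (rule filterlim_fst filterlim_snd)+
  have ev: "\<forall>\<^sub>F p in ?G. fst p \<in> I \<and> snd p \<in> I"
    using fst[unfolded filterlim_iff, rule_format, OF eventually_time[of 0]]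
      snd[unfolded filterlim_iff, rule_format, OF eventually_time[of 0]] by eventually_elim auto
  have sum: "filterlim (\<lambda>p. fst p + snd p) to_infinity ?G"
    unfolding filterlim_iff
  proof safe
    fix P :: "real \<Rightarrow> bool" assume "eventually P to_infinity"
    then obtain N where N: "\<And>t. t \<in> I \<Longrightarrow> N \<le> t \<Longrightarrow> P t" by (auto simp: eventually_to_infinity)
    show "\<forall>\<^sub>F p in ?G. P (fst p + snd p)"
      using fst[unfolded filterlim_iff, rule_format, OF eventually_time[of N]]
        snd[unfolded filterlim_iff, rule_format, OF eventually_time[of 0]]
    proof eventually_elim
      case (elim p)
      then show ?case by (intro N) auto
    qed
  qed
  define g where "g p = (\<integral>y. f y * resc (snd p) y \<partial>\<kappa> (fst p) x) / surv (fst p) x" for p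
  have g: "(g \<longlongrightarrow> (\<integral>y. f y * eta y \<partial>\<alpha>)) ?G"
  proof (rule Lim_transform)
    have "((\<lambda>t. (\<integral>y. f y * eta y \<partial>\<kappa> t x) / surv t x) \<longlongrightarrow> (\<integral>y. f y * eta y \<partial>\<alpha>)) to_infinity"
      by (rule ergodic_tendsto[OF x, where c = "c * resc_sup"])
        (use f c abs_eta in \<open>auto simp: abs_mult intro!: mult_mono\<close>)
    then show "((\<lambda>p. (\<integral>y. f y * eta y \<partial>\<kappa> (fst p) x) / surv (fst p) x) \<longlongrightarrow> (\<integral>y. f y * eta y \<partial>\<alpha>)) ?G"
      using fst by (rule filterlim_compose)
    show "((\<lambda>p. g p - (\<integral>y. f y * eta y \<partial>\<kappa> (fst p) x) / surv (fst p) x) \<longlongrightarrow> 0) ?G"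
    proof (rule Lim_null_comparison)
      show "\<forall>\<^sub>F p in ?G. norm (g p - (\<integral>y. f y * eta y \<partial>\<kappa> (fst p) x) / surv (fst p) x) \<le> c * (err (snd p) * resc_sup)"
        using ev
      proof eventually_elim
        case (elim p)
        have p: "0 < surv (fst p) x" using elim x surv_pos by auto
        have "\<bar>(\<integral>y. f y * resc (snd p) y \<partial>\<kappa> (fst p) x) - (\<integral>y. f y * eta y \<partial>\<kappa> (fst p) x)\<bar>
            \<le> c * (err (snd p) * resc_sup) * surv (fst p) x"
          unfolding surv_def by (rule integral_resc_diff) (use elim f kernel_space in auto)
        then show ?case
          using p by (simp add: g_def abs_divide pos_divide_le_eq flip: diff_divide_distrib)
      qed
      show "((\<lambda>p. c * (err (snd p) * resc_sup)) \<longlongrightarrow> 0) ?G"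
        by (intro tendsto_mult_left_zero tendsto_mult_right_zero filterlim_compose[OF err_tendsto_0 snd])
    qed
  qed
  have "((\<lambda>p. g p * (resc (fst p) x / resc (fst p + snd p) x)) \<longlongrightarrow> (\<integral>y. f y * eta y \<partial>\<alpha>) * (eta x / eta x)) ?G"
    using eta_pos[OF x]
    by (intro tendsto_mult g tendsto_divide filterlim_compose[OF resc_tendsto fst] filterlim_compose[OF resc_tendsto sum]) auto
  moreover have "\<forall>\<^sub>F p in ?G. g p * (resc (fst p) x / resc (fst p + snd p) x)
       = (\<integral>y. f y * surv (snd p) y \<partial>\<kappa> (fst p) x) / surv (fst p + snd p) x"
    using ev
  proof eventually_elim
    case (elim p)
    then have p: "0 < surv (fst p) x" "0 < surv (fst p + snd p) x" using x surv_pos by auto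
    have "(\<integral>y. f y * resc (snd p) y \<partial>\<kappa> (fst p) x) = exp (rate * snd p) * (\<integral>y. f y * surv (snd p) y \<partial>\<kappa> (fst p) x)"
      by (simp add: resc_def mult.left_commute flip: integral_mult_right_zero)
    then show ?case using p by (simp add: g_def resc_def distrib_left exp_add)
  qed
  ultimately have "((\<lambda>p. (\<integral>y. f y * surv (snd p) y \<partial>\<kappa> (fst p) x) / surv (fst p + snd p) x) \<longlongrightarrow> (\<integral>y. f y * eta y \<partial>\<alpha>)) ?G"
    using eta_pos[OF x] by (simp add: filterlim_cong)
  then show ?thesis by (simp add: case_prod_unfold)
qed

section \<open>The Q-process and its invariant law\<close>

text \<open>Doob's h-transform of the killed kernel with h = \<open>eta\<close>; the eigenvalue
  equation gives it mass 1 from points of \<open>F\<close>. Off \<open>F\<close> the division by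
  \<open>eta x = 0\<close> makes it the null measure.\<close>

definition qker :: "real \<Rightarrow> 'e \<Rightarrow> 'e measure" where
  "qker t x = density (\<kappa> t x) (\<lambda>y. ennreal (exp (rate * t) * eta y / eta x))"

lemma emeasure_qker:
  assumes t: "t \<in> I" and B: "B \<in> sets S"
  shows "emeasure (qker t x) B = ennreal (exp (rate * t) / eta x * (\<integral>y. indicator B y * eta y \<partial>\<kappa> t x))"
proof -
  have [measurable]: "B \<in> sets S" by fact
  have int: "integrable (\<kappa> t x) (\<lambda>y. indicator B y * eta y)"
    by (rule integrable_kernel[OF t, where c = resc_sup])
      (use abs_eta resc_sup_pos in \<open>auto simp: indicator_def less_imp_le\<close>)
  have "emeasure (qker t x) B = (\<integral>\<^sup>+y. ennreal (exp (rate * t) * eta y / eta x) * indicator B y \<partial>\<kappa> t x)"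
    unfolding qker_def by (rule emeasure_density) (use t in auto)
  also have "\<dots> = (\<integral>\<^sup>+y. ennreal (exp (rate * t) / eta x * (indicator B y * eta y)) \<partial>\<kappa> t x)"
    by (intro nn_integral_cong) (auto simp: indicator_def)
  also have "\<dots> = ennreal (\<integral>y. exp (rate * t) / eta x * (indicator B y * eta y) \<partial>\<kappa> t x)"
    by (intro nn_integral_eq_integral integrable_mult_right int AE_I2) (auto simp: eta_nonneg)
  finally show ?thesis by simp
qed

lemma measure_qker:
  assumes "t \<in> I" "B \<in> sets S"
  shows "measure (qker t x) B = exp (rate * t) / eta x * (\<integral>y. indicator B y * eta y \<partial>\<kappa> t x)"
  unfolding measure_def emeasure_qker[OF assms] by (auto simp: eta_nonneg intro!: enn2real_ennreal)

lemma qker_prob: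
  assumes t: "t \<in> I" and x: "x \<in> F"
  shows "qker t x \<in> space (prob_algebra S)" and "emeasure (qker t x) F = 1"
proof -
  have "emeasure (qker t x) UNIV = 1"
    using eta_eigenfunction[OF t, of x] eta_pos[OF x] emeasure_qker[OF t, of UNIV x] sets.top[of S]
    by (simp add: ac_simps)
  then show "qker t x \<in> space (prob_algebra S)"
    using t by (auto simp: space_prob_algebra qker_def intro!: prob_spaceI)
  have "(\<integral>y. indicator F y * eta y \<partial>\<kappa> t x) = (\<integral>y. eta y \<partial>\<kappa> t x)"
    by (intro Bochner_Integration.integral_cong) (auto simp: indicator_def eta_dead)
  then show "emeasure (qker t x) F = 1"
    using eta_eigenfunction[OF t, of x] eta_pos[OF x] emeasure_qker[OF t sets_F, of x]
    by (simp add: ac_simps)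
qed

text \<open>Rescaling the numerator by exp (rate (T - t)) and the denominator by exp (rate T) leaves
  the factor exp (rate t) of \<open>qker\<close>, and both rescaled quantities converge to their
  counterparts with \<open>eta\<close>.\<close>

lemma qker_limit:
  assumes t: "t \<in> I" and x: "x \<in> F" and B: "B \<in> sets S"
  shows "((\<lambda>T. (\<integral>y. indicator B y * surv (T - t) y \<partial>\<kappa> t x) / surv T x) \<longlongrightarrow> measure (qker t x) B) to_infinity"
proof -
  have "filterlim (\<lambda>T. T - t) to_infinity to_infinity"
    unfolding filterlim_iff
  proof safe
    fix P :: "real \<Rightarrow> bool" assume "eventually P to_infinity"
    then obtain N where N: "\<And>s. s \<in> I \<Longrightarrow> N \<le> s \<Longrightarrow> P s" by (auto simp: eventually_to_infinity)
    show "\<forall>\<^sub>F T in to_infinity. P (T - t)"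
      using eventually_time[of "max t (N + t)"]
      by eventually_elim (intro N, auto intro: time_diff t)
  qed
  then have "((\<lambda>T. \<integral>y. indicator B y * resc (T - t) y \<partial>\<kappa> t x) \<longlongrightarrow> (\<integral>y. indicator B y * eta y \<partial>\<kappa> t x)) to_infinity"
    by (rule filterlim_compose[OF integral_resc_tendsto[OF kernel_space[OF t], where c = 1], rotated 2])
      (use B in \<open>auto simp: indicator_def\<close>)
  then have "((\<lambda>T. exp (rate * t) * (\<integral>y. indicator B y * resc (T - t) y \<partial>\<kappa> t x) / resc T x)
     \<longlongrightarrow> exp (rate * t) * (\<integral>y. indicator B y * eta y \<partial>\<kappa> t x) / eta x) to_infinity"
    using eta_pos[OF x] by (intro tendsto_divide tendsto_mult_left resc_tendsto) auto
  moreover have "\<forall>\<^sub>F T in to_infinity. exp (rate * t) * (\<integral>y. indicator B y * resc (T - t) y \<partial>\<kappa> t x) / resc T x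
      = (\<integral>y. indicator B y * surv (T - t) y \<partial>\<kappa> t x) / surv T x"
    using eventually_time[of t]
  proof eventually_elim
    case (elim T)
    have "(\<integral>y. indicator B y * resc (T - t) y \<partial>\<kappa> t x) = exp (rate * (T - t)) * (\<integral>y. indicator B y * surv (T - t) y \<partial>\<kappa> t x)"
      by (simp add: resc_def mult.left_commute flip: integral_mult_right_zero)
    then show ?case by (simp add: resc_def right_diff_distrib exp_diff)
  qed
  ultimately show ?thesis
    using measure_qker[OF t B, of x] by (simp add: filterlim_cong)
qed

definition beta :: "'e measure" where
  "beta = density \<alpha> (\<lambda>y. ennreal (eta y))"

lemma sets_beta [simp, measurable_cong]: "sets beta = sets S"
  by (simp add: beta_def)

lemma integral_beta:
  fixes f :: "'e \<Rightarrow> real"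
  assumes "f \<in> borel_measurable S"
  shows "(\<integral>y. f y \<partial>beta) = (\<integral>y. f y * eta y \<partial>\<alpha>)"
  unfolding beta_def using assms
  by (subst integral_density) (auto simp: eta_nonneg mult.commute)

lemma emeasure_beta:
  assumes B: "B \<in> sets S"
  shows "emeasure beta B = ennreal (\<integral>y. indicator B y * eta y \<partial>\<alpha>)"
proof -
  have [measurable]: "B \<in> sets S" by fact
  have int: "integrable \<alpha> (\<lambda>y. indicator B y * eta y)"
    by (rule integrable_\<alpha>[where c = resc_sup])
      (use abs_eta resc_sup_pos in \<open>auto simp: indicator_def less_imp_le\<close>)
  have "emeasure beta B = (\<integral>\<^sup>+y. ennreal (eta y) * indicator B y \<partial>\<alpha>)"
    unfolding beta_def by (rule emeasure_density) auto
  also have "\<dots> = (\<integral>\<^sup>+y. ennreal (indicator B y * eta y) \<partial>\<alpha>)"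
    by (intro nn_integral_cong) (auto simp: indicator_def)
  also have "\<dots> = ennreal (\<integral>y. indicator B y * eta y \<partial>\<alpha>)"
    by (intro nn_integral_eq_integral int AE_I2) (auto simp: eta_nonneg)
  finally show ?thesis .
qed

lemma measure_beta: "B \<in> sets S \<Longrightarrow> measure beta B = (\<integral>y. indicator B y * eta y \<partial>\<alpha>)"
  unfolding measure_def emeasure_beta by (auto simp: eta_nonneg intro!: enn2real_ennreal)

lemma beta_prob: "beta \<in> space (prob_algebra S)" and beta_F: "emeasure beta F = 1"
proof -
  have "emeasure beta UNIV = 1"
    using emeasure_beta[of UNIV] sets.top[of S] \<alpha>_eta by simp
  then show "beta \<in> space (prob_algebra S)"
    by (auto simp: space_prob_algebra beta_def intro!: prob_spaceI)
  have "(\<integral>y. indicator F y * eta y \<partial>\<alpha>) = (\<integral>y. eta y \<partial>\<alpha>)"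
    by (intro Bochner_Integration.integral_cong) (auto simp: indicator_def eta_dead)
  then show "emeasure beta F = 1" using emeasure_beta[OF sets_F] \<alpha>_eta by simp
qed

lemma measurable_measure_qker:
  assumes t: "t \<in> I" and B: "B \<in> sets S"
  shows "(\<lambda>x. measure (qker t x) B) \<in> borel_measurable S"
  unfolding measure_qker[OF assms] using t B by measurable

text \<open>The density \<open>eta x\<close> of \<open>beta\<close> cancels the denominator of
  \<open>qker t x\<close>. Quasi-stationarity applied to the indicator of B times \<open>eta\<close>
  then produces a factor exp (- rate t), which cancels the remaining exp (rate t).\<close>

lemma beta_invariant:
  assumes t: "t \<in> I" and B: "B \<in> sets S"
  shows "(LINT x:F|beta. measure (qker t x) B) = measure beta B"
proof -
  have [measurable]: "B \<in> sets S" by fact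
  let ?g = "\<lambda>x. \<integral>y. indicator B y * eta y \<partial>\<kappa> t x"
  have g [measurable]: "?g \<in> borel_measurable S" using t by measurable
  have "(LINT x:F|beta. measure (qker t x) B) = (\<integral>x. indicator F x * measure (qker t x) B * eta x \<partial>\<alpha>)"
    unfolding set_lebesgue_integral_def using measurable_measure_qker[OF assms]
    by (subst integral_beta) auto
  also have "\<dots> = (\<integral>x. exp (rate * t) * ?g x \<partial>\<alpha>)"
  proof (rule integral_cong_AE)
    show "AE x in \<alpha>. indicator F x * measure (qker t x) B * eta x = exp (rate * t) * ?g x"
      using AE_\<alpha>
    proof eventually_elim
      case (elim x)
      then show ?case using eta_pos[OF elim] by (simp add: measure_qker[OF assms])
    qed
  qed (use measurable_measure_qker[OF assms] in auto)
  also have "\<dots> = exp (rate * t) * ((\<integral>y. indicator B y * eta y \<partial>\<alpha>) * (\<integral>y. surv t y \<partial>\<alpha>))"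
    by (subst integral_mult_right_zero, subst quasi_stationary[OF t, where c = resc_sup])
      (use abs_eta resc_sup_pos in \<open>auto simp: indicator_def less_imp_le\<close>)
  also have "\<dots> = measure beta B"
    using B by (simp add: surv_\<alpha>[OF t] measure_beta exp_minus)
  finally show ?thesis .
qed

lemma qker_tendsto:
  assumes x: "x \<in> F" and B: "B \<in> sets S"
  shows "((\<lambda>t. measure (qker t x) B) \<longlongrightarrow> measure beta B) to_infinity"
proof -
  have "((\<lambda>t. (\<integral>y. indicator B y * eta y \<partial>\<kappa> t x) / surv t x) \<longlongrightarrow> (\<integral>y. indicator B y * eta y \<partial>\<alpha>)) to_infinity"
    by (rule ergodic_tendsto[OF x, where c = resc_sup])
      (use B abs_eta resc_sup_pos in \<open>auto simp: indicator_def less_imp_le\<close>)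
  then have "((\<lambda>t. resc t x / eta x * ((\<integral>y. indicator B y * eta y \<partial>\<kappa> t x) / surv t x))
      \<longlongrightarrow> eta x / eta x * (\<integral>y. indicator B y * eta y \<partial>\<alpha>)) to_infinity"
    using eta_pos[OF x] by (intro tendsto_mult tendsto_divide resc_tendsto tendsto_const) auto
  moreover have "\<forall>\<^sub>F t in to_infinity. resc t x / eta x * ((\<integral>y. indicator B y * eta y \<partial>\<kappa> t x) / surv t x)
      = measure (qker t x) B"
    using eventually_time[of 0]
  proof eventually_elim
    case (elim t)
    then show ?case using surv_pos[of t x] x B by (simp add: measure_qker resc_def)
  qed
  ultimately show ?thesis
    using eta_pos[OF x] B by (simp add: measure_beta filterlim_cong)
qed

text \<open>From every point of \<open>F\<close> the transition probabilities converge to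
  \<open>beta\<close>, so letting integer times tend to infinity in the invariance of \<beta>'
  identifies it by dominated convergence.\<close>

lemma beta_unique:
  assumes prob: "\<beta>' \<in> space (prob_algebra S)" and F: "emeasure \<beta>' F = 1"
    and inv: "\<And>t B. t \<in> I \<Longrightarrow> B \<in> sets S \<Longrightarrow> (LINT x:F|\<beta>'. measure (qker t x) B) = measure \<beta>' B"
  shows "\<beta>' = beta"
proof (rule measure_eqI)
  interpret b: prob_space \<beta>' using prob by (simp add: space_prob_algebra)
  interpret b': prob_space beta using beta_prob by (simp add: space_prob_algebra)
  show eq [measurable_cong]: "sets \<beta>' = sets beta" using prob by (simp add: space_prob_algebra)
  fix B assume "B \<in> sets \<beta>'"
  then have B: "B \<in> sets S" using eq by simp
  have "(\<lambda>n. \<integral>x. indicator F x * measure (qker (real n) x) B \<partial>\<beta>') \<longlonglongrightarrow> (\<integral>x. indicator F x * measure beta B \<partial>\<beta>')"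
  proof (rule integral_dominated_convergence[where w = "\<lambda>_. 1"])
    show "AE x in \<beta>'. (\<lambda>n. indicator F x * measure (qker (real n) x) B) \<longlonglongrightarrow> indicator F x * measure beta B"
    proof (rule AE_I2)
      fix x
      show "(\<lambda>n. indicator F x * measure (qker (real n) x) B) \<longlonglongrightarrow> indicator F x * measure beta B"
        using filterlim_compose[OF qker_tendsto[OF _ B] sequence_to_infinity, of x]
        by (cases "x \<in> F") auto
    qed
    show "AE x in \<beta>'. norm (indicator F x * measure (qker (real n) x) B) \<le> 1" for n
    proof (rule AE_I2)
      fix x
      show "norm (indicator F x * measure (qker (real n) x) B) \<le> 1"
      proof (cases "x \<in> F")
        case True
        then interpret q: prob_space "qker (real n) x"
          using qker_prob(1)[of "real n" x] by (simp add: space_prob_algebra)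
        show ?thesis using True by simp
      qed simp
    qed
  qed (use measurable_measure_qker[OF _ B] in auto)
  moreover have "(\<integral>x. indicator F x * measure (qker (real n) x) B \<partial>\<beta>') = measure \<beta>' B" for n
    using inv[of "real n" B] B by (simp add: set_lebesgue_integral_def)
  ultimately have "measure \<beta>' B = (\<integral>x. indicator F x * measure beta B \<partial>\<beta>')"
    by (simp add: LIMSEQ_const_iff)
  also have "\<dots> = measure \<beta>' F * measure beta B"
    using sets.sets_into_space[of F S] eq by simp
  also have "\<dots> = measure beta B" using F by (simp add: measure_def)
  finally show "emeasure \<beta>' B = emeasure beta B"
    by (simp add: b.emeasure_eq_measure b'.emeasure_eq_measure)
qed

end

subsection \<open>Doeblin contraction for killed propagators\<close>

locale killed_propagator = time_domain I
  for I :: "real set" +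
  fixes S :: "'e measure" and F :: "real \<Rightarrow> 'e set" and \<kappa> :: "real \<Rightarrow> real \<Rightarrow> 'e \<Rightarrow> 'e measure"
  assumes space_S [simp]: "space S = UNIV"
    and sets_F [measurable]: "\<And>t. t \<in> I \<Longrightarrow> F t \<in> sets S"
    and kernel [measurable]: "\<And>s t. s \<in> I \<Longrightarrow> t \<in> I \<Longrightarrow> s \<le> t \<Longrightarrow> \<kappa> s t \<in> S \<rightarrow>\<^sub>M subprob_algebra S"
    and support: "\<And>s t x. s \<in> I \<Longrightarrow> t \<in> I \<Longrightarrow> s \<le> t \<Longrightarrow> emeasure (\<kappa> s t x) (- F t) = 0"
    and alive: "\<And>s t x. s \<in> I \<Longrightarrow> t \<in> I \<Longrightarrow> s \<le> t \<Longrightarrow> x \<in> F s \<Longrightarrow> 0 < measure (\<kappa> s t x) UNIV"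
    and chapman_kolmogorov: "\<And>s t u x. s \<in> I \<Longrightarrow> t \<in> I \<Longrightarrow> u \<in> I \<Longrightarrow> s \<le> t \<Longrightarrow> t \<le> u \<Longrightarrow>
      \<kappa> s u x = \<kappa> s t x \<bind> \<kappa> t u"
begin

definition surv :: "real \<Rightarrow> real \<Rightarrow> 'e \<Rightarrow> real" where
  "surv s t x = measure (\<kappa> s t x) UNIV"

lemma kernel_space: "s \<in> I \<Longrightarrow> t \<in> I \<Longrightarrow> s \<le> t \<Longrightarrow> \<kappa> s t x \<in> space (subprob_algebra S)"
  using measurable_space[OF kernel, of s t x] by simp

lemma sets_kernel_eq [simp, measurable_cong]: "s \<in> I \<Longrightarrow> t \<in> I \<Longrightarrow> s \<le> t \<Longrightarrow> sets (\<kappa> s t x) = sets S"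
  using kernel_space by (simp add: space_subprob_algebra)

lemma space_kernel_eq [simp]: "s \<in> I \<Longrightarrow> t \<in> I \<Longrightarrow> s \<le> t \<Longrightarrow> space (\<kappa> s t x) = UNIV"
  using sets_eq_imp_space_eq[OF sets_kernel_eq] by simp

lemma measurable_kernel_integral [measurable]:
  fixes f :: "'e \<Rightarrow> real"
  assumes "f \<in> borel_measurable S" "s \<in> I" "t \<in> I" "s \<le> t"
  shows "(\<lambda>x. \<integral>y. f y \<partial>\<kappa> s t x) \<in> borel_measurable S"
  using measurable_compose[OF kernel integral_measurable_subprob_algebra] assms by blast

lemma measurable_surv [measurable]: "s \<in> I \<Longrightarrow> t \<in> I \<Longrightarrow> s \<le> t \<Longrightarrow> surv s t \<in> borel_measurable S"
  unfolding surv_def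
  using measurable_compose[OF kernel measurable_measure_subprob_algebra, of s t UNIV] sets.top[of S] by simp

lemma surv_nonneg: "0 \<le> surv s t x" by (simp add: surv_def)

lemma surv_le_1: "s \<in> I \<Longrightarrow> t \<in> I \<Longrightarrow> s \<le> t \<Longrightarrow> surv s t x \<le> 1"
  using subprob_space.subprob_measure_le_1 kernel_space by (force simp: surv_def space_subprob_algebra)

lemma abs_surv_le_1: "s \<in> I \<Longrightarrow> t \<in> I \<Longrightarrow> s \<le> t \<Longrightarrow> \<bar>surv s t x\<bar> \<le> 1"
  using surv_le_1 surv_nonneg by auto

lemma surv_pos: "s \<in> I \<Longrightarrow> t \<in> I \<Longrightarrow> s \<le> t \<Longrightarrow> x \<in> F s \<Longrightarrow> 0 < surv s t x" by (simp add: surv_def alive)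

lemma integrable_kernel:
  fixes f :: "'e \<Rightarrow> real"
  assumes "s \<in> I" "t \<in> I" "s \<le> t" "f \<in> borel_measurable S" "\<And>x. \<bar>f x\<bar> \<le> c"
  shows "integrable (\<kappa> s t x) f"
  by (rule integrable_subprob_bounded[OF kernel_space]) (use assms in auto)

lemma abs_kernel_integral_le:
  fixes f :: "'e \<Rightarrow> real"
  assumes "s \<in> I" "t \<in> I" "s \<le> t" "f \<in> borel_measurable S" "\<And>x. \<bar>f x\<bar> \<le> c"
  shows "\<bar>\<integral>y. f y \<partial>\<kappa> s t x\<bar> \<le> c * surv s t x"
  using abs_integral_subprob_le[OF kernel_space assms(4), of s t c x] assms by (simp add: surv_def)

lemma kernel_integral_split:
  fixes f :: "'e \<Rightarrow> real"
  assumes "s \<in> I" "t \<in> I" "u \<in> I" "s \<le> t" "t \<le> u" "f \<in> borel_measurable S" "\<And>x. \<bar>f x\<bar> \<le> c"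
  shows "(\<integral>y. f y \<partial>\<kappa> s u x) = (\<integral>y. \<integral>z. f z \<partial>\<kappa> t u y \<partial>\<kappa> s t x)"
  unfolding chapman_kolmogorov[OF assms(1-5)]
  by (rule integral_bind_kernel[OF kernel_space kernel]) (use assms in auto)

lemma surv_split:
  assumes "s \<in> I" "t \<in> I" "u \<in> I" "s \<le> t" "t \<le> u"
  shows "surv s u x = (\<integral>y. surv t u y \<partial>\<kappa> s t x)"
  using kernel_integral_split[OF assms, of "\<lambda>_. 1" 1 x] assms by (simp add: surv_def)

lemma AE_kernel: "s \<in> I \<Longrightarrow> t \<in> I \<Longrightarrow> s \<le> t \<Longrightarrow> AE y in \<kappa> s t x. y \<in> F t"
  by (rule AE_I[where N = "- F t"]) (use support sets.compl_sets[OF sets_F] in \<open>auto simp: Compl_eq_Diff_UNIV\<close>)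

text \<open>\<open>cond_mean s r T f x\<close> is the mean of \<open>f(X\<^sub>r)\<close> for the process started from \<open>x\<close> at time \<open>s\<close>
  and conditioned to survive until \<open>T\<close>.\<close>

definition cond_mean :: "real \<Rightarrow> real \<Rightarrow> real \<Rightarrow> ('e \<Rightarrow> real) \<Rightarrow> 'e \<Rightarrow> real" where
  "cond_mean s r T f x = (\<integral>y. f y * surv r T y \<partial>\<kappa> s r x) / surv s T x"

lemma abs_mult_surv:
  assumes "r \<in> I" "T \<in> I" "r \<le> T" "\<And>y. \<bar>f y\<bar> \<le> b"
  shows "\<bar>f y * surv r T y\<bar> \<le> b * surv r T y" "\<bar>f y * surv r T y\<bar> \<le> b"
proof -
  have b: "0 \<le> b" using assms(4)[of undefined] by linarith
  show *: "\<bar>f y * surv r T y\<bar> \<le> b * surv r T y"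
    using surv_nonneg assms by (auto simp: abs_mult intro: mult_right_mono)
  show "\<bar>f y * surv r T y\<bar> \<le> b"
    using * mult_left_mono[OF surv_le_1[OF assms(1-3)] b, of y] by simp
qed

lemma abs_integral_mult_surv:
  fixes f :: "'e \<Rightarrow> real"
  assumes "s \<in> I" "r \<in> I" "T \<in> I" "s \<le> r" "r \<le> T" and f: "f \<in> borel_measurable S" "\<And>y. \<bar>f y\<bar> \<le> b"
  shows "\<bar>\<integral>y. f y * surv r T y \<partial>\<kappa> s r x\<bar> \<le> b * surv s T x"
proof -
  have "\<bar>\<integral>y. f y * surv r T y \<partial>\<kappa> s r x\<bar> \<le> (\<integral>y. \<bar>f y * surv r T y\<bar> \<partial>\<kappa> s r x)"
    by (rule integral_abs_bound)
  also have "\<dots> \<le> (\<integral>y. b * surv r T y \<partial>\<kappa> s r x)"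
  proof (rule integral_mono)
    show "integrable (\<kappa> s r x) (\<lambda>y. \<bar>f y * surv r T y\<bar>)"
      by (rule integrable_kernel[where c = b]) (use assms abs_mult_surv in auto)
    show "integrable (\<kappa> s r x) (\<lambda>y. b * surv r T y)"
      by (intro integrable_mult_right integrable_kernel[where c = 1]) (use assms abs_surv_le_1 in auto)
  qed (use abs_mult_surv assms in auto)
  also have "\<dots> = b * surv s T x" using surv_split[of s r T x] assms by simp
  finally show ?thesis .
qed

text \<open>Where the survival probability vanishes, so does the integral, by
  \<open>abs_integral_mult_surv\<close>; the default value of the quotient is therefore harmless and
  no starting point has to be excluded.\<close>

lemma cond_mean_mult_surv:
  fixes f :: "'e \<Rightarrow> real"
  assumes "s \<in> I" "r \<in> I" "T \<in> I" "s \<le> r" "r \<le> T" and f: "f \<in> borel_measurable S" "\<And>y. \<bar>f y\<bar> \<le> b"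
  shows "cond_mean s r T f x * surv s T x = (\<integral>y. f y * surv r T y \<partial>\<kappa> s r x)"
  using abs_integral_mult_surv[OF assms, of x] by (cases "surv s T x = 0") (simp_all add: cond_mean_def)

lemma abs_cond_mean_le:
  fixes f :: "'e \<Rightarrow> real"
  assumes "s \<in> I" "r \<in> I" "T \<in> I" "s \<le> r" "r \<le> T" and f: "f \<in> borel_measurable S" "\<And>y. \<bar>f y\<bar> \<le> b"
  shows "\<bar>cond_mean s r T f x\<bar> \<le> b"
proof (cases "surv s T x = 0")
  case True
  then show ?thesis using f(2)[of undefined] by (simp add: cond_mean_def)
next
  case False
  then have "0 < surv s T x" using surv_nonneg[of s T x] by simp
  then show ?thesis
    using abs_integral_mult_surv[OF assms, of x] by (simp add: cond_mean_def abs_divide pos_divide_le_eq)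
qed

lemma measurable_cond_mean [measurable]:
  fixes f :: "'e \<Rightarrow> real"
  assumes "s \<in> I" "r \<in> I" "T \<in> I" "s \<le> r" "r \<le> T" "f \<in> borel_measurable S"
  shows "cond_mean s r T f \<in> borel_measurable S"
  unfolding cond_mean_def[abs_def] using assms by (auto intro!: borel_measurable_divide measurable_kernel_integral)

text \<open>The tower property: with the horizon \<open>T\<close> held fixed, conditioning on
  survival again yields a Markov evolution, and the survival weights at the intermediate time
  cancel.\<close>

lemma cond_mean_split:
  fixes f :: "'e \<Rightarrow> real"
  assumes "s \<in> I" "q \<in> I" "r \<in> I" "T \<in> I" "s \<le> q" "q \<le> r" "r \<le> T"
    and f: "f \<in> borel_measurable S" "\<And>y. \<bar>f y\<bar> \<le> b"
  shows "cond_mean s r T f x = cond_mean s q T (cond_mean q r T f) x"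
proof -
  have "(\<integral>y. f y * surv r T y \<partial>\<kappa> s r x) = (\<integral>y. \<integral>z. f z * surv r T z \<partial>\<kappa> q r y \<partial>\<kappa> s q x)"
    by (rule kernel_integral_split[where c = b]) (use assms abs_mult_surv(2) in auto)
  also have "\<dots> = (\<integral>y. cond_mean q r T f y * surv q T y \<partial>\<kappa> s q x)"
    using assms by (intro Bochner_Integration.integral_cong) (auto simp: cond_mean_mult_surv[of q r T f b])
  finally show ?thesis by (simp add: cond_mean_def)
qed

lemma cond_mean_mono_on:
  fixes g :: "'e \<Rightarrow> real"
  assumes "s \<in> I" "q \<in> I" "T \<in> I" "s \<le> q" "q \<le> T" and x: "x \<in> F s"
    and g: "g \<in> borel_measurable S" "\<And>y. \<bar>g y\<bar> \<le> b" and ge: "\<And>y. y \<in> F q \<Longrightarrow> \<bar>g y - a\<bar> \<le> d"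
  shows "\<bar>cond_mean s q T g x - a\<bar> \<le> d"
proof -
  have pos: "0 < surv s T x" using surv_pos assms by auto
  have iS: "integrable (\<kappa> s q x) (surv q T)"
    by (rule integrable_kernel[where c = 1]) (use assms abs_surv_le_1 in auto)
  have ig: "integrable (\<kappa> s q x) (\<lambda>y. g y * surv q T y)"
    by (rule integrable_kernel[where c = b]) (use assms abs_mult_surv(2) in auto)
  have S: "surv s T x = (\<integral>y. surv q T y \<partial>\<kappa> s q x)" by (rule surv_split) (use assms in auto)
  have "AE y in \<kappa> s q x. 0 \<le> surv q T y \<and> \<bar>g y - a\<bar> \<le> d"
    using AE_kernel[OF assms(1,2,4)] by eventually_elim (simp add: ge surv_nonneg)
  then show ?thesis
    unfolding cond_mean_def S by (rule weighted_mean_close[OF iS ig]) (use pos S in simp)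
qed

end

section \<open>Minorisation and contraction of conditioned means\<close>

text \<open>\<open>minorization\<close> and \<open>comparison\<close> are the two parts of
  \<open>cond_A'\<close> expressed by the killed kernels; the first is multiplied by the survival
  probability, which removes the conditioning.\<close>

locale doeblin_propagator = killed_propagator I S F \<kappa>
  for I and S :: "'e measure" and F and \<kappa> +
  fixes \<nu> :: "real \<Rightarrow> 'e measure" and t0 c1 c2 :: real
  assumes \<nu>_prob: "\<And>s. s \<in> I \<Longrightarrow> \<nu> s \<in> space (prob_algebra S)"
    and \<nu>_F: "\<And>s. s \<in> I \<Longrightarrow> emeasure (\<nu> s) (F s) = 1"
    and t0: "t0 \<in> I" "0 < t0" and c1: "0 < c1" and c2: "0 < c2"
    and minorization: "\<And>s x B. s \<in> I \<Longrightarrow> x \<in> F s \<Longrightarrow> B \<in> sets S \<Longrightarrow>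
      c1 * measure (\<nu> (s + t0)) B * measure (\<kappa> s (s + t0) x) UNIV \<le> measure (\<kappa> s (s + t0) x) B"
    and comparison: "\<And>s t x. s \<in> I \<Longrightarrow> t \<in> I \<Longrightarrow> s \<le> t \<Longrightarrow> x \<in> F s \<Longrightarrow>
      c2 * measure (\<kappa> s t x) UNIV \<le> (\<integral>y. measure (\<kappa> s t y) UNIV \<partial>\<nu> s)"
begin

lemma \<nu>_subprob: "s \<in> I \<Longrightarrow> \<nu> s \<in> space (subprob_algebra S)"
  using \<nu>_prob by (auto simp: space_prob_algebra space_subprob_algebra prob_space_imp_subprob_space)

lemma sets_\<nu> [simp, measurable_cong]: "s \<in> I \<Longrightarrow> sets (\<nu> s) = sets S"
  using \<nu>_prob by (simp add: space_prob_algebra)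

lemma integrable_\<nu>:
  fixes f :: "'e \<Rightarrow> real"
  assumes "s \<in> I" "f \<in> borel_measurable S" "\<And>x. \<bar>f x\<bar> \<le> c"
  shows "integrable (\<nu> s) f"
  by (rule integrable_subprob_bounded[OF \<nu>_subprob]) (use assms in auto)

lemma AE_\<nu>: assumes "s \<in> I" shows "AE y in \<nu> s. y \<in> F s"
proof -
  interpret prob_space "\<nu> s" using \<nu>_prob[OF assms] by (simp add: space_prob_algebra)
  show ?thesis by (rule AE_prob_1) (simp add: \<nu>_F assms measure_def)
qed

lemma surv_\<nu>_pos:
  assumes "s \<in> I" "T \<in> I" "s \<le> T"
  shows "0 < (\<integral>y. surv s T y \<partial>\<nu> s)"
proof (rule prob_space.expectation_pos)
  show "prob_space (\<nu> s)" using \<nu>_prob[OF assms(1)] by (simp add: space_prob_algebra)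
  show "integrable (\<nu> s) (surv s T)"
    by (rule integrable_\<nu>[where c = 1]) (use assms abs_surv_le_1 in auto)
  show "AE y in \<nu> s. 0 < surv s T y"
    using AE_\<nu>[OF assms(1)] by eventually_elim (rule surv_pos[OF assms])
qed

text \<open>The inequality on sets is an inequality between measures, hence between integrals of
  functions non-negative almost everywhere for both. Non-negativity is available only on
  \<open>F (s + t0)\<close>, but both measures sit there.\<close>

lemma minorization_integral:
  fixes g :: "'e \<Rightarrow> real"
  assumes s: "s \<in> I" and x: "x \<in> F s" and g: "g \<in> borel_measurable S" "\<And>y. \<bar>g y\<bar> \<le> b"
    and nonneg: "\<And>y. y \<in> F (s + t0) \<Longrightarrow> 0 \<le> g y"
  shows "c1 * (\<integral>y. g y \<partial>\<nu> (s + t0)) * surv s (s + t0) x \<le> (\<integral>y. g y \<partial>\<kappa> s (s + t0) x)"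
proof -
  let ?q = "s + t0" and ?k = "\<kappa> s (s + t0) x" and ?n = "\<nu> (s + t0)"
  have q: "?q \<in> I" "s \<le> ?q" using s t0 by auto
  interpret k: subprob_space ?k using kernel_space[OF s q] by (simp add: space_subprob_algebra)
  interpret n: prob_space ?n using \<nu>_prob[OF q(1)] by (simp add: space_prob_algebra)
  define e where "e = c1 * surv s ?q x"
  have e: "0 \<le> e" using c1 surv_nonneg by (simp add: e_def)
  have gm: "g \<in> borel_measurable ?n" "g \<in> borel_measurable ?k" using g q s by auto
  have le: "scale_measure (ennreal e) ?n \<le> ?k"
  proof (subst le_measure)
    show "sets (scale_measure (ennreal e) ?n) = sets ?k" using q s by simp
    show "\<forall>A\<in>sets (scale_measure (ennreal e) ?n). emeasure (scale_measure (ennreal e) ?n) A \<le> emeasure ?k A"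
      using minorization[OF s x] q s e
      by (auto simp: n.emeasure_eq_measure k.emeasure_eq_measure e_def surv_def mult_ac simp flip: ennreal_mult)
  qed
  have "ennreal (e * (\<integral>y. g y \<partial>?n)) = ennreal e * (\<integral>\<^sup>+y. ennreal (g y) \<partial>?n)"
  proof (subst nn_integral_eq_integral)
    show "integrable ?n g" by (rule integrable_\<nu>[OF q(1) g])
    show "AE y in ?n. 0 \<le> g y" using AE_\<nu>[OF q(1)] by eventually_elim (rule nonneg)
    show "ennreal (e * (\<integral>y. g y \<partial>?n)) = ennreal e * ennreal (\<integral>y. g y \<partial>?n)"
      by (rule ennreal_mult'[OF e])
  qed
  also have "\<dots> = (\<integral>\<^sup>+y. ennreal (g y) \<partial>scale_measure (ennreal e) ?n)"
    using gm by (simp add: nn_integral_scale_measure)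
  also have "\<dots> \<le> (\<integral>\<^sup>+y. ennreal (g y) \<partial>?k)"
    by (rule nn_integral_mono_measure[OF _ le]) (use q s in simp)
  also have "\<dots> = ennreal (\<integral>y. g y \<partial>?k)"
  proof (rule nn_integral_eq_integral)
    show "integrable ?k g" by (rule integrable_kernel[OF s q g])
    show "AE y in ?k. 0 \<le> g y" using AE_kernel[OF s q] by eventually_elim (rule nonneg)
  qed
  finally have "e * (\<integral>y. g y \<partial>?n) \<le> (\<integral>y. g y \<partial>?k)"
    by (rule ennreal_le_iff[THEN iffD1, rotated])
      (rule integral_nonneg_AE, use AE_kernel[OF s q] in \<open>eventually_elim, auto intro: nonneg\<close>)
  then show ?thesis by (simp add: e_def mult_ac)
qed

text \<open>\<open>minorization\<close> conditions on survival until s + t0 only. Surviving until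
  \<open>T\<close> reweights the position at s + t0 by the survival probability from there, and by
  \<open>comparison\<close> this weight is nowhere on \<open>F (s + t0)\<close> larger than its
  \<nu>-mean divided by c2. The minorising law is thus \<nu> with the same reweighting, and the
  constant c1 c2 depends neither on x nor on the horizon.\<close>

lemma conditioned_minorization:
  fixes g :: "'e \<Rightarrow> real"
  assumes s: "s \<in> I" and T: "T \<in> I" "s + t0 \<le> T" and x: "x \<in> F s"
    and g: "g \<in> borel_measurable S" "\<And>y. \<bar>g y\<bar> \<le> b"
    and nonneg: "\<And>y. y \<in> F (s + t0) \<Longrightarrow> 0 \<le> g y"
  shows "c1 * c2 * ((\<integral>y. g y * surv (s + t0) T y \<partial>\<nu> (s + t0)) / (\<integral>y. surv (s + t0) T y \<partial>\<nu> (s + t0)))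
    \<le> cond_mean s (s + t0) T g x"
proof -
  let ?q = "s + t0"
  have q: "?q \<in> I" "s \<le> ?q" "s \<le> T" using s t0 T by auto
  let ?G = "\<integral>y. g y * surv ?q T y \<partial>\<nu> ?q" and ?N = "\<integral>y. surv ?q T y \<partial>\<nu> ?q"
  have N: "0 < ?N" by (rule surv_\<nu>_pos) (use q T in auto)
  have G: "0 \<le> ?G"
    using AE_\<nu>[OF q(1)] by (intro integral_nonneg_AE, eventually_elim) (auto simp: nonneg surv_nonneg)
  have pos: "0 < surv s T x" by (rule surv_pos) (use s q T x in auto)
  have "surv s T x = (\<integral>y. surv ?q T y \<partial>\<kappa> s ?q x)" by (rule surv_split) (use s q T in auto)
  also have "\<dots> \<le> (\<integral>y. ?N / c2 \<partial>\<kappa> s ?q x)"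
  proof (rule integral_mono_AE)
    show "AE y in \<kappa> s ?q x. surv ?q T y \<le> ?N / c2"
      using AE_kernel[OF s q(1,2)]
    proof eventually_elim
      case (elim y)
      then show ?case using comparison[OF q(1) T elim] c2 by (simp add: surv_def pos_le_divide_eq mult.commute)
    qed
    show "integrable (\<kappa> s ?q x) (surv ?q T)"
      by (rule integrable_kernel[where c = 1]) (use s q T abs_surv_le_1 in auto)
    show "integrable (\<kappa> s ?q x) (\<lambda>y. ?N / c2)"
      by (rule integrable_kernel[where c = "?N / c2"]) (use s q N c2 in auto)
  qed
  also have "\<dots> = surv s ?q x * ?N / c2" using s q by (simp add: surv_def)
  finally have le: "c2 * surv s T x \<le> surv s ?q x * ?N" using c2 by (simp add: pos_le_divide_eq mult.commute)
  have "c1 * c2 * (?G / ?N) * surv s T x = c1 * ?G / ?N * (c2 * surv s T x)" by simp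
  also have "\<dots> \<le> c1 * ?G / ?N * (surv s ?q x * ?N)"
    using le G N c1 by (intro mult_left_mono) auto
  also have "\<dots> = c1 * ?G * surv s ?q x" using N by simp
  also have "\<dots> \<le> (\<integral>y. g y * surv ?q T y \<partial>\<kappa> s ?q x)"
    by (rule minorization_integral[where b = b])
      (use s q T x g nonneg abs_mult_surv(2) surv_nonneg in auto)
  finally show ?thesis using pos by (simp add: cond_mean_def pos_le_divide_eq)
qed

definition contraction :: real where
  "contraction = 1 - min 1 (c1 * c2)"

lemma contraction: "0 \<le> contraction" "contraction < 1"
  using c1 c2 by (auto simp: contraction_def)

lemma cond_mean_affine:
  fixes g :: "'e \<Rightarrow> real"
  assumes "s \<in> I" "q \<in> I" "T \<in> I" "s \<le> q" "q \<le> T" and x: "x \<in> F s"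
    and g: "g \<in> borel_measurable S" "\<And>y. \<bar>g y\<bar> \<le> b"
  shows "cond_mean s q T (\<lambda>y. u * g y + v) x = u * cond_mean s q T g x + v"
proof -
  have pos: "0 < surv s T x" using surv_pos assms by auto
  have iS: "integrable (\<kappa> s q x) (surv q T)"
    by (rule integrable_kernel[where c = 1]) (use assms abs_surv_le_1 in auto)
  have ig: "integrable (\<kappa> s q x) (\<lambda>y. g y * surv q T y)"
    by (rule integrable_kernel[where c = b]) (use assms abs_mult_surv(2) in auto)
  have S: "surv s T x = (\<integral>y. surv q T y \<partial>\<kappa> s q x)" by (rule surv_split) (use assms in auto)
  have "(\<integral>y. (u * g y + v) * surv q T y \<partial>\<kappa> s q x) = u * (\<integral>y. g y * surv q T y \<partial>\<kappa> s q x) + v * surv s T x"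
    using iS ig by (simp add: S distrib_right mult.assoc)
  then show ?thesis using pos by (simp add: cond_mean_def add_divide_distrib)
qed

text \<open>The classical Doeblin argument, run backwards from r in blocks of length t0 with the
  horizon \<open>T\<close> fixed: if the conditioned means from s + t0 lie in an interval, those
  from s are pulled from both ends towards one value m that does not depend on the starting point.
  Since the constant in \<open>conditioned_minorization\<close> is free of the horizon, so is the
  rate.\<close>

lemma oscillation:
  fixes f :: "'e \<Rightarrow> real"
  assumes r: "r \<in> I" and T: "T \<in> I" "r \<le> T" and f: "f \<in> borel_measurable S" "\<And>y. \<bar>f y\<bar> \<le> b"
  shows "s \<in> I \<Longrightarrow> s + real n * t0 \<le> r \<Longrightarrow>
    \<exists>a. \<forall>x\<in>F s. a \<le> cond_mean s r T f x \<and> cond_mean s r T f x \<le> a + contraction ^ n * (2 * b)"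
proof (induction n arbitrary: s)
  case 0
  then have *: "\<bar>cond_mean s r T f x\<bar> \<le> b" for x
    by (intro abs_cond_mean_le) (use r T f in auto)
  have "- b \<le> cond_mean s r T f x \<and> cond_mean s r T f x \<le> - b + contraction ^ 0 * (2 * b)" for x
    using *[of x] by (simp add: abs_le_iff)
  then show ?case by blast
next
  case (Suc n)
  let ?q = "s + t0" let ?D = "contraction ^ n * (2 * b)"
  have q: "?q \<in> I" "s \<le> ?q" using Suc.prems(1) t0 by auto
  have "?q + real n * t0 \<le> r" using Suc.prems(2) by (simp add: algebra_simps)
  moreover have "0 \<le> real n * t0" using t0 by auto
  ultimately have qr: "?q + real n * t0 \<le> r" "?q \<le> r" "?q \<le> T" using T by auto
  define R where "R = cond_mean ?q r T f"
  have R: "R \<in> borel_measurable S" "\<And>y. \<bar>R y\<bar> \<le> b"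
    unfolding R_def using abs_cond_mean_le[OF q(1) r T(1) qr(2) T(2) f] q r T qr f by auto
  obtain a where a: "\<And>y. y \<in> F ?q \<Longrightarrow> a \<le> R y" "\<And>y. y \<in> F ?q \<Longrightarrow> R y \<le> a + ?D"
    using Suc.IH[OF q(1) qr(1)] by (auto simp: R_def)
  define N where "N = (\<integral>y. surv ?q T y \<partial>\<nu> ?q)"
  define m where "m = (\<integral>y. R y * surv ?q T y \<partial>\<nu> ?q) / N"
  define c where "c = 1 - contraction"
  have c: "0 \<le> c" "c \<le> c1 * c2" by (auto simp: c_def contraction_def c1 c2 less_imp_le)
  have N: "0 < N" unfolding N_def by (rule surv_\<nu>_pos) (use q T qr in auto)
  have iS: "integrable (\<nu> ?q) (surv ?q T)"
    by (rule integrable_\<nu>[where c = 1]) (use q T qr abs_surv_le_1 in auto)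
  have iR: "integrable (\<nu> ?q) (\<lambda>y. R y * surv ?q T y)"
    by (rule integrable_\<nu>[where c = b]) (use q T qr R abs_mult_surv(2) in auto)
  \<comment> \<open>One affine statement covers both ends of the interval: it is used with R - a and
    with a + D - R, both non-negative on \<open>F (s + t0)\<close>. Here m is the mean of
    \<open>R\<close> under the minorising law.\<close>
  have lower: "c * (u * m + v) \<le> u * cond_mean s r T f x + v"
    if x: "x \<in> F s" and nonneg: "\<And>y. y \<in> F ?q \<Longrightarrow> 0 \<le> u * R y + v" for u v x
  proof -
    have mean: "(\<integral>y. (u * R y + v) * surv ?q T y \<partial>\<nu> ?q) / N = u * m + v"
      using iS iR N by (simp add: distrib_right mult.assoc N_def m_def add_divide_distrib)
    have "AE y in \<nu> ?q. 0 \<le> (u * R y + v) * surv ?q T y"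
      using AE_\<nu>[OF q(1)] by eventually_elim (auto simp: nonneg surv_nonneg)
    then have "0 \<le> u * m + v"
      unfolding mean[symmetric] using N by (intro divide_nonneg_pos integral_nonneg_AE) auto
    then have "c * (u * m + v) \<le> c1 * c2 * (u * m + v)" using c by (intro mult_right_mono) auto
    also have "\<dots> \<le> cond_mean s ?q T (\<lambda>y. u * R y + v) x"
      unfolding mean[symmetric] N_def
    proof (rule conditioned_minorization[where b = "\<bar>u\<bar> * b + \<bar>v\<bar>"])
      show "\<bar>u * R y + v\<bar> \<le> \<bar>u\<bar> * b + \<bar>v\<bar>" for y
        using mult_left_mono[OF R(2)[of y] abs_ge_zero[of u]] by (simp add: abs_mult[symmetric])
    qed (use Suc.prems q T qr R x nonneg in auto)
    also have "\<dots> = u * cond_mean s ?q T R x + v"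
      by (rule cond_mean_affine[where b = b]) (use Suc.prems q T qr R x in auto)
    also have "cond_mean s ?q T R x = cond_mean s r T f x"
      unfolding R_def by (rule cond_mean_split[symmetric, where b = b]) (use Suc.prems q r T qr f in auto)
    finally show ?thesis .
  qed
  \<comment> \<open>The new lower end moves a fraction c of the way from a to m, and so does the
    upper end from a + D; the length left over is (1 - c) D, and 1 - c is
    \<open>contraction\<close>.\<close>
  show ?case
  proof (intro exI[of _ "c * m + (1 - c) * a"] ballI conjI)
    fix x assume x: "x \<in> F s"
    show "c * m + (1 - c) * a \<le> cond_mean s r T f x"
      using lower[OF x, of 1 "- a"] a(1) by (simp add: algebra_simps)
    have "c * (- m + (a + ?D)) \<le> - cond_mean s r T f x + (a + ?D)"
      using lower[OF x, of "-1" "a + ?D"] a(2) by simp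
    moreover have "contraction ^ Suc n * (2 * b) = (1 - c) * ?D" by (simp add: c_def)
    ultimately show "cond_mean s r T f x \<le> c * m + (1 - c) * a + contraction ^ Suc n * (2 * b)"
      by (simp add: algebra_simps)
  qed
qed

lemma cond_mean_forgets:
  fixes f :: "'e \<Rightarrow> real"
  assumes "s \<in> I" "r \<in> I" "T \<in> I" "s + real n * t0 \<le> r" "r \<le> T" "x \<in> F s" "y \<in> F s"
    and f: "f \<in> borel_measurable S" "\<And>y. \<bar>f y\<bar> \<le> b"
  shows "\<bar>cond_mean s r T f x - cond_mean s r T f y\<bar> \<le> contraction ^ n * (2 * b)"
proof -
  obtain a where "\<forall>x\<in>F s. a \<le> cond_mean s r T f x \<and> cond_mean s r T f x \<le> a + contraction ^ n * (2 * b)"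
    using oscillation[OF assms(2,3,5) f assms(1,4)] by blast
  then have "a \<le> cond_mean s r T f x \<and> cond_mean s r T f x \<le> a + contraction ^ n * (2 * b)"
    "a \<le> cond_mean s r T f y \<and> cond_mean s r T f y \<le> a + contraction ^ n * (2 * b)"
    using assms(6,7) by auto
  then show ?thesis by (simp add: abs_le_iff)
qed

end

subsection \<open>Histories, paths and the Markov properties\<close>

context process
begin

lemma space_hist [simp]: "space (hist s t) = space M"
  unfolding hist_def by (rule space_measure_of) auto

lemma sets_hist: "sets (hist s t) = sigma_sets (space M)
     (\<Union>u\<in>{u\<in>I. s \<le> u \<and> ereal u \<le> t}. {X u -` B \<inter> space M | B. B \<in> sets \<E>})"
  unfolding hist_def by (rule sets_measure_of) auto

lemma hist_mono:
  assumes "s' \<le> s" "t \<le> t'"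
  shows "sets (hist s t) \<subseteq> sets (hist s' t')"
proof -
  have "{u\<in>I. s \<le> u \<and> ereal u \<le> t} \<subseteq> {u\<in>I. s' \<le> u \<and> ereal u \<le> t'}"
    using assms(1) order.trans[OF _ assms(2)] by (auto simp: subset_eq)
  then show ?thesis
    unfolding sets_hist by (intro sigma_sets_mono' UN_mono) auto
qed

lemma filtration_hist: "filtration (space M) (hist s)"
  by unfold_locales (simp_all add: hist_mono)

lemma path_from_eq: "path_from s \<omega> = path_from 0 \<omega>' \<Longrightarrow> u \<in> I \<Longrightarrow> X (s + u) \<omega> = X u \<omega>'"
  by (drule fun_cong[of _ _ u]) (simp add: path_from_def)

lemma hitting_gt_imp_notin: "ereal t < hitting B s \<omega> \<Longrightarrow> t \<in> I \<Longrightarrow> s \<le> t \<Longrightarrow> X t \<omega> \<notin> B t"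
  unfolding hitting_def by (auto dest: less_INF_D)

text \<open>The hitting time from s is the minimum of the infimum p over hits before t and the
  hitting time from t. If p exceeds t there are no such hits and p is infinite. This makes survival
  until u the intersection of a past and a future event, the source of Chapman-Kolmogorov for the
  killed kernels.\<close>

lemma hitting_gt_split:
  assumes "s \<le> t" "t \<le> u"
  shows "ereal u < hitting B s \<omega> \<longleftrightarrow> ereal t < hitting B s \<omega> \<and> ereal u < hitting B t \<omega>"
proof -
  define p where "p = (INF r\<in>{r\<in>I. s \<le> r \<and> r < t \<and> X r \<omega> \<in> B r}. ereal r)"
  have "{r\<in>I. s \<le> r \<and> X r \<omega> \<in> B r} = {r\<in>I. s \<le> r \<and> r < t \<and> X r \<omega> \<in> B r} \<union> {r\<in>I. t \<le> r \<and> X r \<omega> \<in> B r}"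
    using assms by auto
  then have eq: "hitting B s \<omega> = inf p (hitting B t \<omega>)"
    unfolding hitting_def p_def by (simp only: INF_union)
  have "p = \<infinity>" if "ereal t < p"
  proof -
    have "{r\<in>I. s \<le> r \<and> r < t \<and> X r \<omega> \<in> B r} = {}"
    proof (rule ccontr)
      assume "\<not> ?thesis"
      then obtain r where r: "r \<in> {r\<in>I. s \<le> r \<and> r < t \<and> X r \<omega> \<in> B r}" by blast
      then have "p \<le> ereal r" unfolding p_def by (rule INF_lower)
      moreover have "r < t" using r by simp
      ultimately show False using that by (auto dest: order.strict_trans2)
    qed
    then show ?thesis unfolding p_def by (simp only: image_empty Inf_empty top_ereal_def)
  qed
  moreover have "ereal t \<le> ereal u" using assms by simp
  ultimately have "ereal u < p \<longleftrightarrow> ereal t < p"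
    using order.strict_trans1[of "ereal t" "ereal u" p] by fastforce
  moreover have "ereal u < hitting B t \<omega> \<Longrightarrow> ereal t < hitting B t \<omega>"
    using \<open>ereal t \<le> ereal u\<close> by (rule order.strict_trans1)
  ultimately show ?thesis
    unfolding eq by (auto simp: inf_min)
qed

end

context markov_process
begin

sublocale time_domain I
  by unfold_locales (rule time_set)

lemma time_top_eq: "time_top = to_infinity"
  by (simp add: time_top_def)

lemma prob_P: "s \<in> I \<Longrightarrow> prob_space (P s x)"
  and sets_P [simp, measurable_cong]: "s \<in> I \<Longrightarrow> sets (P s x) = sets M"
  using measurable_space[OF kernel, of s x] by (auto simp: space_prob_algebra space_states)

lemma space_P [simp]: "s \<in> I \<Longrightarrow> space (P s x) = space M"
  using sets_eq_imp_space_eq[OF sets_P] .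

lemma measurable_emeasure_P: "s \<in> I \<Longrightarrow> Z \<in> sets M \<Longrightarrow> (\<lambda>x. emeasure (P s x) Z) \<in> borel_measurable \<E>"
  by (rule measurable_emeasure_kernel[OF measurable_prob_algebraD[OF kernel]])

lemma measurable_measure_P: "s \<in> I \<Longrightarrow> Z \<in> sets M \<Longrightarrow> (\<lambda>x. measure (P s x) Z) \<in> borel_measurable \<E>"
  unfolding measure_def by (intro borel_measurable_enn2real measurable_emeasure_P)

lemma sets_hist_subset: "sets (hist s t) \<subseteq> sets M"
  unfolding sets_hist using measurable_sets[OF measurable_X] by (intro sets.sigma_sets_subset) auto

lemma measurable_X_hist: "u \<in> I \<Longrightarrow> s \<le> u \<Longrightarrow> ereal u \<le> t \<Longrightarrow> X u \<in> hist s t \<rightarrow>\<^sub>M \<E>"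
  by (rule measurableI) (auto simp: sets_hist space_states intro!: sigma_sets.Basic)

lemma measurable_path_from_hist: "s \<in> I \<Longrightarrow> path_from s \<in> hist s \<infinity> \<rightarrow>\<^sub>M path_space"
  unfolding path_from_def[abs_def] path_space_def
  by (intro measurable_restrict measurable_X_hist) (auto dest: time_nonneg)

lemma measurable_path_from: "s \<in> I \<Longrightarrow> path_from s \<in> M \<rightarrow>\<^sub>M path_space"
  unfolding path_from_def[abs_def] path_space_def
  by (intro measurable_restrict measurable_X) auto

lemma path_sets_hist: "s \<in> I \<Longrightarrow> C \<in> sets path_space \<Longrightarrow> {\<omega> \<in> space M. path_from s \<omega> \<in> C} \<in> sets (hist s \<infinity>)"
  using measurable_sets[OF measurable_path_from_hist, of s C] by (simp add: vimage_def Int_def conj_commute)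

lemma path_sets: "s \<in> I \<Longrightarrow> C \<in> sets path_space \<Longrightarrow> {\<omega> \<in> space M. path_from s \<omega> \<in> C} \<in> sets M"
  using path_sets_hist sets_hist_subset by blast

lemma shift_path:
  assumes "s \<in> I" "\<omega> \<in> space M"
  obtains \<omega>' where "\<omega>' \<in> space M" "path_from s \<omega> = path_from 0 \<omega>'"
proof -
  have "path_from s \<omega> \<in> path_from 0 ` space M" using shift_paths[OF assms(1)] assms(2) by blast
  then show ?thesis using that by blast
qed

lemma unshift_path:
  assumes "s \<in> I" "\<omega>' \<in> space M"
  obtains \<omega> where "\<omega> \<in> space M" "path_from s \<omega> = path_from 0 \<omega>'"
proof -
  have "path_from 0 \<omega>' \<in> path_from s ` space M" using shift_paths[OF assms(1)] assms(2) by blast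
  then obtain \<omega> where "\<omega> \<in> space M" "path_from 0 \<omega>' = path_from s \<omega>" by blast
  then show ?thesis by (intro that[of \<omega>]) simp_all
qed

text \<open>By induction over the generated \<sigma>-algebra, an event of the history after s is
  described by a product-measurable set C of paths read from s; reading the same C from time 0 gives
  an event of the correspondingly shifted history. Stopping times can therefore be moved from s to 0
  together with their adaptedness.\<close>

lemma hist_path:
  assumes s: "s \<in> I" and D: "D \<in> sets (hist s (ereal s + t))"
  shows "\<exists>C\<in>sets path_space. D = {\<omega>\<in>space M. path_from s \<omega> \<in> C} \<and> {\<omega>\<in>space M. path_from 0 \<omega> \<in> C} \<in> sets (hist 0 t)"
  using D unfolding sets_hist[of s]
proof induction
  case (Basic D)
  then obtain u B where u: "u \<in> I" "s \<le> u" "ereal u \<le> ereal s + t" and B: "B \<in> sets \<E>" and D: "D = X u -` B \<inter> space M"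
    by auto
  have u': "u - s \<in> I" "ereal (u - s) \<le> t" "0 \<le> u - s"
    using u time_diff[OF s u(1,2)] by (cases t; simp)+
  let ?C = "{p \<in> space path_space. p (u - s) \<in> B}"
  have C: "?C \<in> sets path_space"
    unfolding path_space_def using u' B by measurable
  have eq: "path_from r \<omega> \<in> ?C \<longleftrightarrow> X (r + (u - s)) \<omega> \<in> B" for r \<omega>
    using u' by (auto simp: path_space_def path_from_def space_PiM space_states)
  show ?case
  proof (intro bexI[OF _ C] conjI)
    show "D = {\<omega>\<in>space M. path_from s \<omega> \<in> ?C}" unfolding eq D by auto
    show "{\<omega>\<in>space M. path_from 0 \<omega> \<in> ?C} \<in> sets (hist 0 t)"
      unfolding eq using measurable_sets[OF measurable_X_hist[OF u'(1), of 0 t] B] u'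
      by (simp add: vimage_def Int_def conj_commute)
  qed
next
  case Empty
  show ?case by (intro bexI[of _ "{}"]) auto
next
  case (Compl D)
  then obtain C where C: "C \<in> sets path_space" "D = {\<omega>\<in>space M. path_from s \<omega> \<in> C}"
    "{\<omega>\<in>space M. path_from 0 \<omega> \<in> C} \<in> sets (hist 0 t)" by auto
  have p: "path_from r \<omega> \<in> space path_space" for r \<omega>
    by (auto simp: path_space_def path_from_def space_PiM space_states)
  have "{\<omega>\<in>space M. path_from 0 \<omega> \<in> space path_space - C} = space (hist 0 t) - {\<omega>\<in>space M. path_from 0 \<omega> \<in> C}"
    using p by auto
  then show ?case
    using C p by (intro bexI[of _ "space path_space - C"]) (auto simp del: space_hist)
next
  case (Union D)
  then have "\<exists>C. \<forall>i. C i \<in> sets path_space \<and> D i = {\<omega>\<in>space M. path_from s \<omega> \<in> C i} \<and>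
      {\<omega>\<in>space M. path_from 0 \<omega> \<in> C i} \<in> sets (hist 0 t)"
    by (intro choice) blast
  then obtain C where C: "\<And>i. C i \<in> sets path_space" "\<And>i. D i = {\<omega>\<in>space M. path_from s \<omega> \<in> C i}"
    "\<And>i. {\<omega>\<in>space M. path_from 0 \<omega> \<in> C i} \<in> sets (hist 0 t)" by blast
  have "{\<omega>\<in>space M. path_from 0 \<omega> \<in> (\<Union>i. C i)} = (\<Union>i. {\<omega>\<in>space M. path_from 0 \<omega> \<in> C i})" by auto
  then have "{\<omega>\<in>space M. path_from 0 \<omega> \<in> (\<Union>i. C i)} \<in> sets (hist 0 t)" using C(3) by auto
  then show ?case using C(1,2) by (intro bexI[of _ "\<Union>i. C i"]) auto
qed

lemma hist_path_infinity:
  assumes s: "s \<in> I" and D: "D \<in> sets (hist s \<infinity>)"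
  obtains C where "C \<in> sets path_space" "D = {\<omega>\<in>space M. path_from s \<omega> \<in> C}"
  using hist_path[OF s, of D \<infinity>] D by auto

lemma hitting_shift:
  assumes s: "s \<in> I" and eq: "path_from s \<omega> = path_from 0 \<omega>'"
  shows "hitting B s \<omega> = ereal s + hitting (\<lambda>r. B (s + r)) 0 \<omega>'"
proof -
  let ?R = "{r\<in>I. 0 \<le> r \<and> X r \<omega>' \<in> B (s + r)}"
  have "t \<in> (\<lambda>r. s + r) ` ?R" if "t \<in> I" "s \<le> t" "X t \<omega> \<in> B t" for t
    using that time_diff[OF s that(1,2)] path_from_eq[OF eq, of "t - s"]
    by (intro image_eqI[of _ _ "t - s"]) auto
  then have "{t\<in>I. s \<le> t \<and> X t \<omega> \<in> B t} = (\<lambda>r. s + r) ` ?R"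
    using s path_from_eq[OF eq] by auto
  then have "hitting B s \<omega> = (INF r\<in>?R. ereal s + ereal r)"
    unfolding hitting_def by (simp only: image_comp comp_def plus_ereal.simps)
  also have "\<dots> = ereal s + (INF r\<in>?R. ereal r)"
  proof (cases "?R = {}")
    case True
    show ?thesis unfolding True by (simp add: top_ereal_def)
  next
    case False
    then show ?thesis by (rule INF_ereal_add_right) auto
  qed
  finally show ?thesis by (simp add: hitting_def)
qed

lemma homogeneous_emeasure:
  assumes "s \<in> I" "C \<in> sets path_space"
  shows "emeasure (P s x) {\<omega>\<in>space M. path_from s \<omega> \<in> C} = emeasure (P 0 x) {\<omega>\<in>space M. path_from 0 \<omega> \<in> C}"
proof -
  have eq: "emeasure (distr (P r x) path_space (path_from r)) C = emeasure (P r x) {\<omega>\<in>space M. path_from r \<omega> \<in> C}" if "r \<in> I" for r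
    using that assms measurable_path_from[of r]
    by (subst emeasure_distr) (auto simp: vimage_def Int_def conj_commute cong: measurable_cong_sets)
  show ?thesis using eq[OF assms(1)] eq[OF time_0] homogeneous[OF assms(1), of x] by simp
qed

text \<open>The conditional expectation in \<open>markov\<close> integrated over a past event. The
  form with extended non-negative values is what the composition of kernels in
  \<open>sub_law_bind\<close> requires.\<close>

lemma markov_set:
  assumes s: "s \<in> I" and t: "t \<in> I" "s \<le> t" and G: "G \<in> sets (hist s t)" and C: "C \<in> sets path_space"
  shows "emeasure (P s x) (G \<inter> {\<omega>\<in>space M. path_from t \<omega> \<in> C})
    = (\<integral>\<^sup>+\<omega>. indicator G \<omega> * emeasure (P t (X t \<omega>)) {\<omega>\<in>space M. path_from t \<omega> \<in> C} \<partial>P s x)"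
proof -
  interpret prob_space "P s x" by (rule prob_P[OF s])
  interpret finite_measure_subalgebra "P s x" "hist s t"
    by unfold_locales (use s sets_hist_subset in \<open>auto simp: subalgebra_def\<close>)
  let ?Z = "{\<omega>\<in>space M. path_from t \<omega> \<in> C}"
  let ?h = "\<lambda>\<omega>. measure (P t (X t \<omega>)) ?Z"
  have Z: "?Z \<in> sets M" by (rule path_sets[OF t(1) C])
  have G': "G \<in> sets M" using G sets_hist_subset by blast
  have h [measurable]: "?h \<in> borel_measurable (P s x)"
    using measurable_compose[OF measurable_X[OF t(1)] measurable_measure_P[OF t(1) Z]] s
    by (simp cong: measurable_cong_sets)
  have h1: "?h \<omega> \<le> 1" for \<omega> using prob_space.prob_le_1[OF prob_P[OF t(1)]] .
  have "measure (P s x) (G \<inter> ?Z) = (\<integral>\<omega>\<in>G. indicat_real ?Z \<omega> \<partial>P s x)"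
    using G' Z s by (simp add: set_lebesgue_integral_def flip: indicator_inter_arith)
  also have "\<dots> = (\<integral>\<omega>\<in>G. real_cond_exp (P s x) (hist s t) (indicat_real ?Z) \<omega> \<partial>P s x)"
    by (rule real_cond_exp_intA) (use G Z s in \<open>auto simp: emeasure_eq_measure\<close>)
  also have "\<dots> = (\<integral>\<omega>\<in>G. ?h \<omega> \<partial>P s x)"
    using markov[OF s t C, of x] G' s by (intro set_lebesgue_integral_cong_AE) (auto cong: measurable_cong_sets)
  finally have eq: "measure (P s x) (G \<inter> ?Z) = (\<integral>\<omega>. indicator G \<omega> * ?h \<omega> \<partial>P s x)"
    by (simp add: set_lebesgue_integral_def)
  have "(\<integral>\<^sup>+\<omega>. indicator G \<omega> * emeasure (P t (X t \<omega>)) ?Z \<partial>P s x) = (\<integral>\<^sup>+\<omega>. ennreal (indicator G \<omega> * ?h \<omega>) \<partial>P s x)"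
    by (intro nn_integral_cong) (auto simp: indicator_def finite_measure.emeasure_eq_measure[OF prob_space.finite_measure[OF prob_P[OF t(1)]]])
  also have "\<dots> = ennreal (\<integral>\<omega>. indicator G \<omega> * ?h \<omega> \<partial>P s x)"
  proof (rule nn_integral_eq_integral)
    show "integrable (P s x) (\<lambda>\<omega>. indicator G \<omega> * ?h \<omega>)"
      by (rule integrable_const_bound[where B = 1]) (use G' s h1 in \<open>auto simp: indicator_def\<close>)
  qed auto
  finally show ?thesis using eq by (simp add: emeasure_eq_measure)
qed

text \<open>Doob-Dynkin factorisation through the path map, by induction on measurable functions;
  the case of an indicator is \<open>hist_path_infinity\<close>.\<close>

lemma hist_factorization:
  fixes g :: "'w \<Rightarrow> ennreal"
  assumes "g \<in> borel_measurable (hist 0 \<infinity>)"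
  shows "\<exists>h\<in>borel_measurable path_space. \<forall>\<omega>\<in>space M. g \<omega> = h (path_from 0 \<omega>)"
  using assms
proof (induction rule: borel_measurable_induct)
  case (cong f g)
  then show ?case by auto
next
  case (set D)
  then obtain C where C: "C \<in> sets path_space" and D: "D = {\<omega>\<in>space M. path_from 0 \<omega> \<in> C}"
    using hist_path_infinity[OF time_0] by blast
  have "\<forall>\<omega>\<in>space M. (indicator D \<omega> :: ennreal) = indicator C (path_from 0 \<omega>)"
    unfolding D by (simp add: indicator_def)
  then show ?case using borel_measurable_indicator[OF C] by blast
next
  case (mult u c)
  from mult(4) obtain h where h [measurable]: "h \<in> borel_measurable path_space"
    and "\<forall>\<omega>\<in>space M. u \<omega> = h (path_from 0 \<omega>)" by blast
  then show ?case by (intro bexI[of _ "\<lambda>p. c * h p"]) simp_all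
next
  case (add u v)
  from \<open>\<exists>h\<in>borel_measurable path_space. \<forall>\<omega>\<in>space M. u \<omega> = h (path_from 0 \<omega>)\<close> obtain h where h [measurable]: "h \<in> borel_measurable path_space"
    and uh: "\<forall>\<omega>\<in>space M. u \<omega> = h (path_from 0 \<omega>)" by blast
  from \<open>\<exists>h\<in>borel_measurable path_space. \<forall>\<omega>\<in>space M. v \<omega> = h (path_from 0 \<omega>)\<close> obtain k where k [measurable]: "k \<in> borel_measurable path_space"
    and vk: "\<forall>\<omega>\<in>space M. v \<omega> = k (path_from 0 \<omega>)" by blast
  show ?case using uh vk by (intro bexI[of _ "\<lambda>p. k p + h p"]) simp_all
next
  case (seq U)
  have "\<forall>i. \<exists>h. h \<in> borel_measurable path_space \<and> (\<forall>\<omega>\<in>space M. U i \<omega> = h (path_from 0 \<omega>))"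
    using seq.IH by blast
  then obtain h where h [measurable]: "\<And>i. h i \<in> borel_measurable path_space"
    and Uh: "\<And>i \<omega>. \<omega>\<in>space M \<Longrightarrow> U i \<omega> = h i (path_from 0 \<omega>)"
    by (auto dest!: choice)
  have "(SUP i. U i) \<omega> = (SUP i. h i (path_from 0 \<omega>))" if "\<omega> \<in> space M" for \<omega>
    using Uh[OF that] by (simp add: image_comp)
  then show ?case by (intro bexI[of _ "\<lambda>p. SUP i. h i p"]) simp_all
qed

text \<open>Factoring g through paths reduces the claim to equality of the laws of paths. That g'
  has the same factor at every \<omega> uses \<open>shift_paths\<close>: each trajectory seen from s
  is also one seen from 0.\<close>

lemma homogeneous_nn_integral:
  fixes g g' :: "'w \<Rightarrow> ennreal"
  assumes s: "s \<in> I" and g: "g \<in> borel_measurable (hist 0 \<infinity>)"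
    and eq: "\<And>\<omega> \<omega>'. \<omega> \<in> space M \<Longrightarrow> \<omega>' \<in> space M \<Longrightarrow> path_from s \<omega> = path_from 0 \<omega>' \<Longrightarrow> g' \<omega> = g \<omega>'"
  shows "(\<integral>\<^sup>+\<omega>. g' \<omega> \<partial>P s x) = (\<integral>\<^sup>+\<omega>. g \<omega> \<partial>P 0 x)"
proof -
  obtain h where h [measurable]: "h \<in> borel_measurable path_space" and gh: "\<And>\<omega>. \<omega>\<in>space M \<Longrightarrow> g \<omega> = h (path_from 0 \<omega>)"
    using hist_factorization[OF g] by auto
  have int: "(\<integral>\<^sup>+\<omega>. h (path_from r \<omega>) \<partial>P r x) = (\<integral>\<^sup>+p. h p \<partial>distr (P r x) path_space (path_from r))" if "r \<in> I" for r
    using that measurable_path_from[of r] by (subst nn_integral_distr) (auto cong: measurable_cong_sets)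
  have "(\<integral>\<^sup>+\<omega>. g' \<omega> \<partial>P s x) = (\<integral>\<^sup>+\<omega>. h (path_from s \<omega>) \<partial>P s x)"
  proof (rule nn_integral_cong)
    fix \<omega> assume "\<omega> \<in> space (P s x)"
    then have \<omega>: "\<omega> \<in> space M" using s by simp
    then obtain \<omega>' where "\<omega>' \<in> space M" "path_from s \<omega> = path_from 0 \<omega>'" using shift_path[OF s] by blast
    then show "g' \<omega> = h (path_from s \<omega>)" using eq[OF \<omega>] gh by simp
  qed
  also have "\<dots> = (\<integral>\<^sup>+\<omega>. h (path_from 0 \<omega>) \<partial>P 0 x)"
    using int[OF s] int[OF time_0] homogeneous[OF s, of x] by simp
  also have "\<dots> = (\<integral>\<^sup>+\<omega>. g \<omega> \<partial>P 0 x)"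
    by (intro nn_integral_cong) (simp add: gh)
  finally show ?thesis .
qed

text \<open>Progressive measurability is available on bounded time intervals only, so \<Omega> is
  covered by the sets where S \<le> n, on each of which the map \<omega> \<mapsto> (S \<omega>,
  \<omega>) can be composed with it. The \<sigma>-algebra of \<open>N\<close> is kept general to
  reach both \<open>M\<close> and the full history.\<close>

lemma measurable_X_random_time:
  fixes S :: "'w \<Rightarrow> real"
  assumes N: "space N = space M" "\<And>n::nat. sets (hist 0 (real n)) \<subseteq> sets N"
    and S: "S \<in> borel_measurable N" "\<And>\<omega>. \<omega> \<in> space M \<Longrightarrow> S \<omega> \<in> I"
  shows "(\<lambda>\<omega>. X (S \<omega>) \<omega>) \<in> N \<rightarrow>\<^sub>M \<E>"
proof (rule measurable_piecewise_restrict)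
  define Z where "Z n = {\<omega>\<in>space N. S \<omega> \<le> real n}" for n
  show "countable (range Z)" by simp
  show "\<Omega> \<inter> space N \<in> sets N" if "\<Omega> \<in> range Z" for \<Omega> using that S(1) by (auto simp: Z_def)
  show "space N \<subseteq> \<Union>(range Z)" by (auto simp: Z_def real_arch_simple)
  show "(\<lambda>\<omega>. X (S \<omega>) \<omega>) \<in> restrict_space N \<Omega> \<rightarrow>\<^sub>M \<E>" if \<Omega>: "\<Omega> \<in> range Z" for \<Omega>
  proof -
    obtain n where n: "\<Omega> = Z n" using \<Omega> by blast
    have "(\<lambda>\<omega>. (S \<omega>, \<omega>)) \<in> restrict_space N \<Omega> \<rightarrow>\<^sub>M restrict_space borel {u\<in>I. u \<le> real n} \<Otimes>\<^sub>M hist 0 (real n)"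
    proof (rule measurable_Pair)
      show "S \<in> restrict_space N \<Omega> \<rightarrow>\<^sub>M restrict_space borel {u\<in>I. u \<le> real n}"
        by (intro measurable_restrict_space2 measurable_restrict_space1 S)
          (use S(2) N(1) in \<open>auto simp: n Z_def space_restrict_space\<close>)
      have "(\<lambda>\<omega>. \<omega>) \<in> N \<rightarrow>\<^sub>M hist 0 (real n)"
      proof (rule measurableI)
        fix A assume A: "A \<in> sets (hist 0 (real n))"
        then have "(\<lambda>\<omega>. \<omega>) -` A \<inter> space N = A" using sets.sets_into_space[OF A] N(1) by auto
        then show "(\<lambda>\<omega>. \<omega>) -` A \<inter> space N \<in> sets N" using A N(2) by auto
      qed (use N in auto)
      then show "(\<lambda>\<omega>. \<omega>) \<in> restrict_space N \<Omega> \<rightarrow>\<^sub>M hist 0 (real n)"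
        by (rule measurable_restrict_space1)
    qed
    from measurable_compose[OF this progressive[OF time_of_nat]]
    show ?thesis by simp
  qed
qed

lemma measurable_stopping_time_M:
  assumes T: "stopping_time (hist 0) T" shows "T \<in> borel_measurable M" "T \<in> borel_measurable (hist 0 \<infinity>)"
  using measurable_stopping_time[OF T, of M] measurable_stopping_time[OF T, of "hist 0 \<infinity>"] sets_hist_subset hist_mono
  by auto

lemma measurable_path_from_random_time:
  assumes S: "S \<in> borel_measurable M" "\<And>\<omega>. \<omega> \<in> space M \<Longrightarrow> S \<omega> \<in> I"
  shows "(\<lambda>\<omega>. path_from (S \<omega>) \<omega>) \<in> M \<rightarrow>\<^sub>M path_space"
  unfolding path_from_def path_space_def
  by (intro measurable_restrict measurable_X_random_time) (use S sets_hist_subset in auto)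

text \<open>The conditional expectation in \<open>strong_markov\<close> integrated over an event G
  of the past of T; finiteness of T on G absorbs the indicator of finite T.\<close>

lemma strong_markov_set:
  assumes sm: strong_markov and T: "stopping_time (hist 0) T"
    and range: "\<And>\<omega>. \<omega> \<in> space M \<Longrightarrow> T \<omega> \<in> ereal ` I \<union> {\<infinity>}"
    and G: "G \<in> sets (filtration.pre_sigma (space M) (hist 0) T)" "\<And>\<omega>. \<omega> \<in> G \<Longrightarrow> T \<omega> < \<infinity>"
    and C: "C \<in> sets path_space"
  shows "measure (P 0 x) {\<omega>\<in>G. path_from (real_of_ereal (T \<omega>)) \<omega> \<in> C}
    = (\<integral>\<omega>. indicator G \<omega> * measure (P 0 (at_time T \<omega>)) {\<omega>'\<in>space M. path_from 0 \<omega>' \<in> C} \<partial>P 0 x)"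
    and "(\<lambda>\<omega>. measure (P 0 (at_time T \<omega>)) {\<omega>'\<in>space M. path_from 0 \<omega>' \<in> C}) \<in> borel_measurable M"
proof -
  interpret prob_space "P 0 x" by (rule prob_P[OF time_0])
  interpret hist: filtration "space M" "hist 0" by (rule filtration_hist)
  have sub: "A \<in> sets M" if "A \<in> sets (hist.pre_sigma T)" for A
  proof -
    \<comment> \<open>The condition on T is vacuous at time \<infinity>, so this is measurability of
      A itself.\<close>
    have "{\<omega>\<in>A. T \<omega> \<le> \<infinity>} \<in> sets (hist 0 \<infinity>)"
      using hist.sets_pre_sigmaD[OF T that] by blast
    then show ?thesis using sets_hist_subset by auto
  qed
  interpret finite_measure_subalgebra "P 0 x" "hist.pre_sigma T"
    by unfold_locales (use sub in \<open>auto simp: subalgebra_def hist.space_pre_sigma\<close>)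
  have TM: "T \<in> borel_measurable M" by (rule measurable_stopping_time_M[OF T])
  let ?S = "\<lambda>\<omega>. real_of_ereal (T \<omega>)"
  have S: "?S \<in> borel_measurable M" "\<And>\<omega>. \<omega> \<in> space M \<Longrightarrow> ?S \<omega> \<in> I"
    using TM range by (auto dest!: range)
  let ?Z = "{\<omega>\<in>space M. path_from (?S \<omega>) \<omega> \<in> C \<and> T \<omega> < \<infinity>}"
  have "{\<omega>\<in>space M. path_from (?S \<omega>) \<omega> \<in> C} \<in> sets M"
    using measurable_sets[OF measurable_path_from_random_time[OF S] C] by (simp add: vimage_def Int_def conj_commute)
  moreover have "{\<omega>\<in>space M. T \<omega> < \<infinity>} \<in> sets M" using TM by measurable
  ultimately have "{\<omega>\<in>space M. path_from (?S \<omega>) \<omega> \<in> C} \<inter> {\<omega>\<in>space M. T \<omega> < \<infinity>} \<in> sets M"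
    by (rule sets.Int)
  moreover have "{\<omega>\<in>space M. path_from (?S \<omega>) \<omega> \<in> C} \<inter> {\<omega>\<in>space M. T \<omega> < \<infinity>} = ?Z" by blast
  ultimately have Z: "?Z \<in> sets M" by simp
  have G': "G \<in> sets M" using G(1) by (rule sub)
  let ?h = "\<lambda>\<omega>. measure (P 0 (at_time T \<omega>)) {\<omega>'\<in>space M. path_from 0 \<omega>' \<in> C}"
  have at: "at_time T \<in> M \<rightarrow>\<^sub>M \<E>"
    unfolding at_time_def[abs_def] by (rule measurable_X_random_time) (use S sets_hist_subset in auto)
  show h: "?h \<in> borel_measurable M"
    by (rule measurable_compose[OF at measurable_measure_P[OF time_0 path_sets[OF time_0 C]]])
  have "measure (P 0 x) {\<omega>\<in>G. path_from (?S \<omega>) \<omega> \<in> C} = measure (P 0 x) (G \<inter> ?Z)"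
    using G(2) sets.sets_into_space[OF G'] by (intro arg_cong[where f = "measure (P 0 x)"]) auto
  also have "\<dots> = (\<integral>\<omega>\<in>G. indicat_real ?Z \<omega> \<partial>P 0 x)"
    using G' Z by (simp add: set_lebesgue_integral_def flip: indicator_inter_arith)
  also have "\<dots> = (\<integral>\<omega>\<in>G. real_cond_exp (P 0 x) (hist.pre_sigma T) (indicat_real ?Z) \<omega> \<partial>P 0 x)"
    by (rule real_cond_exp_intA) (use G Z in \<open>auto simp: emeasure_eq_measure\<close>)
  also have "\<dots> = (\<integral>\<omega>\<in>G. indicat_real {\<omega> \<in> space M. T \<omega> < \<infinity>} \<omega> * ?h \<omega> \<partial>P 0 x)"
  proof (rule set_lebesgue_integral_cong_AE)
    have "AE \<omega> in P 0 x. real_cond_exp (P 0 x) (hist.pre_sigma T) (indicat_real ?Z) \<omega>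
         = indicat_real {\<omega> \<in> space M. T \<omega> < \<infinity>} \<omega> * ?h \<omega>"
      using sm T range C unfolding strong_markov_def by blast
    then show "AE \<omega>\<in>G in P 0 x. real_cond_exp (P 0 x) (hist.pre_sigma T) (indicat_real ?Z) \<omega>
         = indicat_real {\<omega> \<in> space M. T \<omega> < \<infinity>} \<omega> * ?h \<omega>" by eventually_elim simp
    show "(\<lambda>\<omega>. indicat_real {\<omega> \<in> space M. T \<omega> < \<infinity>} \<omega> * ?h \<omega>) \<in> borel_measurable (P 0 x)"
      using h TM by (simp cong: measurable_cong_sets)
  qed (use G' in auto)
  also have "\<dots> = (\<integral>\<omega>. indicator G \<omega> * ?h \<omega> \<partial>P 0 x)"
    unfolding set_lebesgue_integral_def using G(2) sets.sets_into_space[OF G']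
    by (intro Bochner_Integration.integral_cong) (auto simp: indicator_def)
  finally show "measure (P 0 x) {\<omega>\<in>G. path_from (?S \<omega>) \<omega> \<in> C} = (\<integral>\<omega>. indicator G \<omega> * ?h \<omega> \<partial>P 0 x)" .
qed

end

subsection \<open>The killed kernels\<close>

context process
begin

lemma hitting_antimono:
  assumes "\<And>r. r \<in> I \<Longrightarrow> B r \<subseteq> B' r"
  shows "hitting B' s \<omega> \<le> hitting B s \<omega>"
  unfolding hitting_def by (rule INF_superset_mono) (use assms in auto)

lemma hitting_le_start: "s \<in> I \<Longrightarrow> X s \<omega> \<in> B s \<Longrightarrow> hitting B s \<omega> \<le> ereal s"
  unfolding hitting_def by (rule INF_lower) auto

end

context markov_process
begin

text \<open>D is given by a set of paths read from 0, and D' turns out to be the same set read from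
  s, because every path seen from s occurs from 0. Measurability and probability are then both
  inherited from the path set.\<close>

lemma homogeneous_event:
  assumes s: "s \<in> I" and D: "D \<in> sets (hist 0 \<infinity>)" and D': "D' \<subseteq> space M"
    and eq: "\<And>\<omega> \<omega>'. \<omega> \<in> space M \<Longrightarrow> \<omega>' \<in> space M \<Longrightarrow> path_from s \<omega> = path_from 0 \<omega>' \<Longrightarrow> \<omega> \<in> D' \<longleftrightarrow> \<omega>' \<in> D"
  shows "D' \<in> sets (hist s \<infinity>)" and "emeasure (P s x) D' = emeasure (P 0 x) D"
proof -
  obtain C where C: "C \<in> sets path_space" and DC: "D = {\<omega>\<in>space M. path_from 0 \<omega> \<in> C}"
    using hist_path_infinity[OF time_0 D] by blast
  have "D' = {\<omega>\<in>space M. path_from s \<omega> \<in> C}"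
  proof safe
    fix \<omega> assume \<omega>: "\<omega> \<in> D'"
    then show "\<omega> \<in> space M" using D' by blast
    then obtain \<omega>' where "\<omega>' \<in> space M" "path_from s \<omega> = path_from 0 \<omega>'" using shift_path[OF s] by blast
    then show "path_from s \<omega> \<in> C" using eq[of \<omega> \<omega>'] \<omega> D' by (auto simp: DC)
  next
    fix \<omega> assume \<omega>: "\<omega> \<in> space M" "path_from s \<omega> \<in> C"
    then obtain \<omega>' where "\<omega>' \<in> space M" "path_from s \<omega> = path_from 0 \<omega>'" using shift_path[OF s] by blast
    then show "\<omega> \<in> D'" using eq[of \<omega> \<omega>'] \<omega> by (auto simp: DC)
  qed
  then show "D' \<in> sets (hist s \<infinity>)" "emeasure (P s x) D' = emeasure (P 0 x) D"
    using path_sets_hist[OF s C] homogeneous_emeasure[OF s C] by (auto simp: DC)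
qed

lemma ereal_add_left_mono_iff: "ereal s + a \<le> ereal s + b \<longleftrightarrow> a \<le> b" "ereal s + a < ereal s + b \<longleftrightarrow> a < b"
  by (cases a; cases b; simp)+

text \<open>\<open>hist_path\<close> applied to the event that the hitting time is at most s + t
  yields a path set whose version at time 0 belongs to the history up to t;
  \<open>unshift_path\<close> and \<open>hitting_shift\<close> identify this version with the event
  for the shifted boundary.\<close>

lemma shifted_stopping_time:
  assumes s: "s \<in> I" and T: "stopping_time (hist s) (hitting B s)"
  shows "stopping_time (hist 0) (hitting (\<lambda>r. B (s + r)) 0)"
proof
  fix t
  have "{\<omega>\<in>space M. hitting B s \<omega> \<le> ereal s + t} \<in> sets (hist s (ereal s + t))"
    using stopping_timeD[OF T, of "ereal s + t"] by (simp add: pred_def)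
  then obtain C where C: "C \<in> sets path_space"
    "{\<omega>\<in>space M. hitting B s \<omega> \<le> ereal s + t} = {\<omega>\<in>space M. path_from s \<omega> \<in> C}"
    "{\<omega>\<in>space M. path_from 0 \<omega> \<in> C} \<in> sets (hist 0 t)"
    using hist_path[OF s] by blast
  have "hitting (\<lambda>r. B (s + r)) 0 \<omega>' \<le> t \<longleftrightarrow> path_from 0 \<omega>' \<in> C" if \<omega>': "\<omega>' \<in> space M" for \<omega>'
  proof -
    obtain \<omega> where \<omega>: "\<omega> \<in> space M" "path_from s \<omega> = path_from 0 \<omega>'" using unshift_path[OF s \<omega>'] by blast
    have "hitting B s \<omega> \<le> ereal s + t \<longleftrightarrow> path_from s \<omega> \<in> C" using C(2) \<omega>(1) by blast
    then show ?thesis using \<omega>(2) hitting_shift[OF s \<omega>(2), of B] by (simp add: ereal_add_left_mono_iff)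
  qed
  then have "{\<omega>\<in>space M. hitting (\<lambda>r. B (s + r)) 0 \<omega> \<le> t} = {\<omega>\<in>space M. path_from 0 \<omega> \<in> C}" by blast
  then show "Measurable.pred (hist 0 t) (\<lambda>\<omega>. hitting (\<lambda>r. B (s + r)) 0 \<omega> \<le> t)"
    using C(3) by (simp add: pred_def)
qed

lemma stopping_gt_sets: "stopping_time (hist s) T \<Longrightarrow> {\<omega>\<in>space M. ereal t < T \<omega>} \<in> sets (hist s (ereal t))"
  using stopping_timeD2[of "hist s" T "ereal t"] by (simp add: pred_def)

text \<open>The variable \<open>Y\<close> is general because besides the position at a fixed time
  the position at the hitting time of the boundary is needed.\<close>

definition sub_law :: "'w measure \<Rightarrow> 'w set \<Rightarrow> ('w \<Rightarrow> 'e) \<Rightarrow> 'e measure" where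
  "sub_law N G Y = distr (density N (indicator G)) \<E> Y"

lemma sets_sub_law [simp]: "sets (sub_law N G Y) = sets \<E>"
  by (simp add: sub_law_def)

context
  fixes N :: "'w measure" and G Y
  assumes N: "sets N = sets M" and G: "G \<in> sets M" and Y: "Y \<in> M \<rightarrow>\<^sub>M \<E>"
begin

lemma nn_integral_sub_law:
  assumes f: "f \<in> borel_measurable \<E>"
  shows "(\<integral>\<^sup>+y. f y \<partial>sub_law N G Y) = (\<integral>\<^sup>+\<omega>. indicator G \<omega> * f (Y \<omega>) \<partial>N)"
proof -
  have X: "Y \<in> density N (indicator G) \<rightarrow>\<^sub>M \<E>"
    using Y N by (simp cong: measurable_cong_sets)
  have fX: "(\<lambda>\<omega>. f (Y \<omega>)) \<in> borel_measurable N"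
    using measurable_compose[OF Y f] N by (simp cong: measurable_cong_sets)
  show ?thesis
    unfolding sub_law_def using f by (subst nn_integral_distr[OF X], simp, intro nn_integral_density) (use fX G N in auto)
qed

lemma emeasure_sub_law:
  assumes B: "B \<in> sets \<E>"
  shows "emeasure (sub_law N G Y) B = emeasure N (G \<inter> {\<omega>\<in>space M. Y \<omega> \<in> B})"
proof -
  have XB: "{\<omega>\<in>space M. Y \<omega> \<in> B} \<in> sets M"
    using measurable_sets[OF Y B] by (simp add: vimage_def Int_def conj_commute)
  have "emeasure (sub_law N G Y) B = (\<integral>\<^sup>+y. indicator B y \<partial>sub_law N G Y)"
    using B by simp
  also have "\<dots> = (\<integral>\<^sup>+\<omega>. indicator G \<omega> * indicator B (Y \<omega>) \<partial>N)"
    using B by (intro nn_integral_sub_law) simp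
  also have "\<dots> = (\<integral>\<^sup>+\<omega>. indicator (G \<inter> {\<omega>\<in>space M. Y \<omega> \<in> B}) \<omega> \<partial>N)"
    using sets_eq_imp_space_eq[OF N] by (intro nn_integral_cong) (auto simp: indicator_def)
  also have "\<dots> = emeasure N (G \<inter> {\<omega>\<in>space M. Y \<omega> \<in> B})"
    using G XB N by simp
  finally show ?thesis .
qed

lemma measure_sub_law_UNIV: "measure (sub_law N G Y) UNIV = measure N G"
  using emeasure_sub_law[of UNIV] sets.top[of \<E>] sets.sets_into_space[OF G]
  by (simp add: measure_def space_states Int_absorb2)

lemma integral_sub_law:
  fixes f :: "'e \<Rightarrow> real"
  assumes f: "f \<in> borel_measurable \<E>"
  shows "(\<integral>y. f y \<partial>sub_law N G Y) = (\<integral>\<omega>. indicator G \<omega> * f (Y \<omega>) \<partial>N)"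
proof -
  have X: "Y \<in> density N (indicator G) \<rightarrow>\<^sub>M \<E>"
    using Y N by (simp cong: measurable_cong_sets)
  have fX: "(\<lambda>\<omega>. f (Y \<omega>)) \<in> borel_measurable N"
    using measurable_compose[OF Y f] N by (simp cong: measurable_cong_sets)
  have "density N (indicator G) = density N (\<lambda>\<omega>. ennreal (indicator G \<omega>))"
    by (simp add: ennreal_indicator)
  then show ?thesis
    unfolding sub_law_def using G N fX
    by (subst integral_distr[OF X f]) (simp add: integral_density)
qed

lemma integral_law_given:
  fixes f :: "'e \<Rightarrow> real"
  assumes f: "f \<in> borel_measurable \<E>" and GT: "G = {\<omega>\<in>space M. ereal t < T \<omega>}"
    and Yr: "Y = X r" and "finite_measure N"
  shows "(\<integral>y. f y \<partial>law_given N T t r) = (\<integral>y. f y \<partial>sub_law N G Y) / measure N G"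
proof -
  interpret finite_measure N by fact
  have X: "Y \<in> uniform_measure N G \<rightarrow>\<^sub>M \<E>"
    using Y N by (simp cong: measurable_cong_sets)
  have fX: "(\<lambda>\<omega>. f (Y \<omega>)) \<in> borel_measurable N"
    using measurable_compose[OF Y f] N by (simp cong: measurable_cong_sets)
  show ?thesis
  proof (cases "measure N G = 0")
    \<comment> \<open>The density of the conditional measure is infinite on G, but G is null: the
      integral is 0, which is also the value of the quotient by 0.\<close>
    case True
    then have e0: "emeasure N G = 0" by (simp add: emeasure_eq_measure)
    have "AE \<omega> in N. \<omega> \<notin> G" using e0 G N by (intro AE_not_in) auto
    then have "AE \<omega> in N. \<not> 0 < indicator G \<omega> / emeasure N G" by eventually_elim simp
    then have "AE \<omega> in uniform_measure N G. f (Y \<omega>) = 0"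
      unfolding uniform_measure_def using G N by (subst AE_density) auto
    then have "(\<integral>\<omega>. f (Y \<omega>) \<partial>uniform_measure N G) = 0"
      by (rule integral_eq_zero_AE)
    then show ?thesis
      unfolding law_given_def GT[symmetric] Yr[symmetric] using True by (subst integral_distr[OF X f]) simp
  next
    case False
    then have pos: "0 < measure N G" by (simp add: zero_less_measure_iff)
    have "uniform_measure N G = density N (\<lambda>\<omega>. ennreal (indicator G \<omega> / measure N G))"
      unfolding uniform_measure_def
    proof (rule density_cong)
      show "AE \<omega> in N. (indicator G \<omega> :: ennreal) / emeasure N G = ennreal (indicator G \<omega> / measure N G)"
        using pos by (intro AE_I2) (auto simp: indicator_def emeasure_eq_measure divide_ennreal simp flip: ennreal_1)
    qed (use G N in auto)
    then have "(\<integral>\<omega>. f (Y \<omega>) \<partial>uniform_measure N G) = (\<integral>\<omega>. indicator G \<omega> / measure N G * f (Y \<omega>) \<partial>N)"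
      using G N fX by (simp add: integral_density)
    also have "\<dots> = (\<integral>\<omega>. indicator G \<omega> * f (Y \<omega>) \<partial>N) / measure N G"
      by (simp flip: integral_divide_zero)
    finally show ?thesis
      unfolding law_given_def GT[symmetric] Yr[symmetric] integral_sub_law[OF f] by (subst integral_distr[OF X f])
  qed
qed

end

lemma sub_law_kernel:
  assumes s: "s \<in> I" and G: "G \<in> sets M" and Y: "Y \<in> M \<rightarrow>\<^sub>M \<E>"
  shows "(\<lambda>x. sub_law (P s x) G Y) \<in> \<E> \<rightarrow>\<^sub>M subprob_algebra \<E>"
proof (rule measurable_subprob_algebra)
  fix x
  interpret prob_space "P s x" by (rule prob_P[OF s])
  show "subprob_space (sub_law (P s x) G Y)"
  proof (rule subprob_spaceI)
    have "emeasure (sub_law (P s x) G Y) UNIV \<le> 1"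
      using emeasure_sub_law[OF sets_P[OF s] G Y, of UNIV] sets.top[of \<E>]
      by (simp add: space_states emeasure_le_1)
    then show "emeasure (sub_law (P s x) G Y) (space (sub_law (P s x) G Y)) \<le> 1"
      by (simp add: sub_law_def space_states)
    show "space (sub_law (P s x) G Y) \<noteq> {}" by (simp add: sub_law_def space_states)
  qed
next
  fix B assume B: "B \<in> sets \<E>"
  have "{\<omega>\<in>space M. Y \<omega> \<in> B} \<in> sets M"
    using measurable_sets[OF Y B] by (simp add: vimage_def Int_def conj_commute)
  then show "(\<lambda>x. emeasure (sub_law (P s x) G Y) B) \<in> borel_measurable \<E>"
    unfolding emeasure_sub_law[OF sets_P[OF s] G Y B] using G by (intro measurable_emeasure_P s) auto
qed simp

text \<open>The Markov property at time t, written as an identity between kernels, for an event that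
  splits into a past part G and a future part H. With survival events for G and H it becomes
  Chapman-Kolmogorov for both killed evolutions.\<close>

lemma sub_law_bind:
  assumes s: "s \<in> I" and t: "t \<in> I" "s \<le> t" and Y: "Y \<in> hist t \<infinity> \<rightarrow>\<^sub>M \<E>"
    and G: "G \<in> sets (hist s t)" and H: "H \<in> sets (hist t \<infinity>)"
  shows "sub_law (P s x) (G \<inter> H) Y = sub_law (P s x) G (X t) \<bind> (\<lambda>y. sub_law (P t y) H Y)"
proof (rule measure_eqI)
  have GM: "G \<in> sets M" and HM: "H \<in> sets M" using G H sets_hist_subset by blast+
  have YM: "Y \<in> M \<rightarrow>\<^sub>M \<E>"
    by (rule measurable_mono[THEN subsetD, OF _ _ _ _ Y]) (auto simp: sets_hist_subset)
  have K: "(\<lambda>y. sub_law (P t y) H Y) \<in> \<E> \<rightarrow>\<^sub>M subprob_algebra \<E>" by (rule sub_law_kernel[OF t(1) HM YM])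
  then have K': "(\<lambda>y. sub_law (P t y) H Y) \<in> sub_law (P s x) G (X t) \<rightarrow>\<^sub>M subprob_algebra \<E>"
    by (simp cong: measurable_cong_sets)
  have ne: "space (sub_law (P s x) G (X t)) \<noteq> {}" by (simp add: sub_law_def space_states)
  show "sets (sub_law (P s x) (G \<inter> H) Y) = sets (sub_law (P s x) G (X t) \<bind> (\<lambda>y. sub_law (P t y) H Y))"
    by (subst sets_bind[OF _ ne, of _ \<E>]) auto
  fix B assume "B \<in> sets (sub_law (P s x) (G \<inter> H) Y)"
  then have B: "B \<in> sets \<E>" by simp
  let ?D = "H \<inter> {\<omega>\<in>space M. Y \<omega> \<in> B}"
  have "{\<omega>\<in>space M. Y \<omega> \<in> B} \<in> sets (hist t \<infinity>)"
    using measurable_sets[OF Y B] by (simp add: vimage_def Int_def conj_commute)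
  then have D: "?D \<in> sets (hist t \<infinity>)" using H by auto
  then obtain C where C: "C \<in> sets path_space" "?D = {\<omega>\<in>space M. path_from t \<omega> \<in> C}"
    using hist_path_infinity[OF t(1)] by blast
  have "emeasure (sub_law (P s x) (G \<inter> H) Y) B = emeasure (P s x) (G \<inter> ?D)"
    using emeasure_sub_law[OF sets_P[OF s] sets.Int[OF GM HM] YM B] by (simp add: Int_assoc)
  also have "\<dots> = (\<integral>\<^sup>+\<omega>. indicator G \<omega> * emeasure (P t (X t \<omega>)) ?D \<partial>P s x)"
    unfolding C(2) by (rule markov_set[OF s t G C(1)])
  also have "\<dots> = (\<integral>\<^sup>+\<omega>. indicator G \<omega> * emeasure (sub_law (P t (X t \<omega>)) H Y) B \<partial>P s x)"
    unfolding emeasure_sub_law[OF sets_P[OF t(1)] HM YM B] ..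
  also have "\<dots> = (\<integral>\<^sup>+y. emeasure (sub_law (P t y) H Y) B \<partial>sub_law (P s x) G (X t))"
    by (rule nn_integral_sub_law[OF sets_P[OF s] GM measurable_X[OF t(1)], symmetric]) (rule measurable_emeasure_kernel[OF K B])
  also have "\<dots> = emeasure (sub_law (P s x) G (X t) \<bind> (\<lambda>y. sub_law (P t y) H Y)) B"
    by (rule emeasure_bind[OF ne K' B, symmetric])
  finally show "emeasure (sub_law (P s x) (G \<inter> H) Y) B = emeasure (sub_law (P s x) G (X t) \<bind> (\<lambda>y. sub_law (P t y) H Y)) B" .
qed

end

locale nonincreasing_boundary = moving_boundary I \<E> M X P A
  for I :: "real set"
    and \<E> :: "'e::metric_space measure"
    and M :: "'w measure"
    and X :: "real \<Rightarrow> 'w \<Rightarrow> 'e"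
    and P :: "real \<Rightarrow> 'e \<Rightarrow> 'w measure"
    and A :: "real \<Rightarrow> 'e set" +
  assumes antitone: "\<And>s t. s \<in> I \<Longrightarrow> t \<in> I \<Longrightarrow> s \<le> t \<Longrightarrow> A t \<subseteq> A s"
begin

definition alive_A :: "real \<Rightarrow> real \<Rightarrow> 'w set" where
  "alive_A s t = {\<omega>\<in>space M. ereal t < hitting A s \<omega>}"

definition alive_inf :: "real \<Rightarrow> real \<Rightarrow> 'w set" where
  "alive_inf s t = {\<omega>\<in>space M. ereal t < hitting (\<lambda>_. A_inf) s \<omega>}"

definition kernel_A :: "real \<Rightarrow> real \<Rightarrow> 'e \<Rightarrow> 'e measure" where
  "kernel_A s t x = sub_law (P s x) (alive_A s t) (X t)"

definition kernel_inf :: "real \<Rightarrow> 'e \<Rightarrow> 'e measure" where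
  "kernel_inf t x = sub_law (P 0 x) (alive_inf 0 t) (X t)"

text \<open>By monotonicity of the boundary the intersection may be taken over integer times, hence
  is countable.\<close>

lemma A_inf_sets [measurable]: "A_inf \<in> sets \<E>"
proof -
  have "A_inf = (\<Inter>n. A (real n))"
  proof safe
    fix x n assume "x \<in> A_inf"
    then show "x \<in> A (real n)" using time_of_nat[of n] unfolding A_inf_def by blast
  next
    fix x assume x: "x \<in> (\<Inter>n. A (real n))"
    have "x \<in> A t" if t: "t \<in> I" for t
    proof -
      obtain n where "t \<le> real n" using real_arch_simple by blast
      then show ?thesis using antitone[OF t time_of_nat, of n] x by blast
    qed
    then show "x \<in> A_inf" unfolding A_inf_def by blast
  qed
  also have "\<dots> \<in> sets \<E>" by (intro sets.countable_INT) (auto intro: sets_A)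
  finally show ?thesis .
qed

lemma E_inf_sets: "E_inf \<in> sets \<E>"
  using sets.compl_sets[OF A_inf_sets] by (simp add: E_inf_def space_states Compl_eq_Diff_UNIV)

lemma E_sets: "t \<in> I \<Longrightarrow> E t \<in> sets \<E>"
  using sets.compl_sets[OF sets_A] by (simp add: E_def space_states Compl_eq_Diff_UNIV)

lemma stopping_tau_inf: "stopping_time (hist 0) (hitting (\<lambda>_. A_inf) 0)"
  using stopping_inf by (simp add: A_inf_def)

lemma alive_A_hist: "s \<in> I \<Longrightarrow> alive_A s t \<in> sets (hist s (ereal t))"
  unfolding alive_A_def by (rule stopping_gt_sets[OF stopping_A])

lemma alive_inf_hist: "alive_inf 0 t \<in> sets (hist 0 (ereal t))"
  unfolding alive_inf_def by (rule stopping_gt_sets[OF stopping_tau_inf])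

lemma alive_sets: "s \<in> I \<Longrightarrow> alive_A s t \<in> sets M" "alive_inf 0 t \<in> sets M"
  using alive_A_hist alive_inf_hist sets_hist_subset by blast+

lemma alive_A_split: "s \<le> t \<Longrightarrow> t \<le> u \<Longrightarrow> alive_A s u = alive_A s t \<inter> alive_A t u"
  unfolding alive_A_def using hitting_gt_split by blast

lemma alive_inf_split: "s \<le> t \<Longrightarrow> t \<le> u \<Longrightarrow> alive_inf s u = alive_inf s t \<inter> alive_inf t u"
  unfolding alive_inf_def using hitting_gt_split by blast

lemma shifted_event_inf:
  assumes s: "s \<in> I" and t: "t \<in> I" and B: "B \<in> sets \<E>"
  shows "alive_inf s (s + t) \<in> sets (hist s \<infinity>)"
    and "emeasure (P s x) (alive_inf s (s + t) \<inter> {\<omega>\<in>space M. X (s + t) \<omega> \<in> B})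
      = emeasure (P 0 x) (alive_inf 0 t \<inter> {\<omega>\<in>space M. X t \<omega> \<in> B})"
proof -
  have h: "alive_inf 0 t \<in> sets (hist 0 \<infinity>)"
    using alive_inf_hist[of t] hist_mono[of 0 0 "ereal t" \<infinity>] by auto
  have iff: "ereal (s + t) < hitting (\<lambda>_. A_inf) s \<omega> \<longleftrightarrow> ereal t < hitting (\<lambda>_. A_inf) 0 \<omega>'"
    if "path_from s \<omega> = path_from 0 \<omega>'" for \<omega> \<omega>'
    using hitting_shift[OF s that, of "\<lambda>_. A_inf"] ereal_add_left_mono_iff(2)[of s "ereal t"] by simp
  show "alive_inf s (s + t) \<in> sets (hist s \<infinity>)"
    by (rule homogeneous_event(1)[OF s h]) (auto simp: alive_inf_def iff)
  have "{\<omega>\<in>space M. X t \<omega> \<in> B} \<in> sets (hist 0 \<infinity>)"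
    using measurable_sets[OF measurable_X_hist[OF t, of 0 \<infinity>] B] time_nonneg[OF t]
    by (simp add: vimage_def Int_def conj_commute)
  then have "alive_inf 0 t \<inter> {\<omega>\<in>space M. X t \<omega> \<in> B} \<in> sets (hist 0 \<infinity>)" using h by auto
  then show "emeasure (P s x) (alive_inf s (s + t) \<inter> {\<omega>\<in>space M. X (s + t) \<omega> \<in> B})
      = emeasure (P 0 x) (alive_inf 0 t \<inter> {\<omega>\<in>space M. X t \<omega> \<in> B})"
    by (rule homogeneous_event(2)[OF s]) (auto simp: alive_inf_def iff path_from_eq[OF _ t])
qed

text \<open>The limit set does not move, so killing there depends on elapsed time only; this gives a
  one-parameter semigroup.\<close>

lemma sub_law_alive_inf_shift:
  assumes s: "s \<in> I" and t: "t \<in> I"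
  shows "sub_law (P s x) (alive_inf s (s + t)) (X (s + t)) = kernel_inf t x"
proof (rule measure_eqI)
  fix B assume "B \<in> sets (sub_law (P s x) (alive_inf s (s + t)) (X (s + t)))"
  then have B: "B \<in> sets \<E>" by simp
  have "alive_inf s (s + t) \<in> sets M" using shifted_event_inf(1)[OF s t B] sets_hist_subset by blast
  then show "emeasure (sub_law (P s x) (alive_inf s (s + t)) (X (s + t))) B = emeasure (kernel_inf t x) B"
    unfolding kernel_inf_def using s t B
    by (simp add: emeasure_sub_law[OF sets_P _ measurable_X] alive_sets shifted_event_inf(2))
qed (simp add: kernel_inf_def)

lemma measure_kernel_A: "s \<in> I \<Longrightarrow> t \<in> I \<Longrightarrow> measure (kernel_A s t x) UNIV = survival (P s x) (tau_A s) t"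
  by (simp add: kernel_A_def measure_sub_law_UNIV[OF sets_P alive_sets(1) measurable_X] survival_def tau_A_def alive_A_def[symmetric])

lemma measure_kernel_inf: "t \<in> I \<Longrightarrow> measure (kernel_inf t x) UNIV = survival (P 0 x) tau_inf t"
  by (simp add: kernel_inf_def measure_sub_law_UNIV[OF sets_P alive_sets(2) measurable_X] survival_def tau_inf_def alive_inf_def[symmetric])

text \<open>A point outside the intersection lies outside some A s. Started there at time s, the
  process survives the moving boundary with positive probability and, a fortiori, the smaller set
  \<open>A_inf\<close>; homogeneity brings the start back to time 0.\<close>

lemma survival_inf_pos:
  assumes t: "t \<in> I" and x: "x \<in> E_inf"
  shows "0 < measure (kernel_inf t x) UNIV"
proof -
  obtain s where s: "s \<in> I" "x \<notin> A s" using x by (auto simp: E_inf_def A_inf_def)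
  interpret prob_space "P s x" by (rule prob_P[OF s(1)])
  have sub: "alive_inf s (s + t) \<in> sets M"
    using shifted_event_inf(1)[OF s(1) t sets.top] sets_hist_subset by blast
  have "0 < measure (P s x) (alive_A s (s + t))"
    using survives[of s "s + t" x] s t time_nonneg[OF t] by (simp add: survival_def alive_A_def)
  also have "\<dots> \<le> measure (P s x) (alive_inf s (s + t))"
  proof (rule finite_measure_mono)
    have "hitting A s \<omega> \<le> hitting (\<lambda>_. A_inf) s \<omega>" for \<omega>
      by (rule hitting_antimono) (auto simp: A_inf_def)
    then show "alive_A s (s + t) \<subseteq> alive_inf s (s + t)"
      unfolding alive_A_def alive_inf_def using order.strict_trans2 by blast
  qed (use sub s in simp)
  also have "\<dots> = measure (kernel_inf t x) UNIV"
    using measure_sub_law_UNIV[OF sets_P[OF s(1)] sub measurable_X, of "s + t" x] s t sub_law_alive_inf_shift[OF s(1) t, of x] by simp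
  finally show ?thesis .
qed

section \<open>The two killed evolutions of the process\<close>

sublocale inf: killed_semigroup I \<E> E_inf kernel_inf
proof
  show "space \<E> = UNIV" by (rule space_states)
  show "E_inf \<in> sets \<E>" by (rule E_inf_sets)
  fix t x assume t: "t \<in> I"
  show "kernel_inf t \<in> \<E> \<rightarrow>\<^sub>M subprob_algebra \<E>"
    unfolding kernel_inf_def[abs_def] by (rule sub_law_kernel[OF time_0 alive_sets(2) measurable_X[OF t]])
  have "alive_inf 0 t \<inter> {\<omega>\<in>space M. X t \<omega> \<in> A_inf} = {}"
    using hitting_gt_imp_notin[of t "\<lambda>_. A_inf" 0] t time_nonneg[OF t] by (auto simp: alive_inf_def)
  then show "emeasure (kernel_inf t x) (- E_inf) = 0"
    unfolding kernel_inf_def E_inf_def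
    by (simp add: emeasure_sub_law[OF sets_P[OF time_0] alive_sets(2) measurable_X[OF t] A_inf_sets])
  show "0 < measure (kernel_inf t x) UNIV" if "x \<in> E_inf" by (rule survival_inf_pos[OF t that])
  show "measure (kernel_inf t x) UNIV = 0" if "x \<notin> E_inf"
  proof -
    have "measure (P 0 x) (alive_inf 0 t) = 0"
    proof (rule measure_eq_0_null_sets, rule AE_iff_null_sets[THEN iffD2])
      show "alive_inf 0 t \<in> sets (P 0 x)" using alive_sets(2) by simp
      show "AE \<omega> in P 0 x. \<omega> \<notin> alive_inf 0 t"
        using start[OF time_0, of x]
      proof eventually_elim
        case (elim \<omega>)
        then have "hitting (\<lambda>_. A_inf) 0 \<omega> \<le> ereal 0" using that by (intro hitting_le_start) (auto simp: E_inf_def)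
        also have "\<dots> \<le> ereal t" using time_nonneg[OF t] by simp
        finally show ?case by (auto simp: alive_inf_def)
      qed
    qed
    then show ?thesis
      by (simp add: kernel_inf_def measure_sub_law_UNIV[OF sets_P[OF time_0] alive_sets(2) measurable_X[OF t]])
  qed
next
  fix s t x assume s: "s \<in> I" and t: "t \<in> I"
  have "alive_inf 0 (s + t) = alive_inf 0 s \<inter> alive_inf s (s + t)"
    by (rule alive_inf_split) (use s t time_nonneg in auto)
  then have "kernel_inf (s + t) x = sub_law (P 0 x) (alive_inf 0 s) (X s) \<bind> (\<lambda>y. sub_law (P s y) (alive_inf s (s + t)) (X (s + t)))"
    unfolding kernel_inf_def
    using sub_law_bind[OF time_0 s _ measurable_X_hist[OF time_add[OF s t]] alive_inf_hist shifted_event_inf(1)[OF s t sets.top], of x]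
      s t time_nonneg[OF s] time_nonneg[OF t] by simp
  then show "kernel_inf (s + t) x = kernel_inf s x \<bind> kernel_inf t"
    unfolding sub_law_alive_inf_shift[OF s t] kernel_inf_def .
qed

sublocale mov: killed_propagator I \<E> E kernel_A
proof
  show "space \<E> = UNIV" by (rule space_states)
  fix t assume t: "t \<in> I"
  show "E t \<in> sets \<E>" by (rule E_sets[OF t])
next
  fix s t x assume s: "s \<in> I" and t: "t \<in> I" "s \<le> t"
  show "kernel_A s t \<in> \<E> \<rightarrow>\<^sub>M subprob_algebra \<E>"
    unfolding kernel_A_def[abs_def] by (rule sub_law_kernel[OF s alive_sets(1)[OF s] measurable_X[OF t(1)]])
  have "alive_A s t \<inter> {\<omega>\<in>space M. X t \<omega> \<in> A t} = {}"
    using hitting_gt_imp_notin[of t A s] t by (auto simp: alive_A_def)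
  then show "emeasure (kernel_A s t x) (- E t) = 0"
    unfolding kernel_A_def E_def
    by (simp add: emeasure_sub_law[OF sets_P[OF s] alive_sets(1)[OF s] measurable_X[OF t(1)] sets_A[OF t(1)]])
  show "0 < measure (kernel_A s t x) UNIV" if "x \<in> E s"
    using survives[OF s t, of x] that measure_kernel_A[OF s t(1)] by (simp add: E_def tau_A_def)
next
  fix s t u x assume s: "s \<in> I" and t: "t \<in> I" and u: "u \<in> I" and st: "s \<le> t" and tu: "t \<le> u"
  have "alive_A t u \<in> sets (hist t \<infinity>)"
    using alive_A_hist[OF t, of u] hist_mono[of t t "ereal u" \<infinity>] by auto
  then show "kernel_A s u x = kernel_A s t x \<bind> kernel_A t u"
    unfolding kernel_A_def alive_A_split[OF st tu] using sub_law_bind[OF s t st measurable_X_hist[OF u tu] alive_A_hist[OF s], of "alive_A t u" x] by simp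
qed

end

section \<open>Total variation, mixed initial laws and conditional laws\<close>

text \<open>A real supremum dominates its members only for a bounded family; here every difference
  is at most 2, since both measures are probabilities.\<close>

lemma total_variation_ge:
  fixes f :: "'e::metric_space \<Rightarrow> real"
  assumes "prob_space \<mu>" "prob_space \<nu>" "sets \<mu> = sets \<E>" "sets \<nu> = sets \<E>"
    and "f \<in> borel_measurable \<E>" "\<And>x. x \<in> space \<E> \<Longrightarrow> \<bar>f x\<bar> \<le> 1"
  shows "\<bar>(\<integral>x. f x \<partial>\<mu>) - (\<integral>x. f x \<partial>\<nu>)\<bar> \<le> total_variation \<E> \<mu> \<nu>"
  unfolding total_variation_def
proof (rule cSUP_upper)
  show "f \<in> {f \<in> borel_measurable \<E>. \<forall>x\<in>space \<E>. \<bar>f x\<bar> \<le> 1}" using assms(5,6) by blast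
  have sub: "\<mu> \<in> space (subprob_algebra \<E>)" "\<nu> \<in> space (subprob_algebra \<E>)"
    using assms(1-4) by (auto simp: space_subprob_algebra prob_space_imp_subprob_space)
  show "bdd_above ((\<lambda>f. \<bar>(\<integral>x. f x \<partial>\<mu>) - (\<integral>x. f x \<partial>\<nu>)\<bar>) ` {f \<in> borel_measurable \<E>. \<forall>x\<in>space \<E>. \<bar>f x\<bar> \<le> (1::real)})"
  proof (rule bdd_aboveI2[where M = "2::real"])
    fix g :: "'e \<Rightarrow> real" assume g: "g \<in> {f \<in> borel_measurable \<E>. \<forall>x\<in>space \<E>. \<bar>f x\<bar> \<le> 1}"
    have le: "\<bar>\<integral>x. g x \<partial>N\<bar> \<le> 1" if "N \<in> space (subprob_algebra \<E>)" for N
      using abs_integral_subprob_le[OF that, of g 1] g subprob_space.subprob_measure_le_1[of N] that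
      by (auto simp: space_subprob_algebra intro: order.trans)
    show "\<bar>(\<integral>x. g x \<partial>\<mu>) - (\<integral>x. g x \<partial>\<nu>)\<bar> \<le> 2"
      using le[OF sub(1)] le[OF sub(2)] by linarith
  qed
qed

context markov_process
begin

lemma law_from_return: "s \<in> I \<Longrightarrow> law_from s (return \<E> x) = P s x"
  unfolding law_from_def
  by (rule bind_return[OF measurable_prob_algebraD[OF kernel]]) (auto simp: space_states)

lemma return_prob_measures: "F \<in> sets \<E> \<Longrightarrow> x \<in> F \<Longrightarrow> return \<E> x \<in> prob_measures F"
  unfolding prob_measures_def by (auto simp: space_prob_algebra space_states intro!: prob_space_return)

lemma law_from_prob:
  assumes s: "s \<in> I" and \<mu>: "\<mu> \<in> space (prob_algebra \<E>)"
  shows "prob_space (law_from s \<mu>)" "sets (law_from s \<mu>) = sets M" "space (law_from s \<mu>) = space M"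
proof -
  have K: "P s \<in> \<mu> \<rightarrow>\<^sub>M prob_algebra M"
    using kernel[OF s] \<mu> by (simp add: space_prob_algebra cong: measurable_cong_sets)
  show "prob_space (law_from s \<mu>)"
    unfolding law_from_def by (rule prob_space_bind'[OF \<mu> kernel[OF s]])
  have ne: "space \<mu> \<noteq> {}" using \<mu> by (auto simp: space_prob_algebra prob_space.not_empty)
  show "sets (law_from s \<mu>) = sets M"
    unfolding law_from_def by (rule sets_bind[OF _ ne]) (use s in simp)
  then show "space (law_from s \<mu>) = space M" by (rule sets_eq_imp_space_eq)
qed

lemma integral_law_from:
  fixes g :: "'w \<Rightarrow> real"
  assumes s: "s \<in> I" and \<mu>: "\<mu> \<in> space (prob_algebra \<E>)" and g: "g \<in> borel_measurable M" "\<And>\<omega>. \<bar>g \<omega>\<bar> \<le> c"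
  shows "(\<integral>\<omega>. g \<omega> \<partial>law_from s \<mu>) = (\<integral>x. \<integral>\<omega>. g \<omega> \<partial>P s x \<partial>\<mu>)"
  unfolding law_from_def
  by (rule integral_bind_kernel[OF _ measurable_prob_algebraD[OF kernel[OF s]]])
    (use \<mu> g in \<open>auto simp: space_prob_algebra space_subprob_algebra prob_space_imp_subprob_space\<close>)

lemma survival_law_from:
  assumes s: "s \<in> I" and \<mu>: "\<mu> \<in> space (prob_algebra \<E>)" and Z: "{\<omega>\<in>space M. ereal t < T \<omega>} \<in> sets M"
  shows "survival (law_from s \<mu>) T t = (\<integral>x. survival (P s x) T t \<partial>\<mu>)"
proof -
  have "survival (law_from s \<mu>) T t = (\<integral>\<omega>. indicator {\<omega>\<in>space M. ereal t < T \<omega>} \<omega> \<partial>law_from s \<mu>)"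
    using Z law_from_prob[OF s \<mu>] by (simp add: survival_def Int_absorb2)
  also have "\<dots> = (\<integral>x. \<integral>\<omega>. indicator {\<omega>\<in>space M. ereal t < T \<omega>} \<omega> \<partial>P s x \<partial>\<mu>)"
    by (rule integral_law_from[OF s \<mu>, where c = 1]) (use Z in \<open>auto simp: indicator_def\<close>)
  also have "\<dots> = (\<integral>x. survival (P s x) T t \<partial>\<mu>)"
    using Z s by (simp add: survival_def Int_absorb2)
  finally show ?thesis .
qed

lemma law_given_prob:
  assumes N: "prob_space N" "sets N = sets M" and r: "r \<in> I"
    and Z: "{\<omega>\<in>space M. ereal t < T \<omega>} \<in> sets M" and pos: "0 < survival N T t"
  shows "prob_space (law_given N T t r)" "sets (law_given N T t r) = sets \<E>"
proof -
  interpret prob_space N by fact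
  have "prob_space (uniform_measure N {\<omega>\<in>space M. ereal t < T \<omega>})"
    using pos by (intro prob_space_uniform_measure) (auto simp: survival_def emeasure_eq_measure)
  then show "prob_space (law_given N T t r)"
    unfolding law_given_def
    by (rule prob_space.prob_space_distr) (use N measurable_X[OF r] in \<open>simp cong: measurable_cong_sets\<close>)
  show "sets (law_given N T t r) = sets \<E>" by (simp add: law_given_def)
qed

text \<open>Under \<open>P t y\<close> the position at time t is y almost surely, so f factors out
  and the future event H enters only through its probability given the position at t.\<close>

lemma sub_law_weight:
  fixes f :: "'e \<Rightarrow> real"
  assumes s: "s \<in> I" and t: "t \<in> I" "s \<le> t"
    and G: "G \<in> sets (hist s t)" and H: "H \<in> sets (hist t \<infinity>)"
    and f: "f \<in> borel_measurable \<E>" "\<And>y. \<bar>f y\<bar> \<le> c"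
  shows "(\<integral>y. f y \<partial>sub_law (P s x) (G \<inter> H) (X t)) = (\<integral>y. f y * measure (P t y) H \<partial>sub_law (P s x) G (X t))"
proof -
  have GM: "G \<in> sets M" and HM: "H \<in> sets M" using G H sets_hist_subset by blast+
  note Xt = measurable_X[OF t(1)]
  have K: "(\<lambda>y. sub_law (P t y) H (X t)) \<in> \<E> \<rightarrow>\<^sub>M subprob_algebra \<E>" by (rule sub_law_kernel[OF t(1) HM Xt])
  have sp: "sub_law (P s x) G (X t) \<in> space (subprob_algebra \<E>)"
    using measurable_space[OF sub_law_kernel[OF s GM Xt], of x] by (simp add: space_states)
  have "X t \<in> hist t \<infinity> \<rightarrow>\<^sub>M \<E>" by (rule measurable_X_hist) (use t in auto)
  note bind = sub_law_bind[OF s t this G H, of x]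
  have "(\<integral>y. f y \<partial>sub_law (P s x) (G \<inter> H) (X t)) = (\<integral>y. \<integral>z. f z \<partial>sub_law (P t y) H (X t) \<partial>sub_law (P s x) G (X t))"
    unfolding bind by (rule integral_bind_kernel[OF sp K f(1)]) (rule f(2))
  also have "\<dots> = (\<integral>y. f y * measure (P t y) H \<partial>sub_law (P s x) G (X t))"
  proof (rule Bochner_Integration.integral_cong[OF refl])
    fix y
    have "(\<integral>z. f z \<partial>sub_law (P t y) H (X t)) = (\<integral>\<omega>. indicator H \<omega> * f (X t \<omega>) \<partial>P t y)"
      by (rule integral_sub_law[OF sets_P[OF t(1)] HM Xt f(1)])
    also have "\<dots> = (\<integral>\<omega>. indicator H \<omega> * f y \<partial>P t y)"
    proof (rule integral_cong_AE)
      show "AE \<omega> in P t y. indicator H \<omega> * f (X t \<omega>) = indicator H \<omega> * f y"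
        using start[OF t(1), of y] by eventually_elim simp
      have "(\<lambda>\<omega>. f (X t \<omega>)) \<in> borel_measurable M" by (rule measurable_compose[OF Xt f(1)])
      then show "(\<lambda>\<omega>. indicator H \<omega> * f (X t \<omega>)) \<in> borel_measurable (P t y)"
        using HM t(1) by (simp cong: measurable_cong_sets)
      show "(\<lambda>\<omega>. indicator H \<omega> * f y) \<in> borel_measurable (P t y)" using HM t(1) by simp
    qed
    also have "\<dots> = f y * measure (P t y) H"
      using HM t(1) sets.sets_into_space[OF HM] by (simp add: Int_absorb2)
    finally show "(\<integral>z. f z \<partial>sub_law (P t y) H (X t)) = f y * measure (P t y) H" .
  qed
  finally show ?thesis .
qed

end

context nonincreasing_boundary
begin

lemma surv_A: "s \<in> I \<Longrightarrow> t \<in> I \<Longrightarrow> mov.surv s t x = measure (P s x) (alive_A s t)"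
  by (simp add: mov.surv_def kernel_A_def measure_sub_law_UNIV[OF sets_P alive_sets(1) measurable_X])

lemma surv_inf: "t \<in> I \<Longrightarrow> inf.surv t x = measure (P 0 x) (alive_inf 0 t)"
  by (simp add: inf.surv_def kernel_inf_def measure_sub_law_UNIV[OF sets_P alive_sets(2) measurable_X])

lemma integral_alive_A:
  fixes f :: "'e \<Rightarrow> real"
  assumes s: "s \<in> I" and r: "r \<in> I" "s \<le> r" and T: "T \<in> I" "r \<le> T"
    and f: "f \<in> borel_measurable \<E>" "\<And>y. \<bar>f y\<bar> \<le> c"
  shows "(\<integral>y. f y * mov.surv r T y \<partial>kernel_A s r x) = (\<integral>y. f y \<partial>sub_law (P s x) (alive_A s T) (X r))"
proof -
  have "alive_A r T \<in> sets (hist r \<infinity>)"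
    using alive_A_hist[OF r(1), of T] hist_mono[of r r "ereal T" \<infinity>] by auto
  then show ?thesis
    unfolding alive_A_split[OF r(2) T(2)] kernel_A_def surv_A[OF r(1) T(1)]
    by (rule sub_law_weight[OF s r alive_A_hist[OF s] _ f, symmetric])
qed

lemma measure_alive_inf_shift:
  assumes s: "s \<in> I" and t: "t \<in> I"
  shows "measure (P s y) (alive_inf s (s + t)) = inf.surv t y"
proof -
  have "alive_inf s (s + t) \<in> sets M" using shifted_event_inf(1)[OF s t sets.top] sets_hist_subset by blast
  from measure_sub_law_UNIV[OF sets_P[OF s] this measurable_X, of "s + t" y]
  show ?thesis using sub_law_alive_inf_shift[OF s t, of y] s t by (simp add: inf.surv_def)
qed

lemma integral_alive_inf:
  fixes f :: "'e \<Rightarrow> real"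
  assumes r: "r \<in> I" and L: "L \<in> I" and f: "f \<in> borel_measurable \<E>" "\<And>y. \<bar>f y\<bar> \<le> c"
  shows "(\<integral>y. f y * inf.surv L y \<partial>kernel_inf r x) = (\<integral>y. f y \<partial>sub_law (P 0 x) (alive_inf 0 (r + L)) (X r))"
proof -
  have "alive_inf 0 (r + L) = alive_inf 0 r \<inter> alive_inf r (r + L)"
    by (rule alive_inf_split) (use r L time_nonneg in auto)
  then show ?thesis
    unfolding kernel_inf_def measure_alive_inf_shift[OF r L, symmetric]
    using sub_law_weight[OF time_0 r time_nonneg[OF r] alive_inf_hist shifted_event_inf(1)[OF r L sets.top] f, of x] by simp
qed

text \<open>Point masses at x as initial laws turn the uniform convergence into the pointwise
  estimate, and \<open>integral_law_given\<close> turns the conditional law into a quotient of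
  killed integrals.\<close>

lemma exp_ergodic_alpha_inf:
  assumes H_inf
  shows "\<exists>C \<gamma>. exp_ergodic I \<E> E_inf kernel_inf alpha_inf C \<gamma>"
proof -
  have "attracting alpha_inf"
    unfolding alpha_inf_def by (rule theI') (use assms in \<open>simp add: H_inf_def\<close>)
  then obtain C \<gamma> where pm: "alpha_inf \<in> prob_measures E_inf" and C: "0 < C" and \<gamma>: "0 < \<gamma>"
    and tv: "\<And>\<mu> t. \<mu> \<in> prob_measures E_inf \<Longrightarrow> t \<in> I \<Longrightarrow>
      total_variation \<E> (law_given (law_from 0 \<mu>) tau_inf t t) alpha_inf \<le> C * exp (- \<gamma> * t)"
    unfolding attracting_def by blast
  have "exp_ergodic I \<E> E_inf kernel_inf alpha_inf C \<gamma>"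
  proof unfold_locales
    show "alpha_inf \<in> space (prob_algebra \<E>)" "emeasure alpha_inf E_inf = 1"
      using pm by (auto simp: prob_measures_def)
    fix x t and f :: "'e \<Rightarrow> real"
    assume x: "x \<in> E_inf" and t: "t \<in> I" and f: "f \<in> borel_measurable \<E>" "\<And>y. \<bar>f y\<bar> \<le> 1"
    have Z: "{\<omega>\<in>space M. ereal t < tau_inf \<omega>} \<in> sets M"
      using alive_sets(2)[of t] by (simp add: alive_inf_def tau_inf_def)
    have pos: "0 < survival (P 0 x) tau_inf t"
      using survival_inf_pos[OF t x] measure_kernel_inf[OF t] by simp
    have "(\<integral>y. f y \<partial>law_given (P 0 x) tau_inf t t) = (\<integral>y. f y \<partial>kernel_inf t x) / measure (P 0 x) (alive_inf 0 t)"
      unfolding kernel_inf_def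
      by (rule integral_law_given[OF sets_P[OF time_0] alive_sets(2) measurable_X[OF t] f(1)])
        (auto simp: alive_inf_def tau_inf_def prob_space.finite_measure[OF prob_P])
    moreover have "\<bar>(\<integral>y. f y \<partial>law_given (P 0 x) tau_inf t t) - (\<integral>y. f y \<partial>alpha_inf)\<bar>
        \<le> total_variation \<E> (law_given (P 0 x) tau_inf t t) alpha_inf"
      by (rule total_variation_ge)
        (use law_given_prob[OF prob_P sets_P t Z pos] pm f in \<open>auto simp: prob_measures_def space_prob_algebra\<close>)
    moreover have "\<dots> \<le> C * exp (- \<gamma> * t)"
      using tv[OF return_prob_measures[OF E_inf_sets x] t] by (simp add: law_from_return)
    ultimately show "\<bar>(\<integral>y. f y \<partial>kernel_inf t x) / measure (kernel_inf t x) UNIV - (\<integral>y. f y \<partial>alpha_inf)\<bar> \<le> C * exp (- \<gamma> * t)"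
      using surv_inf[OF t, of x] by (simp add: inf.surv_def)
  qed (use C \<gamma> in auto)
  then show ?thesis by blast
qed

lemma doeblin_of_cond_A':
  assumes cond_A'
  shows "\<exists>\<nu> t0 c1 c2. doeblin_propagator I \<E> E kernel_A \<nu> t0 c1 c2"
proof -
  obtain \<nu> t0 c1 c2 where \<nu>: "\<And>s. s \<in> I \<Longrightarrow> \<nu> s \<in> prob_measures (E s)"
    and t0: "t0 \<in> I" "0 < t0" and c: "0 < c1" "0 < c2"
    and A1: "\<And>s x B. s \<in> I \<Longrightarrow> x \<in> E s \<Longrightarrow> B \<in> sets \<E> \<Longrightarrow>
        c1 * measure (\<nu> (s + t0)) B \<le> measure (law_given (P s x) (tau_A s) (s + t0) (s + t0)) B"
    and A2: "\<And>s t x. s \<in> I \<Longrightarrow> t \<in> I \<Longrightarrow> x \<in> E s \<Longrightarrow> s \<le> t \<Longrightarrow>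
        c2 * survival (P s x) (tau_A s) t \<le> survival (law_from s (\<nu> s)) (tau_A s) t"
    using assms unfolding cond_A'_def by blast
  have "doeblin_propagator I \<E> E kernel_A \<nu> t0 c1 c2"
  proof unfold_locales
    fix s assume s: "s \<in> I"
    show "\<nu> s \<in> space (prob_algebra \<E>)" "emeasure (\<nu> s) (E s) = 1"
      using \<nu>[OF s] by (auto simp: prob_measures_def)
  next
    fix s x B assume s: "s \<in> I" and x: "x \<in> E s" and B: "B \<in> sets \<E>"
    let ?t = "s + t0"
    have t: "?t \<in> I" "s \<le> ?t" using s t0 by auto
    have Z: "{\<omega>\<in>space M. ereal ?t < tau_A s \<omega>} \<in> sets M"
      using alive_sets(1)[OF s, of ?t] by (simp add: alive_A_def tau_A_def)
    have pos: "0 < survival (P s x) (tau_A s) ?t"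
      using mov.alive[OF s t x] measure_kernel_A[OF s t(1)] by simp
    interpret lg: prob_space "law_given (P s x) (tau_A s) ?t ?t"
      by (rule law_given_prob[OF prob_P[OF s] sets_P[OF s] t(1) Z pos])
    have sets_lg: "sets (law_given (P s x) (tau_A s) ?t ?t) = sets \<E>" by (simp add: law_given_def)
    have "measure (law_given (P s x) (tau_A s) ?t ?t) B = (\<integral>y. indicator B y \<partial>law_given (P s x) (tau_A s) ?t ?t)"
      using B sets_lg by simp
    also have "\<dots> = (\<integral>y. indicator B y \<partial>kernel_A s ?t x) / measure (P s x) (alive_A s ?t)"
      unfolding kernel_A_def
      by (rule integral_law_given[OF sets_P[OF s] alive_sets(1)[OF s] measurable_X[OF t(1)]])
        (use B in \<open>auto simp: alive_A_def tau_A_def prob_space.finite_measure[OF prob_P[OF s]]\<close>)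
    also have "(\<integral>y. indicator B y \<partial>kernel_A s ?t x) = measure (kernel_A s ?t x) B"
      using B by (simp add: kernel_A_def)
    also have "measure (P s x) (alive_A s ?t) = measure (kernel_A s ?t x) UNIV"
      using surv_A[OF s t(1)] by (simp add: mov.surv_def)
    finally show "c1 * measure (\<nu> ?t) B * measure (kernel_A s ?t x) UNIV \<le> measure (kernel_A s ?t x) B"
      using A1[OF s x B] pos measure_kernel_A[OF s t(1)] by (simp add: pos_le_divide_eq)
  next
    fix s t x assume s: "s \<in> I" and t: "t \<in> I" "s \<le> t" and x: "x \<in> E s"
    have Z: "{\<omega>\<in>space M. ereal t < tau_A s \<omega>} \<in> sets M"
      using alive_sets(1)[OF s, of t] by (simp add: alive_A_def tau_A_def)
    have "survival (law_from s (\<nu> s)) (tau_A s) t = (\<integral>y. measure (kernel_A s t y) UNIV \<partial>\<nu> s)"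
      using survival_law_from[OF s _ Z] \<nu>[OF s] by (simp add: prob_measures_def measure_kernel_A[OF s t(1)])
    then show "c2 * measure (kernel_A s t x) UNIV \<le> (\<integral>y. measure (kernel_A s t y) UNIV \<partial>\<nu> s)"
      using A2[OF s t(1) x t(2)] by (simp add: measure_kernel_A[OF s t(1)])
  qed (use t0 c in auto)
  then show ?thesis by blast
qed

end

text \<open>Fixes witnesses for the constants and measures whose existence is asserted by
  \<open>H_inf\<close> and \<open>cond_A'\<close>.\<close>

locale boundary_setting = nonincreasing_boundary I \<E> M X P A +
    lim: exp_ergodic I \<E> "moving_boundary.E_inf I A" "nonincreasing_boundary.kernel_inf I \<E> M X P A"
      "moving_boundary.alpha_inf I \<E> M X P A" C \<gamma> +
    dob: doeblin_propagator I \<E> "moving_boundary.E A" "nonincreasing_boundary.kernel_A I \<E> M X P A" \<nu> t0 c1 c2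
  for I :: "real set"
    and \<E> :: "'e::metric_space measure"
    and M :: "'w measure"
    and X :: "real \<Rightarrow> 'w \<Rightarrow> 'e"
    and P :: "real \<Rightarrow> 'e \<Rightarrow> 'w measure"
    and A :: "real \<Rightarrow> 'e set"
    and C \<gamma> :: real and \<nu> :: "real \<Rightarrow> 'e measure" and t0 c1 c2 :: real
begin

lemma lambda_inf_eq: "lambda_inf = lim.rate"
proof -
  have surv: "survival (law_from 0 alpha_inf) tau_inf t = exp (- lim.rate * t)" if t: "t \<in> I" for t
  proof -
    have "{\<omega>\<in>space M. ereal t < tau_inf \<omega>} \<in> sets M"
      using alive_sets(2)[of t] by (simp add: alive_inf_def tau_inf_def)
    then have "survival (law_from 0 alpha_inf) tau_inf t = (\<integral>y. inf.surv t y \<partial>alpha_inf)"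
      using survival_law_from[OF time_0 lim.\<alpha>_prob, of t tau_inf] measure_kernel_inf[OF t] by (simp add: inf.surv_def)
    then show ?thesis using lim.surv_\<alpha>[OF t] by simp
  qed
  show ?thesis
    unfolding lambda_inf_def
  proof (rule the_equality)
    show "\<forall>t\<in>I. survival (law_from 0 alpha_inf) tau_inf t = exp (- lim.rate * t)" using surv by blast
    fix l assume "\<forall>t\<in>I. survival (law_from 0 alpha_inf) tau_inf t = exp (- l * t)"
    then have "exp (- l * 1) = exp (- lim.rate * 1)" using surv[OF time_1] time_1 by metis
    then show "l = lim.rate" by simp
  qed
qed

lemma eta_inf_eq: "eta_inf x = lim.eta x"
proof (cases "x \<in> E_inf")
  case True
  have "((\<lambda>t. exp (lambda_inf * t) * survival (P 0 x) tau_inf t) \<longlongrightarrow> lim.eta x) time_top"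
    unfolding time_top_eq
  proof (rule Lim_transform_eventually[OF lim.resc_tendsto])
    show "\<forall>\<^sub>F t in to_infinity. lim.resc t x = exp (lambda_inf * t) * survival (P 0 x) tau_inf t"
      using eventually_time[of 0]
      by eventually_elim (simp add: lim.resc_def lambda_inf_eq inf.surv_def measure_kernel_inf)
  qed
  then show ?thesis
    unfolding eta_inf_def using True by (simp add: tendsto_Lim to_infinity_neq_bot time_top_eq)
next
  case False
  then show ?thesis by (simp add: eta_inf_def lim.eta_dead)
qed

end

subsection \<open>Comparison of the moving boundary with its limit\<close>

text \<open>In discrete time a nonempty set of hitting indices has a least element, so the infimum
  is attained; in continuous time every value in [0, \<infinity>] is admissible.
  \<open>strong_markov\<close> speaks only of stopping times with this range.\<close>

lemma (in markov_process) hitting_range: "hitting B 0 \<omega> \<in> ereal ` I \<union> {\<infinity>}"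
proof (cases "{t\<in>I. 0 \<le> t \<and> X t \<omega> \<in> B t} = {}")
  case True
  show ?thesis unfolding hitting_def True by (simp add: top_ereal_def)
next
  case False
  show ?thesis
    using time_set
  proof
    assume I: "I = range real"
    define n where "n = (LEAST n. X (real n) \<omega> \<in> B (real n))"
    have ex: "\<exists>n. X (real n) \<omega> \<in> B (real n)" using False I by auto
    have n: "X (real n) \<omega> \<in> B (real n)" unfolding n_def by (rule LeastI_ex[OF ex])
    have least: "n \<le> m" if "X (real m) \<omega> \<in> B (real m)" for m unfolding n_def using that by (rule Least_le)
    have "hitting B 0 \<omega> = ereal (real n)"
      unfolding hitting_def
    proof (rule antisym)
      show "(INF t\<in>{t\<in>I. 0 \<le> t \<and> X t \<omega> \<in> B t}. ereal t) \<le> ereal (real n)" by (rule INF_lower) (use n in simp)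
      show "ereal (real n) \<le> (INF t\<in>{t\<in>I. 0 \<le> t \<and> X t \<omega> \<in> B t}. ereal t)" by (rule INF_greatest) (use least I in auto)
    qed
    then show ?thesis by simp
  next
    assume I: "I = {0..}"
    have "0 \<le> hitting B 0 \<omega>" unfolding hitting_def by (rule INF_greatest) simp
    then show ?thesis using I by (cases "hitting B 0 \<omega>") auto
  qed
qed

context boundary_setting
begin

text \<open>Since \<open>strong_markov\<close> only concerns the laws \<open>P 0 x\<close>, the boundary as seen from time \<open>u\<close> is
  transported to time \<open>0\<close>.\<close>

definition sigma :: "real \<Rightarrow> 'w \<Rightarrow> ereal" where
  "sigma u = hitting (\<lambda>r. A (u + r)) 0"

definition alive_sigma :: "real \<Rightarrow> real \<Rightarrow> 'w set" where
  "alive_sigma u t = {\<omega>\<in>space M. ereal t < sigma u \<omega>}"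

text \<open>The discrepancy between the two conditionings: paths counted as surviving by the limit
  set but not by the moving boundary.\<close>

definition lost :: "real \<Rightarrow> real \<Rightarrow> 'w set" where
  "lost u t = alive_inf 0 t - alive_sigma u t"

definition boundary_cost :: "real \<Rightarrow> 'e \<Rightarrow> ennreal" where
  "boundary_cost u x = (\<integral>\<^sup>+\<omega>. ennreal (exp (lambda_inf * (real_of_ereal (tau_A u \<omega>) - u))
                     * eta_inf (at_time (tau_A u) \<omega>)) \<partial>(P u x))"

lemma sigma_stopping: "u \<in> I \<Longrightarrow> stopping_time (hist 0) (sigma u)"
  unfolding sigma_def by (rule shifted_stopping_time[OF _ stopping_A])

lemma alive_sigma_hist: "u \<in> I \<Longrightarrow> alive_sigma u t \<in> sets (hist 0 (ereal t))"
  unfolding alive_sigma_def by (rule stopping_gt_sets[OF sigma_stopping])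

lemma alive_sigma_subset: "u \<in> I \<Longrightarrow> alive_sigma u t \<subseteq> alive_inf 0 t"
proof -
  assume u: "u \<in> I"
  have "sigma u \<omega> \<le> hitting (\<lambda>_. A_inf) 0 \<omega>" for \<omega>
    unfolding sigma_def by (rule hitting_antimono) (use u in \<open>auto simp: A_inf_def\<close>)
  then show ?thesis
    unfolding alive_sigma_def alive_inf_def using order.strict_trans2 by blast
qed

lemma lost_hist: "u \<in> I \<Longrightarrow> lost u t \<in> sets (hist 0 (ereal t))"
  unfolding lost_def by (intro sets.Diff alive_inf_hist alive_sigma_hist)

lemma lost_sets: "u \<in> I \<Longrightarrow> lost u t \<in> sets M" and alive_sigma_sets: "u \<in> I \<Longrightarrow> alive_sigma u t \<in> sets M"
  using lost_hist alive_sigma_hist sets_hist_subset by blast+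

text \<open>After the transport to time 0, survival of the moving boundary and survival of the limit
  set are events under one law, so they can be subtracted.\<close>

lemma sub_law_alive_sigma:
  assumes u: "u \<in> I" and t: "t \<in> I" and K: "K \<in> I"
  shows "sub_law (P u x) (alive_A u (u + t)) (X (u + K)) = sub_law (P 0 x) (alive_sigma u t) (X K)"
proof (rule measure_eqI)
  fix B assume "B \<in> sets (sub_law (P u x) (alive_A u (u + t)) (X (u + K)))"
  then have B: "B \<in> sets \<E>" by simp
  have h: "alive_sigma u t \<in> sets (hist 0 \<infinity>)"
    using alive_sigma_hist[OF u, of t] hist_mono[of 0 0 "ereal t" \<infinity>] by auto
  have iff: "ereal (u + t) < hitting A u \<omega> \<longleftrightarrow> ereal t < sigma u \<omega>'"
    if "path_from u \<omega> = path_from 0 \<omega>'" for \<omega> \<omega>'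
    using hitting_shift[OF u that, of A] ereal_add_left_mono_iff(2)[of u "ereal t"] by (simp add: sigma_def)
  have "{\<omega>\<in>space M. X K \<omega> \<in> B} \<in> sets (hist 0 \<infinity>)"
    using measurable_sets[OF measurable_X_hist[OF K, of 0 \<infinity>] B] time_nonneg[OF K]
    by (simp add: vimage_def Int_def conj_commute)
  then have "alive_sigma u t \<inter> {\<omega>\<in>space M. X K \<omega> \<in> B} \<in> sets (hist 0 \<infinity>)" using h by auto
  then have "emeasure (P u x) (alive_A u (u + t) \<inter> {\<omega>\<in>space M. X (u + K) \<omega> \<in> B})
      = emeasure (P 0 x) (alive_sigma u t \<inter> {\<omega>\<in>space M. X K \<omega> \<in> B})"
    by (rule homogeneous_event(2)[OF u]) (auto simp: alive_A_def alive_sigma_def iff path_from_eq[OF _ K])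
  then show "emeasure (sub_law (P u x) (alive_A u (u + t)) (X (u + K))) B = emeasure (sub_law (P 0 x) (alive_sigma u t) (X K)) B"
    using u K B by (simp add: emeasure_sub_law[OF sets_P _ measurable_X] alive_sets alive_sigma_sets)
qed simp

lemma at_time_measurable:
  assumes u: "u \<in> I"
  shows "at_time (sigma u) \<in> M \<rightarrow>\<^sub>M \<E>" "at_time (sigma u) \<in> hist 0 \<infinity> \<rightarrow>\<^sub>M \<E>"
proof -
  have S: "real_of_ereal (sigma u \<omega>) \<in> I" for \<omega>
    using hitting_range[of "\<lambda>r. A (u + r)" \<omega>] by (auto simp: sigma_def)
  note T = measurable_stopping_time_M[OF sigma_stopping[OF u]]
  show "at_time (sigma u) \<in> M \<rightarrow>\<^sub>M \<E>"
    unfolding at_time_def[abs_def]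
    by (rule measurable_X_random_time) (use T(1) S sets_hist_subset in auto)
  show "at_time (sigma u) \<in> hist 0 \<infinity> \<rightarrow>\<^sub>M \<E>"
    unfolding at_time_def[abs_def]
  proof (rule measurable_X_random_time)
    show "sets (hist 0 (ereal (real n))) \<subseteq> sets (hist 0 \<infinity>)" for n by (rule hist_mono) auto
  qed (use T(2) S in auto)
qed

text \<open>The indicator guards against the default \<open>real_of_ereal \<infinity> = 0\<close>,
  which would evaluate \<eta> at the position at time 0 on paths that never meet the
  boundary.\<close>

definition discounted :: "real \<Rightarrow> 'w \<Rightarrow> ennreal" where
  "discounted u \<omega> = indicator {\<omega>. sigma u \<omega> < \<infinity>} \<omega> *
     ennreal (exp (lim.rate * real_of_ereal (sigma u \<omega>)) * lim.eta (at_time (sigma u) \<omega>))"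

lemma discounted_measurable:
  assumes u: "u \<in> I" shows "discounted u \<in> borel_measurable (hist 0 \<infinity>)"
proof -
  have [measurable]: "sigma u \<in> borel_measurable (hist 0 \<infinity>)"
    by (rule measurable_stopping_time_M[OF sigma_stopping[OF u]])
  have [measurable]: "(\<lambda>\<omega>. lim.eta (at_time (sigma u) \<omega>)) \<in> borel_measurable (hist 0 \<infinity>)"
    by (rule measurable_compose[OF at_time_measurable(2)[OF u] lim.measurable_eta])
  show ?thesis
    unfolding discounted_def[abs_def] indicator_def[abs_def] mem_Collect_eq by measurable
qed

text \<open>The integrands correspond under the shift to time 0 where the hitting time is finite. An
  inequality results because the cost also counts the default value of its integrand where
  \<open>tau_A u\<close> is infinite.\<close>

lemma discounted_le_cost:
  assumes u: "u \<in> I"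
  shows "(\<integral>\<^sup>+\<omega>. discounted u \<omega> \<partial>P 0 x) \<le> boundary_cost u x"
proof -
  define g where "g \<omega> = indicator {\<omega>. tau_A u \<omega> < \<infinity>} \<omega> *
     ennreal (exp (lim.rate * (real_of_ereal (tau_A u \<omega>) - u)) * lim.eta (at_time (tau_A u) \<omega>))" for \<omega>
  have "(\<integral>\<^sup>+\<omega>. g \<omega> \<partial>P u x) = (\<integral>\<^sup>+\<omega>. discounted u \<omega> \<partial>P 0 x)"
  proof (rule homogeneous_nn_integral[OF u discounted_measurable[OF u]])
    fix \<omega> \<omega>' assume eq: "path_from u \<omega> = path_from 0 \<omega>'"
    have tau: "tau_A u \<omega> = ereal u + sigma u \<omega>'"
      unfolding tau_A_def sigma_def by (rule hitting_shift[OF u eq])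
    show "g \<omega> = discounted u \<omega>'"
    proof (cases "sigma u \<omega>' = \<infinity>")
      case True
      then show ?thesis using tau by (simp add: g_def discounted_def)
    next
      case False
      then obtain r where r: "r \<in> I" "sigma u \<omega>' = ereal r"
        using hitting_range[of "\<lambda>r. A (u + r)" \<omega>'] by (auto simp: sigma_def)
      then show ?thesis
        using tau path_from_eq[OF eq r(1)] by (simp add: g_def discounted_def at_time_def)
    qed
  qed
  moreover have "(\<integral>\<^sup>+\<omega>. g \<omega> \<partial>P u x) \<le> boundary_cost u x"
    unfolding boundary_cost_def
    by (intro nn_integral_mono) (auto simp: g_def indicator_def lambda_inf_eq eta_inf_eq)
  ultimately show ?thesis by simp
qed

definition slot :: "real \<Rightarrow> nat \<Rightarrow> 'w set" where
  "slot u k = {\<omega>\<in>space M. ereal (real k) \<le> sigma u \<omega> \<and> sigma u \<omega> < ereal (real k + 1)}"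

lemma slot_pre_sigma: "u \<in> I \<Longrightarrow> slot u k \<in> sets (filtration.pre_sigma (space M) (hist 0) (sigma u))"
proof -
  assume u: "u \<in> I"
  interpret hist: filtration "space M" "hist 0" by (rule filtration_hist)
  have [measurable]: "sigma u \<in> borel_measurable (hist.pre_sigma (sigma u))"
    by (rule hist.measurable_stopping_time_pre_sigma[OF sigma_stopping[OF u]])
  have "{\<omega>\<in>space (hist.pre_sigma (sigma u)). ereal (real k) \<le> sigma u \<omega> \<and> sigma u \<omega> < ereal (real k + 1)}
      \<in> sets (hist.pre_sigma (sigma u))" by measurable
  then show ?thesis by (simp add: slot_def hist.space_pre_sigma)
qed

lemma slot_sets: "u \<in> I \<Longrightarrow> slot u k \<in> sets M"
proof -
  assume u: "u \<in> I"
  have [measurable]: "sigma u \<in> borel_measurable M"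
    by (rule measurable_stopping_time_M[OF sigma_stopping[OF u]])
  show ?thesis unfolding slot_def by measurable
qed

text \<open>The strong Markov property only handles path events that do not depend on the value of the
  stopping time, whereas the remaining time \<open>T - \<sigma>\<close> does. Rounding \<open>\<sigma>\<close> down to an integer costs a
  factor of at most \<open>exp rate\<close>.\<close>

lemma lost_survival_le:
  assumes sm: strong_markov and u: "u \<in> I" and t: "t \<in> I" and m: "1 \<le> (m::nat)"
  shows "measure (P 0 x) (lost u t \<inter> alive_inf 0 (t + real m))
    \<le> (\<Sum>k\<le>nat \<lfloor>t\<rfloor>. \<integral>y. inf.surv (t + real m - (real k + 1)) y \<partial>sub_law (P 0 x) (slot u k) (at_time (sigma u)))"
proof -
  interpret prob_space "P 0 x" by (rule prob_P[OF time_0])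
  define n where "n = nat \<lfloor>t\<rfloor>"
  \<comment> \<open>Time left after the k-th slot: a hit in this slot occurs before k + 1. For k
    \<le> t the bound 1 \<le> m keeps it non-negative, even though k + 1 may exceed t.\<close>
  define r where "r k = t + real m - (real k + 1)" for k :: nat
  let ?S = "\<lambda>\<omega>. real_of_ereal (sigma u \<omega>)"
  have rI: "r k \<in> I" if "k \<le> n" for k
  proof -
    have "real k \<le> t" using that time_nonneg[OF t] unfolding n_def by linarith
    then have "(t - real k) + (real m - 1) \<in> I"
      using m by (intro time_add time_diff) (auto simp: t)
    then show ?thesis by (simp add: r_def algebra_simps)
  qed
  have "\<exists>C. C \<in> sets path_space \<and> alive_inf 0 (r k) = {\<omega>\<in>space M. path_from 0 \<omega> \<in> C}" for k
  proof -
    have "alive_inf 0 (r k) \<in> sets (hist 0 \<infinity>)"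
      using alive_inf_hist[of "r k"] hist_mono[of 0 0 "ereal (r k)" \<infinity>] by auto
    then show ?thesis using hist_path_infinity[OF time_0] by blast
  qed
  then obtain C where C: "\<And>k. C k \<in> sets path_space" "\<And>k. alive_inf 0 (r k) = {\<omega>\<in>space M. path_from 0 \<omega> \<in> C k}"
    by metis
  define Z where "Z k = {\<omega>\<in>slot u k. path_from (?S \<omega>) \<omega> \<in> C k}" for k
  have S1: "?S \<in> borel_measurable M"
    using measurable_stopping_time_M(1)[OF sigma_stopping[OF u]] by simp
  have S2: "?S \<omega> \<in> I" for \<omega>
    using hitting_range[of "\<lambda>r. A (u + r)" \<omega>] by (auto simp: sigma_def)
  note S = S1 S2
  have ZM: "Z k \<in> sets M" for k
  proof -
    have "{\<omega>\<in>space M. path_from (?S \<omega>) \<omega> \<in> C k} \<in> sets M"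
      using measurable_sets[OF measurable_path_from_random_time[OF S] C(1)] by (simp add: vimage_def Int_def conj_commute)
    then have "slot u k \<inter> {\<omega>\<in>space M. path_from (?S \<omega>) \<omega> \<in> C k} \<in> sets M" using slot_sets[OF u] by blast
    moreover have "slot u k \<inter> {\<omega>\<in>space M. path_from (?S \<omega>) \<omega> \<in> C k} = Z k" by (auto simp: Z_def slot_def)
    ultimately show ?thesis by simp
  qed
  \<comment> \<open>A lost path meets the boundary at some q \<le> t, say in slot k. From q on it
    still avoids \<open>A_inf\<close> for longer than t + m - q, hence for longer than
    \<open>r k\<close>.\<close>
  have cover: "lost u t \<inter> alive_inf 0 (t + real m) \<subseteq> (\<Union>k\<in>{..n}. Z k)"
  proof
    fix \<omega> assume \<omega>: "\<omega> \<in> lost u t \<inter> alive_inf 0 (t + real m)"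
    then have \<omega>M: "\<omega> \<in> space M" and le: "sigma u \<omega> \<le> ereal t" and inf: "ereal (t + real m) < hitting (\<lambda>_. A_inf) 0 \<omega>"
      by (auto simp: lost_def alive_sigma_def alive_inf_def)
    obtain q where q: "q \<in> I" "sigma u \<omega> = ereal q"
      using hitting_range[of "\<lambda>r. A (u + r)" \<omega>] le by (auto simp: sigma_def)
    have qt: "0 \<le> q" "q \<le> t" using le q time_nonneg by auto
    define k where "k = nat \<lfloor>q\<rfloor>"
    have k: "real k \<le> q" "q < real k + 1" "k \<le> n"
      using qt unfolding k_def n_def by (linarith, linarith, intro nat_mono floor_mono)
    obtain \<omega>' where \<omega>': "\<omega>' \<in> space M" "path_from q \<omega> = path_from 0 \<omega>'" using shift_path[OF q(1) \<omega>M] by blast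
    have "ereal (t + real m) < hitting (\<lambda>_. A_inf) q \<omega>"
      using inf hitting_gt_split[of 0 q "t + real m" "\<lambda>_. A_inf" \<omega>] qt by simp
    then have "ereal (t + real m - q) < hitting (\<lambda>_. A_inf) 0 \<omega>'"
      using hitting_shift[OF q(1) \<omega>'(2), of "\<lambda>_. A_inf"] ereal_add_left_mono_iff(2)[of q "ereal (t + real m - q)"] by simp
    moreover have "ereal (r k) \<le> ereal (t + real m - q)" using k by (simp add: r_def)
    ultimately have "ereal (r k) < hitting (\<lambda>_. A_inf) 0 \<omega>'" by (rule order.strict_trans1[rotated])
    then have "path_from 0 \<omega>' \<in> C k" using C(2)[of k] \<omega>' by (auto simp: alive_inf_def)
    then have "\<omega> \<in> Z k" using k q \<omega>M \<omega>' by (simp add: Z_def slot_def)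
    then show "\<omega> \<in> (\<Union>k\<in>{..n}. Z k)" using k by blast
  qed
  have "measure (P 0 x) (lost u t \<inter> alive_inf 0 (t + real m)) \<le> measure (P 0 x) (\<Union>k\<in>{..n}. Z k)"
    by (rule finite_measure_mono[OF cover]) (use ZM in auto)
  also have "\<dots> \<le> (\<Sum>k\<le>n. measure (P 0 x) (Z k))"
    by (rule finite_measure_subadditive_finite) (use ZM in auto)
  also have "\<dots> = (\<Sum>k\<le>n. \<integral>y. inf.surv (r k) y \<partial>sub_law (P 0 x) (slot u k) (at_time (sigma u)))"
  proof (rule sum.cong[OF refl])
    fix k assume "k \<in> {..n}"
    then have k: "r k \<in> I" using rI by simp
    have "measure (P 0 x) (Z k) = (\<integral>\<omega>. indicator (slot u k) \<omega> * measure (P 0 (at_time (sigma u) \<omega>)) {\<omega>'\<in>space M. path_from 0 \<omega>' \<in> C k} \<partial>P 0 x)"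
      unfolding Z_def
      by (rule strong_markov_set(1)[OF sm sigma_stopping[OF u] _ slot_pre_sigma[OF u] _ C(1)])
        (use hitting_range[of "\<lambda>r. A (u + r)"] in \<open>auto simp: sigma_def slot_def\<close>)
    also have "\<dots> = (\<integral>\<omega>. indicator (slot u k) \<omega> * inf.surv (r k) (at_time (sigma u) \<omega>) \<partial>P 0 x)"
      using C(2)[of k] surv_inf[OF k] by simp
    also have "\<dots> = (\<integral>y. inf.surv (r k) y \<partial>sub_law (P 0 x) (slot u k) (at_time (sigma u)))"
      by (rule integral_sub_law[OF sets_P[OF time_0] slot_sets[OF u] at_time_measurable(1)[OF u] inf.measurable_surv[OF k], symmetric])
    finally show "measure (P 0 x) (Z k) = (\<integral>y. inf.surv (r k) y \<partial>sub_law (P 0 x) (slot u k) (at_time (sigma u)))" .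
  qed
  finally show ?thesis by (simp add: n_def r_def)
qed

lemma sub_law_space:
  assumes "s \<in> I" "G \<in> sets M" "Y \<in> M \<rightarrow>\<^sub>M \<E>"
  shows "sub_law (P s x) G Y \<in> space (subprob_algebra \<E>)"
  using measurable_space[OF sub_law_kernel[OF assms], of x] by (simp add: space_states)

text \<open>Multiply \<open>lost_survival_le\<close> by exp (rate (t + m)) and let m tend to
  infinity. The rescaled survival probabilities from the position at t and from the positions at the
  hitting time both become \<open>eta\<close>, leaving exp (rate t) on one side and exp (rate (k +
  1)) in slot k on the other.\<close>

lemma lost_eta_le_sum:
  assumes sm: strong_markov and u: "u \<in> I" and t: "t \<in> I"
  shows "exp (lim.rate * t) * (\<integral>y. lim.eta y \<partial>sub_law (P 0 x) (lost u t) (X t))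
    \<le> (\<Sum>k\<le>nat \<lfloor>t\<rfloor>. exp (lim.rate * (real k + 1)) * (\<integral>y. lim.eta y \<partial>sub_law (P 0 x) (slot u k) (at_time (sigma u))))"
proof -
  define N where "N = sub_law (P 0 x) (lost u t) (X t)"
  define L where "L k = sub_law (P 0 x) (slot u k) (at_time (sigma u))" for k
  have N: "N \<in> space (subprob_algebra \<E>)"
    unfolding N_def by (rule sub_law_space[OF time_0 lost_sets[OF u] measurable_X[OF t]])
  have L: "L k \<in> space (subprob_algebra \<E>)" for k
    unfolding L_def by (rule sub_law_space[OF time_0 slot_sets[OF u] at_time_measurable(1)[OF u]])
  define r where "r m k = t + real m - (real k + 1)" for m k :: nat
  have rI: "r m k \<in> I" if "k \<le> nat \<lfloor>t\<rfloor>" "1 \<le> m" for m k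
  proof -
    have "real k \<le> t" using that time_nonneg[OF t] by linarith
    then have "(t - real k) + (real m - 1) \<in> I"
      using that by (intro time_add time_diff) (auto simp: t)
    then show ?thesis by (simp add: r_def algebra_simps)
  qed
  have "(\<lambda>m. exp (lim.rate * t) * (\<integral>y. 1 * lim.resc (real m) y \<partial>N)) \<longlonglongrightarrow> exp (lim.rate * t) * (\<integral>y. 1 * lim.eta y \<partial>N)"
    by (intro tendsto_mult_left filterlim_compose[OF lim.integral_resc_tendsto[OF N, where c = 1] sequence_to_infinity]) auto
  moreover have "(\<lambda>m. \<Sum>k\<le>nat \<lfloor>t\<rfloor>. exp (lim.rate * (real k + 1)) * (\<integral>y. 1 * lim.resc (r m k) y \<partial>L k))
      \<longlonglongrightarrow> (\<Sum>k\<le>nat \<lfloor>t\<rfloor>. exp (lim.rate * (real k + 1)) * (\<integral>y. 1 * lim.eta y \<partial>L k))"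
  proof (intro tendsto_sum tendsto_mult_left)
    fix k assume k: "k \<in> {..nat \<lfloor>t\<rfloor>}"
    have "filterlim (\<lambda>m. r m k) to_infinity sequentially"
      unfolding filterlim_inf filterlim_principal
    proof
      have "filterlim (\<lambda>m. (t - (real k + 1)) + real m) at_top sequentially"
        by (rule filterlim_tendsto_add_at_top[OF tendsto_const filterlim_real_sequentially])
      then show "filterlim (\<lambda>m. r m k) at_top sequentially" by (simp add: r_def algebra_simps)
      show "\<forall>\<^sub>F m in sequentially. r m k \<in> I"
        using eventually_ge_at_top[of 1] by eventually_elim (use rI k in auto)
    qed
    then show "(\<lambda>m. \<integral>y. 1 * lim.resc (r m k) y \<partial>L k) \<longlonglongrightarrow> (\<integral>y. 1 * lim.eta y \<partial>L k)"
      by (rule filterlim_compose[OF lim.integral_resc_tendsto[OF L, where c = 1], rotated 2]) auto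
  qed
  moreover have "\<exists>m0. \<forall>m\<ge>m0. exp (lim.rate * t) * (\<integral>y. 1 * lim.resc (real m) y \<partial>N)
      \<le> (\<Sum>k\<le>nat \<lfloor>t\<rfloor>. exp (lim.rate * (real k + 1)) * (\<integral>y. 1 * lim.resc (r m k) y \<partial>L k))"
  proof (intro exI[of _ 1] allI impI)
    fix m :: nat assume m: "1 \<le> m"
    have tm: "t + real m \<in> I" "0 \<le> t" using t time_nonneg by auto
    \<comment> \<open>Paths in \<open>lost u t\<close> have avoided \<open>A_inf\<close> until t
      already, so only an event of the future of t remains and \<open>sub_law_weight\<close>
      applies.\<close>
    have eq: "lost u t \<inter> alive_inf 0 (t + real m) = lost u t \<inter> alive_inf t (t + real m)"
      using alive_inf_split[of 0 t "t + real m"] tm by (auto simp: lost_def)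
    note H = shifted_event_inf(1)[OF t time_of_nat[of m] sets.top]
    have HM: "lost u t \<inter> alive_inf t (t + real m) \<in> sets M" using H lost_sets[OF u] sets_hist_subset by blast
    have "measure (P 0 x) (lost u t \<inter> alive_inf t (t + real m)) = (\<integral>y. 1 \<partial>sub_law (P 0 x) (lost u t \<inter> alive_inf t (t + real m)) (X t))"
      using measure_sub_law_UNIV[OF sets_P[OF time_0] HM measurable_X[OF t], of x]
        sets_eq_imp_space_eq[OF sets_sub_law, of "P 0 x" "lost u t \<inter> alive_inf t (t + real m)" "X t"] by (simp add: space_states)
    also have "\<dots> = (\<integral>y. 1 * measure (P t y) (alive_inf t (t + real m)) \<partial>N)"
      unfolding N_def by (rule sub_law_weight[OF time_0 t tm(2) lost_hist[OF u] H, where c = 1]) auto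
    also have "\<dots> = (\<integral>y. inf.surv (real m) y \<partial>N)" by (simp add: measure_alive_inf_shift[OF t])
    finally have meas: "measure (P 0 x) (lost u t \<inter> alive_inf 0 (t + real m)) = (\<integral>y. inf.surv (real m) y \<partial>N)"
      by (simp add: eq)
    have "exp (lim.rate * t) * (\<integral>y. 1 * lim.resc (real m) y \<partial>N) = exp (lim.rate * (t + real m)) * (\<integral>y. inf.surv (real m) y \<partial>N)"
      by (simp add: lim.resc_def[abs_def] distrib_left exp_add)
    also have "\<dots> \<le> exp (lim.rate * (t + real m)) * (\<Sum>k\<le>nat \<lfloor>t\<rfloor>. \<integral>y. inf.surv (r m k) y \<partial>L k)"
      using lost_survival_le[OF sm u t m, of x] by (intro mult_left_mono) (simp_all add: meas L_def r_def)
    also have "\<dots> = (\<Sum>k\<le>nat \<lfloor>t\<rfloor>. exp (lim.rate * (t + real m)) * (\<integral>y. inf.surv (r m k) y \<partial>L k))"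
      by (rule sum_distrib_left)
    also have "\<dots> = (\<Sum>k\<le>nat \<lfloor>t\<rfloor>. exp (lim.rate * (real k + 1)) * (\<integral>y. 1 * lim.resc (r m k) y \<partial>L k))"
    proof (rule sum.cong[OF refl])
      fix k
      have "lim.rate * (t + real m) = lim.rate * (real k + 1) + lim.rate * r m k"
        by (simp add: r_def algebra_simps)
      then show "exp (lim.rate * (t + real m)) * (\<integral>y. inf.surv (r m k) y \<partial>L k)
          = exp (lim.rate * (real k + 1)) * (\<integral>y. 1 * lim.resc (r m k) y \<partial>L k)"
        by (simp add: lim.resc_def[abs_def] exp_add)
    qed
    finally show "exp (lim.rate * t) * (\<integral>y. 1 * lim.resc (real m) y \<partial>N)
      \<le> (\<Sum>k\<le>nat \<lfloor>t\<rfloor>. exp (lim.rate * (real k + 1)) * (\<integral>y. 1 * lim.resc (r m k) y \<partial>L k))" .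
  qed
  ultimately have "exp (lim.rate * t) * (\<integral>y. 1 * lim.eta y \<partial>N) \<le> (\<Sum>k\<le>nat \<lfloor>t\<rfloor>. exp (lim.rate * (real k + 1)) * (\<integral>y. 1 * lim.eta y \<partial>L k))"
    by (rule LIMSEQ_le)
  then show ?thesis by (simp add: N_def L_def)
qed

text \<open>In slot k the hitting time is at least k, so exp (rate (k + 1)) \<le> exp rate times the
  actual discount factor; as the slots are disjoint, the sum over k stays below the mean of
  \<open>discounted\<close>. The estimate runs in extended non-negative reals, where no
  integrability of \<open>discounted\<close> has to be known.\<close>

lemma lost_eta_le:
  assumes sm: strong_markov and u: "u \<in> I" and t: "t \<in> I"
    and cost: "boundary_cost u x \<le> ennreal e" and e: "0 \<le> e"
  shows "exp (lim.rate * t) * (\<integral>y. lim.eta y \<partial>sub_law (P 0 x) (lost u t) (X t)) \<le> exp lim.rate * e"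
proof -
  define n where "n = nat \<lfloor>t\<rfloor>"
  define L where "L k = sub_law (P 0 x) (slot u k) (at_time (sigma u))" for k
  have L: "L k \<in> space (subprob_algebra \<E>)" for k
    unfolding L_def by (rule sub_law_space[OF time_0 slot_sets[OF u] at_time_measurable(1)[OF u]])
  have D: "discounted u \<in> borel_measurable (P 0 x)"
    using discounted_measurable[OF u] sets_hist_subset by (auto simp: measurable_def)
  have term_le: "ennreal (exp (lim.rate * (real k + 1)) * (\<integral>y. lim.eta y \<partial>L k))
      \<le> ennreal (exp lim.rate) * (\<integral>\<^sup>+\<omega>. indicator (slot u k) \<omega> * discounted u \<omega> \<partial>P 0 x)" for k
  proof -
    have "ennreal (exp (lim.rate * (real k + 1)) * (\<integral>y. lim.eta y \<partial>L k))
        = ennreal (exp (lim.rate * (real k + 1))) * (\<integral>\<^sup>+y. ennreal (lim.eta y) \<partial>L k)"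
      by (subst nn_integral_eq_integral)
        (auto simp: lim.eta_nonneg ennreal_mult intro!: integrable_subprob_bounded[OF L lim.measurable_eta lim.abs_eta])
    also have "(\<integral>\<^sup>+y. ennreal (lim.eta y) \<partial>L k) = (\<integral>\<^sup>+\<omega>. indicator (slot u k) \<omega> * ennreal (lim.eta (at_time (sigma u) \<omega>)) \<partial>P 0 x)"
      unfolding L_def by (rule nn_integral_sub_law[OF sets_P[OF time_0] slot_sets[OF u] at_time_measurable(1)[OF u]]) simp
    also have "ennreal (exp (lim.rate * (real k + 1))) * \<dots>
        = (\<integral>\<^sup>+\<omega>. ennreal (exp (lim.rate * (real k + 1))) * (indicator (slot u k) \<omega> * ennreal (lim.eta (at_time (sigma u) \<omega>))) \<partial>P 0 x)"
    proof (rule nn_integral_cmult[symmetric])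
      have "(\<lambda>\<omega>. ennreal (lim.eta (at_time (sigma u) \<omega>))) \<in> borel_measurable M"
        by (rule measurable_compose[OF at_time_measurable(1)[OF u]]) simp
      then show "(\<lambda>\<omega>. indicator (slot u k) \<omega> * ennreal (lim.eta (at_time (sigma u) \<omega>))) \<in> borel_measurable (P 0 x)"
        using slot_sets[OF u, of k] by (simp cong: measurable_cong_sets)
    qed
    also have "\<dots> \<le> (\<integral>\<^sup>+\<omega>. ennreal (exp lim.rate) * (indicator (slot u k) \<omega> * discounted u \<omega>) \<partial>P 0 x)"
    proof (rule nn_integral_mono)
      fix \<omega>
      show "ennreal (exp (lim.rate * (real k + 1))) * (indicator (slot u k) \<omega> * ennreal (lim.eta (at_time (sigma u) \<omega>)))
          \<le> ennreal (exp lim.rate) * (indicator (slot u k) \<omega> * discounted u \<omega>)"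
      proof (cases "\<omega> \<in> slot u k")
        case True
        then obtain q where q: "sigma u \<omega> = ereal q" "real k \<le> q"
          by (cases "sigma u \<omega>") (auto simp: slot_def)
        have "exp (lim.rate * (real k + 1)) \<le> exp lim.rate * exp (lim.rate * q)"
          using mult_left_mono[OF q(2) lim.rate_nonneg] by (simp add: algebra_simps flip: exp_add)
        then have "exp (lim.rate * (real k + 1)) * lim.eta (at_time (sigma u) \<omega>)
            \<le> exp lim.rate * (exp (lim.rate * q) * lim.eta (at_time (sigma u) \<omega>))"
          using mult_right_mono[OF _ lim.eta_nonneg[of "at_time (sigma u) \<omega>"]] by (metis mult.assoc)
        then show ?thesis
          using True q by (simp add: discounted_def lim.eta_nonneg ennreal_leI flip: ennreal_mult)
      qed simp
    qed
    also have "\<dots> = ennreal (exp lim.rate) * (\<integral>\<^sup>+\<omega>. indicator (slot u k) \<omega> * discounted u \<omega> \<partial>P 0 x)"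
      using D slot_sets[OF u, of k] by (intro nn_integral_cmult) simp
    finally show ?thesis .
  qed
  have nonneg: "0 \<le> exp (lim.rate * (real k + 1)) * (\<integral>y. lim.eta y \<partial>L k)" for k
    by (simp add: lim.eta_nonneg)
  have "ennreal (\<Sum>k\<le>n. exp (lim.rate * (real k + 1)) * (\<integral>y. lim.eta y \<partial>L k))
      = (\<Sum>k\<le>n. ennreal (exp (lim.rate * (real k + 1)) * (\<integral>y. lim.eta y \<partial>L k)))"
    using nonneg by (simp add: sum_ennreal)
  also have "\<dots> \<le> (\<Sum>k\<le>n. ennreal (exp lim.rate) * (\<integral>\<^sup>+\<omega>. indicator (slot u k) \<omega> * discounted u \<omega> \<partial>P 0 x))"
    by (rule sum_mono) (rule term_le)
  also have "\<dots> = ennreal (exp lim.rate) * (\<integral>\<^sup>+\<omega>. (\<Sum>k\<le>n. indicator (slot u k) \<omega> * discounted u \<omega>) \<partial>P 0 x)"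
    using D slot_sets[OF u] by (subst nn_integral_sum) (auto simp: sum_distrib_left)
  also have "(\<integral>\<^sup>+\<omega>. (\<Sum>k\<le>n. indicator (slot u k) \<omega> * discounted u \<omega>) \<partial>P 0 x) \<le> (\<integral>\<^sup>+\<omega>. discounted u \<omega> \<partial>P 0 x)"
  proof (rule nn_integral_mono)
    fix \<omega>
    have disj: "disjoint_family_on (slot u) {..n}"
    proof (unfold disjoint_family_on_def, intro ballI impI)
      fix i j :: nat assume "i \<noteq> j"
      show "slot u i \<inter> slot u j = {}"
      proof (rule ccontr)
        assume "slot u i \<inter> slot u j \<noteq> {}"
        then obtain \<omega> where w: "\<omega> \<in> slot u i" "\<omega> \<in> slot u j" by blast
        then show False using \<open>i \<noteq> j\<close> by (cases "sigma u \<omega>") (auto simp: slot_def)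
      qed
    qed
    have "(\<Sum>k\<le>n. indicator (slot u k) \<omega> * discounted u \<omega>) = indicator (\<Union>k\<le>n. slot u k) \<omega> * discounted u \<omega>"
      unfolding indicator_UN_disjoint[OF finite_atMost disj, of \<omega>] by (rule sum_distrib_right[symmetric])
    also have "\<dots> \<le> discounted u \<omega>" by (simp add: indicator_def)
    finally show "(\<Sum>k\<le>n. indicator (slot u k) \<omega> * discounted u \<omega>) \<le> discounted u \<omega>" .
  qed
  also have "\<dots> \<le> ennreal e" using discounted_le_cost[OF u, of x] cost by (rule order.trans)
  finally have "ennreal (\<Sum>k\<le>n. exp (lim.rate * (real k + 1)) * (\<integral>y. lim.eta y \<partial>L k)) \<le> ennreal (exp lim.rate * e)"
    using e by (simp add: ennreal_mult mult_left_mono)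
  then have "(\<Sum>k\<le>n. exp (lim.rate * (real k + 1)) * (\<integral>y. lim.eta y \<partial>L k)) \<le> exp lim.rate * e"
    using e by (simp add: ennreal_le_iff)
  then show ?thesis
    using lost_eta_le_sum[OF sm u t, of x] by (simp add: L_def n_def)
qed

end

text \<open>The factor 2 counts the change of numerator and the change of denominator once each:
  replacing b by b' costs the first quotient, bounded by c, times d.\<close>

lemma abs_ratio_diff_le:
  fixes a b a' b' c d :: real
  assumes b: "0 < b" and b': "0 < b'" and a: "\<bar>a\<bar> \<le> c * b" and aa: "\<bar>a - a'\<bar> \<le> c * d" and bb: "\<bar>b' - b\<bar> \<le> d"
  shows "\<bar>a / b - a' / b'\<bar> \<le> 2 * c * d / b'"
proof -
  have eq: "a / b - a' / b' = (a / b * (b' - b) + (a - a')) / b'"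
    using b b' by (simp add: field_simps)
  have c: "\<bar>a / b\<bar> \<le> c" using a b by (simp add: abs_divide pos_divide_le_eq)
  then have "\<bar>a / b\<bar> * \<bar>b' - b\<bar> \<le> c * d"
    using bb order.trans[OF abs_ge_zero c] by (intro mult_mono) auto
  then have "\<bar>a / b * (b' - b) + (a - a')\<bar> \<le> 2 * c * d"
    using aa abs_triangle_ineq[of "a / b * (b' - b)" "a - a'"] by (simp add: abs_mult)
  then show ?thesis unfolding eq using b' by (simp add: abs_divide divide_right_mono)
qed

context boundary_setting
begin

text \<open>\<open>lost_eta_le\<close> controls \<eta>-mass only. Where n \<eta> \<ge> 1, mass is at
  most n times \<eta>-mass. On the complement \<open>L n\<close> the lost law is bounded by the
  whole killed law, whose rescaled mass there is at most about \<open>resc_sup\<close> times that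
  under \<open>alpha_inf\<close>. The sets \<open>L n\<close> decrease to the zero set of \<eta>,
  which misses \<open>E_inf\<close>, so this mass vanishes for large n.\<close>

lemma lost_small:
  assumes sm: strong_markov and cost: "((\<lambda>s. boundary_cost s x) \<longlongrightarrow> 0) to_infinity" and \<delta>: "0 < \<delta>"
  shows "\<exists>T. \<forall>u\<in>I. \<forall>t\<in>I. T \<le> u \<longrightarrow> T \<le> t \<longrightarrow> exp (lim.rate * t) * measure (P 0 x) (lost u t) \<le> \<delta>"
proof -
  define L where "L n = {y. real n * lim.eta y < 1}" for n :: nat
  have L [measurable]: "L n \<in> sets \<E>" for n
    unfolding L_def using measurable_sets[of "\<lambda>y. real n * lim.eta y" \<E> borel "{..<1}"]
    by (simp add: space_states vimage_def lessThan_def)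
  have "(\<lambda>n. measure alpha_inf (L n)) \<longlonglongrightarrow> measure alpha_inf (\<Inter>n. L n)"
  proof (rule lim.\<alpha>.finite_Lim_measure_decseq)
    show "range L \<subseteq> sets alpha_inf" by auto
    show "decseq L"
    proof (rule decseq_SucI, rule subsetI)
      fix n y assume "y \<in> L (Suc n)"
      then show "y \<in> L n" using lim.eta_nonneg[of y] by (simp add: L_def algebra_simps)
    qed
  qed
  moreover have "measure alpha_inf (\<Inter>n. L n) = 0"
  proof -
    have "(\<Inter>n. L n) \<subseteq> - E_inf"
    proof
      fix y assume y: "y \<in> (\<Inter>n. L n)"
      have "\<not> 0 < lim.eta y"
      proof
        assume "0 < lim.eta y"
        then obtain n :: nat where "1 < real n * lim.eta y" using reals_Archimedean3 by blast
        moreover have "y \<in> L n" using y by blast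
        ultimately show False by (simp add: L_def)
      qed
      then show "y \<in> - E_inf" using lim.eta_pos by blast
    qed
    then have "AE y in alpha_inf. y \<notin> (\<Inter>n. L n)"
      using lim.AE_\<alpha> by (auto elim!: eventually_mono)
    moreover have "(\<Inter>n. L n) \<in> sets alpha_inf" by simp
    ultimately show ?thesis using lim.\<alpha>.prob_eq_0 by blast
  qed
  ultimately have "(\<lambda>n. lim.resc_sup * measure alpha_inf (L n)) \<longlonglongrightarrow> 0"
    by (intro tendsto_mult_right_zero) simp
  then have "\<forall>\<^sub>F n in sequentially. lim.resc_sup * measure alpha_inf (L n) < \<delta> / 3"
    using \<delta> by (intro order_tendstoD) auto
  then obtain n where n: "lim.resc_sup * measure alpha_inf (L n) < \<delta> / 3"
    by (auto simp: eventually_sequentially)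
  \<comment> \<open>The level n is fixed before e, because the cost has to absorb the factor n exp
    rate; n + 1 avoids a division by 0.\<close>
  define e where "e = \<delta> / (3 * (real n + 1) * exp lim.rate)"
  have e: "0 < e" using \<delta> by (simp add: e_def)
  have ne: "real n * (exp lim.rate * e) \<le> \<delta> / 3"
  proof -
    have "real n * (exp lim.rate * e) = \<delta> / 3 * (real n / (real n + 1))" by (simp add: e_def)
    also have "\<dots> \<le> \<delta> / 3" using \<delta> by (intro mult_left_le) auto
    finally show ?thesis .
  qed
  have "\<forall>\<^sub>F t in to_infinity. lim.err t < \<delta> / 3"
    by (rule order_tendstoD(2)[OF lim.err_tendsto_0]) (use \<delta> in simp)
  then obtain T1 where T1: "\<And>t. t \<in> I \<Longrightarrow> T1 \<le> t \<Longrightarrow> lim.err t < \<delta> / 3"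
    by (auto simp: eventually_to_infinity)
  have "\<forall>\<^sub>F u in to_infinity. boundary_cost u x < ennreal e"
    by (rule order_tendstoD(2)[OF cost]) (use e in simp)
  then obtain T2 where T2: "\<And>u. u \<in> I \<Longrightarrow> T2 \<le> u \<Longrightarrow> boundary_cost u x < ennreal e"
    by (auto simp: eventually_to_infinity)
  have "exp (lim.rate * t) * measure (P 0 x) (lost u t) \<le> \<delta>"
    if u: "u \<in> I" "max T1 T2 \<le> u" and t: "t \<in> I" "max T1 T2 \<le> t" for u t
  proof -
    interpret prob_space "P 0 x" by (rule prob_P[OF time_0])
    define N where "N = sub_law (P 0 x) (lost u t) (X t)"
    note Nrules = sets_P[OF time_0] lost_sets[OF u(1)] measurable_X[OF t(1)]
    have N: "N \<in> space (subprob_algebra \<E>)"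
      unfolding N_def by (rule sub_law_space[OF time_0 Nrules(2,3)])
    have sN: "sets N = sets \<E>" "space N = UNIV"
      using N by (auto simp: space_subprob_algebra space_states dest: sets_eq_imp_space_eq)
    interpret N: subprob_space N using N by (simp add: space_subprob_algebra)
    have i_eta: "integrable N lim.eta"
      by (rule integrable_subprob_bounded[OF N lim.measurable_eta lim.abs_eta])
    have i_L: "integrable N (indicat_real (L n))"
      by (rule integrable_subprob_bounded[OF N, where c = 1]) auto
    have "measure (P 0 x) (lost u t) = measure N UNIV"
      unfolding N_def by (rule measure_sub_law_UNIV[OF Nrules, symmetric])
    also have "\<dots> = (\<integral>y. 1 \<partial>N)" using sN by simp
    also have "\<dots> \<le> (\<integral>y. real n * lim.eta y + indicat_real (L n) y \<partial>N)"
    proof (rule integral_mono)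
      fix y
      show "1 \<le> real n * lim.eta y + indicat_real (L n) y"
        using lim.eta_nonneg[of y] by (cases "y \<in> L n") (auto simp: L_def not_less)
    qed (use i_eta i_L in auto)
    also have "\<dots> = real n * (\<integral>y. lim.eta y \<partial>N) + measure N (L n)"
      using i_eta i_L sN by simp
    also have "measure N (L n) \<le> measure (kernel_inf t x) (L n)"
    proof -
      have "emeasure N (L n) \<le> emeasure (kernel_inf t x) (L n)"
        unfolding N_def kernel_inf_def emeasure_sub_law[OF Nrules L] emeasure_sub_law[OF Nrules(1) alive_sets(2) Nrules(3) L]
      proof (rule emeasure_mono)
        have "{\<omega> \<in> space M. X t \<omega> \<in> L n} \<in> sets M"
          using measurable_sets[OF Nrules(3) L[of n]] by (simp add: vimage_def Int_def conj_commute)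
        then show "alive_inf 0 t \<inter> {\<omega> \<in> space M. X t \<omega> \<in> L n} \<in> sets (P 0 x)"
          using alive_sets(2) by auto
      qed (auto simp: lost_def)
      then show ?thesis
        unfolding measure_def using subprob_space.axioms(1)[OF inf.subprob_kernel[OF t(1)], of x]
        by (intro enn2real_mono) (auto simp: finite_measure.emeasure_finite less_top[symmetric])
    qed
    finally have le: "measure (P 0 x) (lost u t) \<le> real n * (\<integral>y. lim.eta y \<partial>N) + measure (kernel_inf t x) (L n)"
      by simp
    have "exp (lim.rate * t) * (\<integral>y. lim.eta y \<partial>N) \<le> exp lim.rate * e"
      unfolding N_def using T2[OF u(1)] u e by (intro lost_eta_le[OF sm u(1) t(1)]) (auto intro: less_imp_le)
    then have "real n * (exp (lim.rate * t) * (\<integral>y. lim.eta y \<partial>N)) \<le> real n * (exp lim.rate * e)"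
      by (rule mult_left_mono) simp
    then have part1: "real n * (exp (lim.rate * t) * (\<integral>y. lim.eta y \<partial>N)) \<le> \<delta> / 3"
      using ne by (rule order.trans)
    have "\<bar>(\<integral>y. indicat_real (L n) y \<partial>kernel_inf t x) - (\<integral>y. indicat_real (L n) y \<partial>alpha_inf) * inf.surv t x\<bar>
        \<le> 1 * C * exp (- \<gamma> * t) * inf.surv t x"
      by (rule lim.ergodic_bounded[OF t(1)]) auto
    then have "measure (kernel_inf t x) (L n) \<le> (measure alpha_inf (L n) + C * exp (- \<gamma> * t)) * inf.surv t x"
      using t by (simp add: distrib_right)
    then have "exp (lim.rate * t) * measure (kernel_inf t x) (L n)
        \<le> exp (lim.rate * t) * ((measure alpha_inf (L n) + C * exp (- \<gamma> * t)) * inf.surv t x)"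
      by (intro mult_left_mono) auto
    also have "\<dots> = (measure alpha_inf (L n) + C * exp (- \<gamma> * t)) * lim.resc t x"
      by (simp add: lim.resc_def)
    also have "\<dots> \<le> (measure alpha_inf (L n) + C * exp (- \<gamma> * t)) * lim.resc_sup"
      using lim.resc_le[OF t(1)] lim.C_pos by (intro mult_left_mono) auto
    also have "\<dots> = lim.resc_sup * measure alpha_inf (L n) + lim.err t"
      by (simp add: lim.err_def algebra_simps)
    also have "\<dots> \<le> \<delta> / 3 + \<delta> / 3" using n T1[OF t(1)] t by (intro add_mono) auto
    finally have part2: "exp (lim.rate * t) * measure (kernel_inf t x) (L n) \<le> \<delta> / 3 + \<delta> / 3" .
    have "exp (lim.rate * t) * measure (P 0 x) (lost u t)
        \<le> exp (lim.rate * t) * (real n * (\<integral>y. lim.eta y \<partial>N) + measure (kernel_inf t x) (L n))"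
      using le by (intro mult_left_mono) auto
    also have "\<dots> = real n * (exp (lim.rate * t) * (\<integral>y. lim.eta y \<partial>N)) + exp (lim.rate * t) * measure (kernel_inf t x) (L n)"
      by (simp add: algebra_simps)
    also have "\<dots> \<le> \<delta>" using part1 part2 by simp
    finally show ?thesis .
  qed
  then show ?thesis by blast
qed

text \<open>At time 0 the two conditioned means are quotients of integrals over
  \<open>alive_sigma\<close> and over \<open>alive_inf\<close> under the same law; numerators and
  denominators both differ by the contribution of \<open>lost\<close>.\<close>

lemma cond_mean_lost:
  fixes f :: "'e \<Rightarrow> real"
  assumes u: "u \<in> I" and K: "K \<in> I" and L: "L \<in> I" and x: "x \<in> E u" and f: "f \<in> borel_measurable \<E>" "\<And>y. \<bar>f y\<bar> \<le> c"
  shows "\<bar>mov.cond_mean u (u + K) (u + (K + L)) f x - (\<integral>y. f y * inf.surv L y \<partial>kernel_inf K x) / inf.surv (K + L) x\<bar>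
    \<le> 2 * c * measure (P 0 x) (lost u (K + L)) / inf.surv (K + L) x"
proof -
  interpret prob_space "P 0 x" by (rule prob_P[OF time_0])
  let ?t = "K + L"
  have t: "?t \<in> I" "u + K \<in> I" "u + ?t \<in> I" "u \<le> u + K" "u + K \<le> u + ?t" "u \<le> u + ?t"
    using u K L time_nonneg by auto
  have c: "0 \<le> c" using f(2)[of undefined] by linarith
  have S: "alive_sigma u ?t \<in> sets M" and A: "alive_inf 0 ?t \<in> sets M" and lost: "lost u ?t \<in> sets M"
    using alive_sigma_sets[OF u] alive_sets(2) lost_sets[OF u] by auto
  note P0 = sets_P[OF time_0] and XK = measurable_X[OF K]
  have fX [measurable]: "(\<lambda>\<omega>. f (X K \<omega>)) \<in> borel_measurable (P 0 x)"
    using measurable_compose[OF XK f(1)] by (simp cong: measurable_cong_sets)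
  have int: "integrable (P 0 x) (\<lambda>\<omega>. indicator G \<omega> * f (X K \<omega>))" if "G \<in> sets M" for G
    by (rule integrable_const_bound[where B = c]) (use that f c in \<open>auto simp: indicator_def\<close>)
  have le: "\<bar>\<integral>\<omega>. indicator G \<omega> * f (X K \<omega>) \<partial>P 0 x\<bar> \<le> c * measure (P 0 x) G" if G: "G \<in> sets M" for G
  proof -
    have "\<bar>\<integral>\<omega>. indicator G \<omega> * f (X K \<omega>) \<partial>P 0 x\<bar> \<le> (\<integral>\<omega>. \<bar>indicator G \<omega> * f (X K \<omega>)\<bar> \<partial>P 0 x)"
      by (rule integral_abs_bound)
    also have "\<dots> \<le> (\<integral>\<omega>. c * indicator G \<omega> \<partial>P 0 x)"
    proof (rule integral_mono)
      show "integrable (P 0 x) (\<lambda>\<omega>. \<bar>indicator G \<omega> * f (X K \<omega>)\<bar>)"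
        by (rule integrable_abs[OF int[OF G]])
      show "integrable (P 0 x) (\<lambda>\<omega>. c * indicator G \<omega>)"
        using G by (simp add: emeasure_eq_measure)
    qed (use f in \<open>auto simp: indicator_def\<close>)
    also have "\<dots> = c * measure (P 0 x) G" using G sets.sets_into_space[OF G] by (simp add: Int_absorb2)
    finally show ?thesis .
  qed
  have split: "alive_inf 0 ?t = alive_sigma u ?t \<union> lost u ?t" "alive_sigma u ?t \<inter> lost u ?t = {}"
    using alive_sigma_subset[OF u] by (auto simp: lost_def)
  have mu: "mov.surv u (u + ?t) x = measure (P 0 x) (alive_sigma u ?t)"
  proof -
    have "mov.surv u (u + ?t) x = measure (sub_law (P u x) (alive_A u (u + ?t)) (X (u + K))) UNIV"
      by (simp add: surv_A[OF u t(3)] measure_sub_law_UNIV[OF sets_P[OF u] alive_sets(1)[OF u] measurable_X[OF t(2)]])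
    then show ?thesis
      unfolding sub_law_alive_sigma[OF u t(1) K] by (simp add: measure_sub_law_UNIV[OF P0 S XK])
  qed
  have E1: "mov.cond_mean u (u + K) (u + ?t) f x
      = (\<integral>\<omega>. indicator (alive_sigma u ?t) \<omega> * f (X K \<omega>) \<partial>P 0 x) / measure (P 0 x) (alive_sigma u ?t)"
    unfolding mov.cond_mean_def mu integral_alive_A[OF u t(2,4) t(3,5) f]
      sub_law_alive_sigma[OF u t(1) K] integral_sub_law[OF P0 S XK f(1)] ..
  have E2: "(\<integral>y. f y * inf.surv L y \<partial>kernel_inf K x) / inf.surv ?t x
      = (\<integral>\<omega>. indicator (alive_inf 0 ?t) \<omega> * f (X K \<omega>) \<partial>P 0 x) / measure (P 0 x) (alive_inf 0 ?t)"
    unfolding integral_alive_inf[OF K L f] integral_sub_law[OF P0 A XK f(1)] surv_inf[OF t(1)] ..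
  have "\<bar>(\<integral>\<omega>. indicator (alive_sigma u ?t) \<omega> * f (X K \<omega>) \<partial>P 0 x) / measure (P 0 x) (alive_sigma u ?t)
      - (\<integral>\<omega>. indicator (alive_inf 0 ?t) \<omega> * f (X K \<omega>) \<partial>P 0 x) / measure (P 0 x) (alive_inf 0 ?t)\<bar>
      \<le> 2 * c * measure (P 0 x) (lost u ?t) / measure (P 0 x) (alive_inf 0 ?t)"
  proof (rule abs_ratio_diff_le)
    show pos: "0 < measure (P 0 x) (alive_sigma u ?t)"
      using mov.surv_pos[OF u t(3,6) x] by (simp add: mu)
    show "0 < measure (P 0 x) (alive_inf 0 ?t)"
      using pos finite_measure_mono[OF alive_sigma_subset[OF u], of ?t] A by simp
    show "\<bar>\<integral>\<omega>. indicator (alive_sigma u ?t) \<omega> * f (X K \<omega>) \<partial>P 0 x\<bar> \<le> c * measure (P 0 x) (alive_sigma u ?t)"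
      by (rule le[OF S])
    have "(\<integral>\<omega>. indicator (alive_inf 0 ?t) \<omega> * f (X K \<omega>) \<partial>P 0 x)
        = (\<integral>\<omega>. indicator (alive_sigma u ?t) \<omega> * f (X K \<omega>) + indicator (lost u ?t) \<omega> * f (X K \<omega>) \<partial>P 0 x)"
      using split(2) unfolding split(1)
      by (intro Bochner_Integration.integral_cong) (auto simp: indicator_def)
    also have "\<dots> = (\<integral>\<omega>. indicator (alive_sigma u ?t) \<omega> * f (X K \<omega>) \<partial>P 0 x) + (\<integral>\<omega>. indicator (lost u ?t) \<omega> * f (X K \<omega>) \<partial>P 0 x)"
      by (rule Bochner_Integration.integral_add[OF int[OF S] int[OF lost]])
    finally show "\<bar>(\<integral>\<omega>. indicator (alive_sigma u ?t) \<omega> * f (X K \<omega>) \<partial>P 0 x)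
        - (\<integral>\<omega>. indicator (alive_inf 0 ?t) \<omega> * f (X K \<omega>) \<partial>P 0 x)\<bar> \<le> c * measure (P 0 x) (lost u ?t)"
      using le[OF lost] by simp
    have "measure (P 0 x) (alive_inf 0 ?t) = measure (P 0 x) (alive_sigma u ?t) + measure (P 0 x) (lost u ?t)"
      unfolding split(1) by (rule finite_measure_Union) (use S lost split(2) in auto)
    then show "\<bar>measure (P 0 x) (alive_inf 0 ?t) - measure (P 0 x) (alive_sigma u ?t)\<bar> \<le> measure (P 0 x) (lost u ?t)"
      by simp
  qed
  then show ?thesis by (subst E1, subst E2, subst surv_inf[OF t(1)])
qed

lemma E_mono: "s \<in> I \<Longrightarrow> t \<in> I \<Longrightarrow> s \<le> t \<Longrightarrow> E s \<subseteq> E t"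
  using antitone by (auto simp: E_def)

lemma E_subset_E_inf: "s \<in> I \<Longrightarrow> E s \<subseteq> E_inf"
  by (auto simp: E_def E_inf_def A_inf_def)

text \<open>Survival of the limit set from x until t is at least exp (- rate t) \<eta>(x) / 2 for
  large t, and \<open>lost_small\<close> is small on exactly this scale, so the error in
  \<open>cond_mean_lost\<close> vanishes. What remains is the limit
  \<open>conditioned_tendsto\<close> for the fixed set.\<close>

lemma start_limit:
  fixes f :: "'e \<Rightarrow> real"
  assumes sm: strong_markov and cost: "((\<lambda>s. boundary_cost s x) \<longlongrightarrow> 0) to_infinity"
    and s0: "s0 \<in> I" "x \<in> E s0" and f: "f \<in> borel_measurable \<E>" "\<And>y. \<bar>f y\<bar> \<le> c" and \<delta>: "0 < \<delta>"
  shows "\<exists>T. \<forall>u\<in>I. \<forall>K\<in>I. \<forall>L\<in>I. T \<le> u \<longrightarrow> T \<le> K \<longrightarrow> T \<le> L \<longrightarrow>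
    \<bar>mov.cond_mean u (u + K) (u + (K + L)) f x - (\<integral>y. f y * lim.eta y \<partial>alpha_inf)\<bar> \<le> \<delta>"
proof -
  let ?v = "\<integral>y. f y * lim.eta y \<partial>alpha_inf"
  have xinf: "x \<in> E_inf" using E_subset_E_inf[OF s0(1)] s0(2) by blast
  have eta: "0 < lim.eta x" by (rule lim.eta_pos[OF xinf])
  have c: "0 \<le> c" using f(2)[of undefined] by linarith
  have "\<forall>\<^sub>F p in to_infinity \<times>\<^sub>F to_infinity. dist (case p of (K, L) \<Rightarrow> (\<integral>y. f y * inf.surv L y \<partial>kernel_inf K x) / inf.surv (K + L) x) ?v < \<delta> / 2"
    using lim.conditioned_tendsto[OF xinf f] \<delta> by (intro tendstoD) auto
  then obtain PK PL where PK: "eventually PK to_infinity" and PL: "eventually PL to_infinity"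
    and near: "\<And>K L. PK K \<Longrightarrow> PL L \<Longrightarrow> dist ((\<integral>y. f y * inf.surv L y \<partial>kernel_inf K x) / inf.surv (K + L) x) ?v < \<delta> / 2"
    unfolding eventually_prod_filter by fastforce
  obtain T1 T2 where T1: "\<And>K. K \<in> I \<Longrightarrow> T1 \<le> K \<Longrightarrow> PK K" and T2: "\<And>L. L \<in> I \<Longrightarrow> T2 \<le> L \<Longrightarrow> PL L"
    using PK PL by (auto simp: eventually_to_infinity)
  have "\<forall>\<^sub>F t in to_infinity. lim.eta x / 2 < lim.resc t x"
    using eta by (intro order_tendstoD[OF lim.resc_tendsto]) auto
  then obtain T3 where T3: "\<And>t. t \<in> I \<Longrightarrow> T3 \<le> t \<Longrightarrow> lim.eta x / 2 < lim.resc t x"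
    by (auto simp: eventually_to_infinity)
  \<comment> \<open>The error becomes 4 c d / \<eta>(x), which this choice keeps below \<delta> / 2;
    c + 1 instead of c allows c = 0.\<close>
  define d where "d = \<delta> * lim.eta x / (8 * (c + 1))"
  have d: "0 < d" using \<delta> eta c by (simp add: d_def)
  obtain T4 where T4: "\<And>u t. u \<in> I \<Longrightarrow> t \<in> I \<Longrightarrow> T4 \<le> u \<Longrightarrow> T4 \<le> t \<Longrightarrow> exp (lim.rate * t) * measure (P 0 x) (lost u t) \<le> d"
    using lost_small[OF sm cost d] by blast
  define T where "T = Max {T1, T2, T3, T4, s0}"
  have T: "T1 \<le> T" "T2 \<le> T" "T3 \<le> T" "T4 \<le> T" "s0 \<le> T" by (auto simp: T_def)
  have "\<bar>mov.cond_mean u (u + K) (u + (K + L)) f x - ?v\<bar> \<le> \<delta>"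
    if u: "u \<in> I" "T \<le> u" and K: "K \<in> I" "T \<le> K" and L: "L \<in> I" "T \<le> L" for u K L
  proof -
    have t: "K + L \<in> I" "T \<le> K + L" using K L time_nonneg[OF L(1)] by auto
    have xu: "x \<in> E u" using E_mono[OF s0(1) u(1)] s0(2) u T by auto
    define R where "R = (\<integral>y. f y * inf.surv L y \<partial>kernel_inf K x) / inf.surv (K + L) x"
    define dd where "dd = measure (P 0 x) (lost u (K + L))"
    have "\<bar>mov.cond_mean u (u + K) (u + (K + L)) f x - R\<bar> \<le> 2 * c * dd / inf.surv (K + L) x"
      unfolding R_def dd_def by (rule cond_mean_lost[OF u(1) K(1) L(1) xu f])
    also have "\<dots> = 2 * c * (exp (lim.rate * (K + L)) * dd) / lim.resc (K + L) x"
      by (simp add: lim.resc_def)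
    also have "\<dots> \<le> 2 * c * d / (lim.eta x / 2)"
    proof (rule frac_le)
      show "2 * c * (exp (lim.rate * (K + L)) * dd) \<le> 2 * c * d"
        unfolding dd_def using T4[OF u(1) t(1)] u t T c by (intro mult_left_mono) auto
      show "lim.eta x / 2 \<le> lim.resc (K + L) x" using T3[OF t(1)] t T by (simp add: less_imp_le)
    qed (use c d eta in auto)
    also have "\<dots> = 4 * c * (\<delta> / (8 * (c + 1)))" using eta by (simp add: d_def)
    also have "\<dots> = \<delta> / 2 * (c / (c + 1))" using c by (simp add: divide_simps)
    also have "\<dots> \<le> \<delta> / 2" using \<delta> c by (intro mult_left_le) auto
    finally have "\<bar>mov.cond_mean u (u + K) (u + (K + L)) f x - R\<bar> \<le> \<delta> / 2" .
    moreover have "\<bar>R - ?v\<bar> < \<delta> / 2"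
      using near[OF T1[OF K(1)] T2[OF L(1)]] K L T by (simp add: R_def dist_real_def)
    ultimately show ?thesis by linarith
  qed
  then show ?thesis by blast
qed

lemma surv_initial_pos:
  assumes \<mu>: "\<mu> \<in> prob_measures (E 0)" and T: "T \<in> I"
  shows "0 < (\<integral>y. mov.surv 0 T y \<partial>\<mu>)"
proof -
  have \<mu>p: "\<mu> \<in> space (prob_algebra \<E>)" and \<mu>E: "emeasure \<mu> (E 0) = 1" using \<mu> by (auto simp: prob_measures_def)
  interpret m: prob_space \<mu> using \<mu>p by (simp add: space_prob_algebra)
  have \<mu>s: "\<mu> \<in> space (subprob_algebra \<E>)"
    using \<mu>p by (simp add: space_prob_algebra space_subprob_algebra prob_space_imp_subprob_space)
  have T0: "0 \<le> T" by (rule time_nonneg[OF T])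
  show ?thesis
  proof (rule m.expectation_pos)
    show "integrable \<mu> (mov.surv 0 T)"
      by (rule integrable_subprob_bounded[OF \<mu>s, where c = 1]) (use mov.abs_surv_le_1[OF time_0 T T0] T T0 in auto)
    have "AE y in \<mu>. y \<in> E 0" by (rule m.AE_prob_1) (simp add: \<mu>E measure_def)
    then show "AE y in \<mu>. 0 < mov.surv 0 T y" by eventually_elim (rule mov.surv_pos[OF time_0 T T0])
  qed
qed

text \<open>Conditioning does not commute with mixing over the initial law: the conditional law from
  \<mu> is the average of those from points with weights proportional to
  \<open>mov.surv 0 T\<close>. A bound uniform over \<open>E 0\<close> is insensitive to these
  weights.\<close>

lemma integral_law_given_mean:
  fixes f :: "'e \<Rightarrow> real"
  assumes \<mu>: "\<mu> \<in> prob_measures (E 0)" and s: "s \<in> I" and T: "T \<in> I" "s \<le> T"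
    and f: "f \<in> borel_measurable \<E>" "\<And>y. \<bar>f y\<bar> \<le> c"
    and near: "\<And>y. y \<in> E 0 \<Longrightarrow> \<bar>mov.cond_mean 0 s T f y - v\<bar> \<le> d"
  shows "\<bar>(\<integral>y. f y \<partial>law_given (law_from 0 \<mu>) (tau_A 0) T s) - v\<bar> \<le> d"
proof -
  have \<mu>p: "\<mu> \<in> space (prob_algebra \<E>)" and \<mu>E: "emeasure \<mu> (E 0) = 1" using \<mu> by (auto simp: prob_measures_def)
  interpret m: prob_space \<mu> using \<mu>p by (simp add: space_prob_algebra)
  have \<mu>s: "\<mu> \<in> space (subprob_algebra \<E>)"
    using \<mu>p by (simp add: space_prob_algebra space_subprob_algebra prob_space_imp_subprob_space)
  have sets_\<mu> [measurable_cong]: "sets \<mu> = sets \<E>" using \<mu>p by (simp add: space_prob_algebra)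
  note Q = law_from_prob[OF time_0 \<mu>p]
  have s0: "0 \<le> s" "0 \<le> T" using time_nonneg s T by auto
  have AE: "AE y in \<mu>. y \<in> E 0" by (rule m.AE_prob_1) (simp add: \<mu>E measure_def)
  let ?S = "\<lambda>y. mov.surv 0 T y" and ?G = "\<lambda>y. mov.cond_mean 0 s T f y"
  have fX: "(\<lambda>\<omega>. f (X s \<omega>)) \<in> borel_measurable M" by (rule measurable_compose[OF measurable_X[OF s] f(1)])
  have c: "0 \<le> c" using f(2)[of undefined] by linarith
  have iS: "integrable \<mu> ?S"
    by (rule integrable_subprob_bounded[OF \<mu>s, where c = 1]) (use mov.abs_surv_le_1[OF time_0 T(1) s0(2)] T s0 in auto)
  have iG: "integrable \<mu> (\<lambda>y. ?G y * ?S y)"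
    by (rule integrable_subprob_bounded[OF \<mu>s, where c = c])
      (use mov.abs_mult_surv(2)[OF time_0 T(1) s0(2), of ?G c] mov.abs_cond_mean_le[OF time_0 s T(1) s0(1) T(2) f] s T s0 f in auto)
  have meas: "measure (law_from 0 \<mu>) (alive_A 0 T) = (\<integral>y. ?S y \<partial>\<mu>)"
    using survival_law_from[OF time_0 \<mu>p, of T "hitting A 0"] alive_sets(1)[OF time_0, of T]
    by (simp add: survival_def alive_A_def surv_A[OF time_0 T(1)])
  have pos: "0 < (\<integral>y. ?S y \<partial>\<mu>)" by (rule surv_initial_pos[OF \<mu> T(1)])
  have "(\<integral>y. f y \<partial>law_given (law_from 0 \<mu>) (tau_A 0) T s)
      = (\<integral>y. f y \<partial>sub_law (law_from 0 \<mu>) (alive_A 0 T) (X s)) / measure (law_from 0 \<mu>) (alive_A 0 T)"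
    by (rule integral_law_given[OF Q(2) alive_sets(1)[OF time_0] measurable_X[OF s] f(1)])
      (auto simp: alive_A_def tau_A_def prob_space.finite_measure[OF Q(1)])
  also have "(\<integral>y. f y \<partial>sub_law (law_from 0 \<mu>) (alive_A 0 T) (X s)) = (\<integral>\<omega>. indicator (alive_A 0 T) \<omega> * f (X s \<omega>) \<partial>law_from 0 \<mu>)"
    by (rule integral_sub_law[OF Q(2) alive_sets(1)[OF time_0] measurable_X[OF s] f(1)])
  also have "\<dots> = (\<integral>y. \<integral>\<omega>. indicator (alive_A 0 T) \<omega> * f (X s \<omega>) \<partial>P 0 y \<partial>\<mu>)"
    by (rule integral_law_from[OF time_0 \<mu>p, where c = c])
      (use fX alive_sets(1)[OF time_0, of T] f c in \<open>auto simp: indicator_def\<close>)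
  also have "\<dots> = (\<integral>y. ?G y * ?S y \<partial>\<mu>)"
  proof (rule Bochner_Integration.integral_cong[OF refl])
    fix y
    show "(\<integral>\<omega>. indicator (alive_A 0 T) \<omega> * f (X s \<omega>) \<partial>P 0 y) = ?G y * ?S y"
      unfolding mov.cond_mean_mult_surv[OF time_0 s T(1) s0(1) T(2) f] integral_alive_A[OF time_0 s s0(1) T f]
      by (rule integral_sub_law[OF sets_P[OF time_0] alive_sets(1)[OF time_0] measurable_X[OF s] f(1), symmetric])
  qed
  finally have eq: "(\<integral>y. f y \<partial>law_given (law_from 0 \<mu>) (tau_A 0) T s) = (\<integral>y. ?G y * ?S y \<partial>\<mu>) / (\<integral>y. ?S y \<partial>\<mu>)"
    by (simp add: meas)
  show ?thesis unfolding eq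
  proof (rule weighted_mean_close[OF iS iG _ pos])
    show "AE y in \<mu>. 0 \<le> ?S y \<and> \<bar>?G y - v\<bar> \<le> d"
      using AE by eventually_elim (simp add: near mov.surv_nonneg)
  qed
qed

text \<open>At time u = s - K the conditioned mean of f at time s is nearly constant over
  \<open>E u\<close>, so whatever law the conditioned process has at u may be replaced by the point
  x. This point belongs to \<open>E u\<close> because the sets \<open>E\<close> grow with time and u
  \<ge> s0.\<close>

lemma law_limit:
  fixes f :: "'e \<Rightarrow> real"
  assumes sm: strong_markov and cost: "((\<lambda>s. boundary_cost s x) \<longlongrightarrow> 0) to_infinity"
    and s0: "s0 \<in> I" "x \<in> E s0" and \<mu>: "\<mu> \<in> prob_measures (E 0)"
    and f: "f \<in> borel_measurable \<E>" "\<And>y. \<bar>f y\<bar> \<le> c" and \<delta>: "0 < \<delta>"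
  shows "\<exists>T. \<forall>s\<in>I. \<forall>t\<in>I. T \<le> s \<longrightarrow> s + T \<le> t \<longrightarrow>
    \<bar>(\<integral>y. f y \<partial>law_given (law_from 0 \<mu>) (tau_A 0) t s) - (\<integral>y. f y * lim.eta y \<partial>alpha_inf)\<bar> \<le> \<delta>"
proof -
  let ?v = "\<integral>y. f y * lim.eta y \<partial>alpha_inf"
  have "0 < \<delta> / 2" using \<delta> by simp
  then obtain T1 where T1: "\<forall>u\<in>I. \<forall>K\<in>I. \<forall>L\<in>I. T1 \<le> u \<longrightarrow> T1 \<le> K \<longrightarrow> T1 \<le> L \<longrightarrow>
      \<bar>mov.cond_mean u (u + K) (u + (K + L)) f x - ?v\<bar> \<le> \<delta> / 2"
    using start_limit[OF sm cost s0 f] by blast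
  have "(\<lambda>n. dob.contraction ^ n * (2 * c)) \<longlonglongrightarrow> 0 * (2 * c)"
    using dob.contraction by (intro tendsto_mult_right LIMSEQ_power_zero) auto
  then have "\<forall>\<^sub>F n in sequentially. dob.contraction ^ n * (2 * c) < \<delta> / 2"
    using \<delta> by (intro order_tendstoD) auto
  then obtain n where n: "dob.contraction ^ n * (2 * c) < \<delta> / 2" by (auto simp: eventually_sequentially)
  obtain m :: nat where m: "max T1 (real n * t0) \<le> real m" using real_arch_simple by blast
  define K where "K = real m"
  have K: "K \<in> I" "T1 \<le> K" "real n * t0 \<le> K" "0 \<le> K" using m by (auto simp: K_def)
  \<comment> \<open>For s \<ge> T the time s - K is still beyond both s0 and T1; K itself does not
    depend on s or t.\<close>
  define T where "T = max T1 s0 + K"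
  have "\<bar>(\<integral>y. f y \<partial>law_given (law_from 0 \<mu>) (tau_A 0) t s) - ?v\<bar> \<le> \<delta>"
    if s: "s \<in> I" "T \<le> s" and t: "t \<in> I" "s + T \<le> t" for s t
  proof (rule integral_law_given_mean[OF \<mu> s(1) t(1) _ f])
    define u where "u = s - K"
    have s0': "0 \<le> s0" using time_nonneg[OF s0(1)] .
    have Ks: "K \<le> s" using s s0' by (simp add: T_def)
    have u: "u \<in> I" "T1 \<le> u" "s0 \<le> u" "0 \<le> u" "u \<le> s"
      using time_diff[OF K(1) s(1) Ks] s time_nonneg[OF s0(1)] K(4) by (auto simp: u_def T_def)
    have st: "s \<le> t" using t s0' K(4) by (simp add: T_def)
    then show "s \<le> t" .
    define L where "L = t - s"
    have L: "L \<in> I" "T1 \<le> L" using time_diff[OF s(1) t(1) st] t K(4) by (auto simp: L_def T_def)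
    have eqs: "u + K = s" "u + (K + L) = t" by (auto simp: u_def L_def)
    have x: "x \<in> E u" using E_mono[OF s0(1) u(1,3)] s0(2) by blast
    have near: "\<bar>mov.cond_mean u s t f x - ?v\<bar> \<le> \<delta> / 2"
      using T1[rule_format, OF u(1) K(1) L(1) u(2) K(2) L(2)] by (simp add: eqs)
    fix y assume y: "y \<in> E 0"
    have "\<bar>mov.cond_mean 0 u t (mov.cond_mean u s t f) y - mov.cond_mean u s t f x\<bar> \<le> dob.contraction ^ n * (2 * c)"
    proof (rule mov.cond_mean_mono_on[OF time_0 u(1) t(1) u(4) _ y])
      show ut: "u \<le> t" using u(5) st by simp
      show "mov.cond_mean u s t f \<in> borel_measurable \<E>" by (rule mov.measurable_cond_mean[OF u(1) s(1) t(1) u(5) st f(1)])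
      show "\<bar>mov.cond_mean u s t f z\<bar> \<le> c" for z by (rule mov.abs_cond_mean_le[OF u(1) s(1) t(1) u(5) st f])
      show "\<bar>mov.cond_mean u s t f z - mov.cond_mean u s t f x\<bar> \<le> dob.contraction ^ n * (2 * c)" if z: "z \<in> E u" for z
        by (rule dob.cond_mean_forgets[OF u(1) s(1) t(1) _ st z x f]) (use K(3) in \<open>simp add: u_def\<close>)
    qed
    moreover have "mov.cond_mean 0 s t f y = mov.cond_mean 0 u t (mov.cond_mean u s t f) y"
      by (rule mov.cond_mean_split[OF time_0 u(1) s(1) t(1) u(4,5) st f])
    ultimately show "\<bar>mov.cond_mean 0 s t f y - ?v\<bar> \<le> \<delta>" using near n by linarith
  qed
  then show ?thesis by blast
qed

end

subsection \<open>Time averages\<close>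

lemma integral_scale_measure:
  fixes f :: "'a \<Rightarrow> real"
  assumes a: "0 \<le> a" and f: "f \<in> borel_measurable N"
  shows "(\<integral>x. f x \<partial>scale_measure (ennreal a) N) = a * (\<integral>x. f x \<partial>N)"
proof -
  have "scale_measure (ennreal a) N = density N (\<lambda>_. ennreal a)"
    by (rule measure_eqI) (auto simp: emeasure_density_const)
  then show ?thesis using a f by (simp add: integral_density)
qed

context moving_boundary
begin

text \<open>Decides the conditional in \<open>time_measure\<close> when time is discrete.\<close>

lemma range_real_neq: "range real \<noteq> {0..}"
proof
  assume "range real = {0..}"
  then have "1 / 2 \<in> range real" by simp
  then obtain n where "1 / 2 = real n" by blast
  then have "1 = real (2 * n)" by simp
  then have "1 = 2 * n" using of_nat_eq_iff[where 'a = real, of 1 "2 * n"] by simp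
  then show False by presburger
qed

lemma space_time_measure: "space (time_measure t) = {r\<in>I. r \<le> t}"
  using time_set by (auto simp: time_measure_def space_restrict_space)

lemma time_measure_discrete:
  assumes "I = range real"
  shows "time_measure (real n) = count_space (real ` {..n})"
proof -
  have "I \<noteq> {0..}" "{k\<in>I. k \<le> real n} = real ` {..n}" using assms range_real_neq by auto
  then show ?thesis unfolding time_measure_def by simp
qed

lemma time_measure_continuous:
  assumes "I = {0..}"
  shows "time_measure t = restrict_space lborel {0..t}"
  unfolding time_measure_def using assms by simp

text \<open>Collects what averaging needs in a form common to both time sets. The slack up to t + 1
  comes from the n + 1 summands in discrete time, and the strict inequalities in the exceptional set
  leave at most m integers at each end.\<close>

lemma time_measure_bounds:
  assumes t: "t \<in> I"
  shows "finite_measure (time_measure t)"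
    and "t \<le> measure (time_measure t) (space (time_measure t))"
    and "measure (time_measure t) (space (time_measure t)) \<le> t + 1"
    and "{r\<in>space (time_measure t). r < real m \<or> t < r + real m} \<in> sets (time_measure t)" (is "?B \<in> _")
    and "measure (time_measure t) {r\<in>space (time_measure t). r < real m \<or> t < r + real m} \<le> 2 * real m"
proof -
  have "finite_measure (time_measure t) \<and> t \<le> measure (time_measure t) (space (time_measure t)) \<and>
    measure (time_measure t) (space (time_measure t)) \<le> t + 1 \<and> ?B \<in> sets (time_measure t) \<and>
    measure (time_measure t) ?B \<le> 2 * real m"
    using time_set
  proof
    assume I: "I = range real"
    then obtain n where n: "t = real n" using t by blast
    have eq: "time_measure t = count_space (real ` {..n})" unfolding n by (rule time_measure_discrete[OF I])
    have inj: "inj_on real Z" for Z by (simp add: inj_on_def)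
    have "?B \<subseteq> real ` ({..<m} \<union> {n + 1 - m..n})"
    proof
      fix r assume r: "r \<in> ?B"
      then obtain i where i: "r = real i" "i \<le> n" unfolding eq by auto
      with r have "i < m \<or> n < i + m" unfolding n by auto
      then show "r \<in> real ` ({..<m} \<union> {n + 1 - m..n})" using i by (intro image_eqI[of _ _ i]) auto
    qed
    then have "card ?B \<le> card (real ` ({..<m} \<union> {n + 1 - m..n}))" by (intro card_mono) auto
    also have "\<dots> \<le> card ({..<m} \<union> {n + 1 - m..n})" by (rule card_image_le) simp
    also have "\<dots> \<le> m + m" by (rule order.trans[OF card_Un_le]) simp
    finally have "card ?B \<le> 2 * m" by simp
    then have "real (card ?B) \<le> 2 * real m" by (metis of_nat_le_iff of_nat_mult of_nat_numeral)
    moreover have "measure (time_measure t) ?B = real (card ?B)"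
      unfolding eq by (subst measure_count_space) auto
    moreover have "measure (time_measure t) (space (time_measure t)) = real n + 1"
      unfolding eq using card_image[OF inj, of "{..n}"] by (simp add: measure_count_space)
    moreover have "finite_measure (time_measure t)"
      unfolding eq by (rule finite_measure_count_space) simp
    moreover have "?B \<in> sets (time_measure t)" unfolding eq by auto
    ultimately show ?thesis by (simp add: n)
  next
    assume I: "I = {0..}"
    then have t0: "0 \<le> t" using t by simp
    have eq: "time_measure t = restrict_space lborel {0..t}" by (rule time_measure_continuous[OF I])
    have m': "measure (time_measure t) Z = measure lborel Z" if "Z \<subseteq> {0..t}" for Z
      unfolding eq using that by (intro measure_restrict_space) auto
    have sp: "space (time_measure t) = {0..t}" unfolding eq by (simp add: space_restrict_space)
    have B: "?B \<in> sets lborel" unfolding sp by measurable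
    have "measure (time_measure t) ?B = measure lborel ?B" by (rule m') (auto simp: sp)
    also have "\<dots> \<le> measure lborel ({0..real m} \<union> {t - real m..t})"
    proof (rule measure_mono_fmeasurable)
      show "?B \<subseteq> {0..real m} \<union> {t - real m..t}" by (auto simp: sp)
      show "{0..real m} \<union> {t - real m..t} \<in> fmeasurable lborel"
        by (intro fmeasurable.Un) (auto simp: fmeasurable_def)
    qed (rule B)
    also have "\<dots> \<le> measure lborel {0..real m} + measure lborel {t - real m..t}"
      by (rule measure_Un_le) auto
    also have "\<dots> = 2 * real m" by simp
    finally have m: "measure (time_measure t) ?B \<le> 2 * real m" .
    have mass: "measure (time_measure t) (space (time_measure t)) = t"
      unfolding sp using m'[of "{0..t}"] t0 by simp
    have fin: "finite_measure (time_measure t)"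
      unfolding eq by (rule finite_measureI) (simp add: space_restrict_space emeasure_restrict_space t0)
    have "{r\<in>{0..t}. r < real m \<or> t < r + real m} \<in> sets (restrict_space lborel {0..t})"
      by (subst sets_restrict_space_iff) (use B in \<open>auto simp: sp\<close>)
    then have B': "?B \<in> sets (time_measure t)" unfolding sp by (simp only: eq)
    show ?thesis unfolding mass by (intro conjI fin m B') simp_all
  qed
  then show "finite_measure (time_measure t)"
    "t \<le> measure (time_measure t) (space (time_measure t))"
    "measure (time_measure t) (space (time_measure t)) \<le> t + 1"
    "?B \<in> sets (time_measure t)" "measure (time_measure t) ?B \<le> 2 * real m" by blast+
qed

text \<open>Within m of either end of [0, t] only the trivial bound 2 c on the deviation is
  available, on a set of mass at most 2 m: hence 4 c m. The last c compensates for the total mass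
  exceeding t by up to 1, and \<delta> / t has the same origin.\<close>

lemma time_average_close:
  fixes \<rho> :: "real \<Rightarrow> real"
  assumes t: "t \<in> I" "0 < t" and \<rho>: "\<rho> \<in> borel_measurable (time_measure t)" "\<And>r. r \<in> space (time_measure t) \<Longrightarrow> \<bar>\<rho> r\<bar> \<le> c"
    and v: "\<bar>v\<bar> \<le> c" and close: "\<And>r. r \<in> I \<Longrightarrow> real m \<le> r \<Longrightarrow> r + real m \<le> t \<Longrightarrow> \<bar>\<rho> r - v\<bar> \<le> \<delta>" and \<delta>: "0 \<le> \<delta>"
  shows "\<bar>1 / t * (\<integral>r. \<rho> r \<partial>time_measure t) - v\<bar> \<le> \<delta> + (\<delta> + 4 * c * real m + c) / t"
proof -
  let ?m = "time_measure t"
  let ?B = "{r\<in>space ?m. r < real m \<or> t < r + real m}"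
  interpret finite_measure ?m by (rule time_measure_bounds(1)[OF t(1)])
  note B = time_measure_bounds(4)[OF t(1), of m]
  define w where "w = measure ?m (space ?m)"
  have w: "t \<le> w" "w \<le> t + 1" unfolding w_def by (rule time_measure_bounds(2,3)[OF t(1)])+
  have c: "0 \<le> c" using v by linarith
  have i: "integrable ?m \<rho>" by (rule integrable_const_bound[where B = c]) (use \<rho> in auto)
  have iB: "integrable ?m (indicat_real ?B)" using B by (simp add: emeasure_eq_measure)
  have "\<bar>(\<integral>r. \<rho> r \<partial>?m) - v * w\<bar> = \<bar>\<integral>r. \<rho> r - v \<partial>?m\<bar>"
    using i by (simp add: w_def mult.commute)
  also have "\<dots> \<le> (\<integral>r. \<bar>\<rho> r - v\<bar> \<partial>?m)" by (rule integral_abs_bound)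
  also have "\<dots> \<le> (\<integral>r. \<delta> + 2 * c * indicat_real ?B r \<partial>?m)"
  proof (rule integral_mono)
    show "integrable ?m (\<lambda>r. \<bar>\<rho> r - v\<bar>)" using i by simp
    show "integrable ?m (\<lambda>r. \<delta> + 2 * c * indicat_real ?B r)"
      by (intro Bochner_Integration.integrable_add integrable_mult_right iB integrable_const)
    fix r assume r: "r \<in> space ?m"
    show "\<bar>\<rho> r - v\<bar> \<le> \<delta> + 2 * c * indicat_real ?B r"
    proof (cases "r \<in> ?B")
      case True
      then show ?thesis using \<rho>(2)[OF r] v \<delta> by simp
    next
      case False
      then show ?thesis using close[of r] r c by (auto simp: space_time_measure)
    qed
  qed
  also have "\<dots> = \<delta> * w + 2 * c * measure ?m ?B"
    using iB B by (subst Bochner_Integration.integral_add) (auto simp: w_def)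
  also have "\<dots> \<le> \<delta> * (t + 1) + 2 * c * (2 * real m)"
    using w \<delta> c time_measure_bounds(5)[OF t(1), of m] by (intro add_mono mult_left_mono) auto
  finally have 1: "\<bar>(\<integral>r. \<rho> r \<partial>?m) - v * w\<bar> \<le> \<delta> * (t + 1) + 4 * c * real m" by simp
  have "\<bar>v * w - v * t\<bar> = \<bar>v\<bar> * (w - t)" using w by (simp add: abs_mult flip: right_diff_distrib)
  also have "\<dots> \<le> c * 1" using v w by (intro mult_mono) auto
  finally have "\<bar>(\<integral>r. \<rho> r \<partial>?m) - v * t\<bar> \<le> \<delta> * (t + 1) + 4 * c * real m + c" using 1 by linarith
  moreover have "1 / t * (\<integral>r. \<rho> r \<partial>?m) - v = ((\<integral>r. \<rho> r \<partial>?m) - v * t) / t"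
    using t(2) by (simp add: field_simps)
  ultimately have "\<bar>1 / t * (\<integral>r. \<rho> r \<partial>?m) - v\<bar> \<le> (\<delta> * (t + 1) + 4 * c * real m + c) / t"
    using t(2) by (simp add: abs_divide divide_right_mono)
  also have "\<dots> = \<delta> + (\<delta> + 4 * c * real m + c) / t" using t(2) by (simp add: field_simps)
  finally show ?thesis .
qed

text \<open>In discrete time every function is measurable. In continuous time
  \<open>progressive\<close> makes (r, \<omega>) \<mapsto> X r \<omega> jointly measurable up to t,
  and the probability of a set of positions becomes the measure of a section, measurable in
  r.\<close>

lemma law_given_time_kernel:
  assumes N: "prob_space N" "sets N = sets M" and t: "t \<in> I"
    and Z: "{\<omega>\<in>space M. ereal t < T \<omega>} \<in> sets M" and pos: "0 < survival N T t"
  shows "law_given N T t \<in> time_measure t \<rightarrow>\<^sub>M subprob_algebra \<E>"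
proof (rule measurable_subprob_algebra)
  fix r assume "r \<in> space (time_measure t)"
  then have r: "r \<in> I" by (simp add: space_time_measure)
  show "subprob_space (law_given N T t r)"
    by (rule prob_space_imp_subprob_space[OF law_given_prob(1)[OF N r Z pos]])
  show "sets (law_given N T t r) = sets \<E>" by (simp add: law_given_def)
next
  fix B assume B: "B \<in> sets \<E>"
  let ?U = "uniform_measure N {\<omega>\<in>space M. ereal t < T \<omega>}"
  have U: "sets ?U = sets M" "space ?U = space M" using N(2) sets_eq_imp_space_eq[OF N(2)] by auto
  show "(\<lambda>r. emeasure (law_given N T t r) B) \<in> borel_measurable (time_measure t)"
    using time_set
  proof
    assume I: "I = range real"
    then obtain n where "t = real n" using t by blast
    then show ?thesis by (simp add: time_measure_discrete[OF I])
  next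
    assume I: "I = {0..}"
    have eq: "time_measure t = restrict_space lborel {0..t}" by (rule time_measure_continuous[OF I])
    have It: "{u\<in>I. u \<le> t} = {0..t}" by (auto simp: I)
    interpret N: prob_space N by (rule N(1))
    have "prob_space ?U"
      using pos by (intro prob_space_uniform_measure) (auto simp: survival_def N.emeasure_eq_measure)
    then interpret U: prob_space ?U .
    have "(\<lambda>p. (fst p, snd p)) \<in> time_measure t \<Otimes>\<^sub>M ?U \<rightarrow>\<^sub>M restrict_space borel {u\<in>I. u \<le> t} \<Otimes>\<^sub>M hist 0 (ereal t)"
    proof (rule measurable_Pair)
      have "(\<lambda>r. r) \<in> time_measure t \<rightarrow>\<^sub>M restrict_space borel {u\<in>I. u \<le> t}"
        unfolding eq It by (rule measurable_ident_sets) (simp add: sets_restrict_space)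
      then show "(\<lambda>p. fst p) \<in> time_measure t \<Otimes>\<^sub>M ?U \<rightarrow>\<^sub>M restrict_space borel {u\<in>I. u \<le> t}"
        by (rule measurable_compose[OF measurable_fst])
      have "(\<lambda>\<omega>. \<omega>) \<in> ?U \<rightarrow>\<^sub>M hist 0 (ereal t)"
      proof (rule measurableI)
        fix Q assume Q: "Q \<in> sets (hist 0 (ereal t))"
        then have "(\<lambda>\<omega>. \<omega>) -` Q \<inter> space ?U = Q" using sets.sets_into_space[OF Q] U(2) by auto
        then show "(\<lambda>\<omega>. \<omega>) -` Q \<inter> space ?U \<in> sets ?U" using Q sets_hist_subset U(1) by auto
      qed (use U in auto)
      then show "(\<lambda>p. snd p) \<in> time_measure t \<Otimes>\<^sub>M ?U \<rightarrow>\<^sub>M hist 0 (ereal t)"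
        by (rule measurable_compose[OF measurable_snd])
    qed
    from measurable_compose[OF this progressive[OF t]]
    have XX: "(\<lambda>p. X (fst p) (snd p)) \<in> time_measure t \<Otimes>\<^sub>M ?U \<rightarrow>\<^sub>M \<E>" by simp
    define Q where "Q = (\<lambda>p. X (fst p) (snd p)) -` B \<inter> space (time_measure t \<Otimes>\<^sub>M ?U)"
    have "Q \<in> sets (time_measure t \<Otimes>\<^sub>M ?U)" unfolding Q_def by (rule measurable_sets[OF XX B])
    then have "(\<lambda>r. emeasure ?U (Pair r -` Q)) \<in> borel_measurable (time_measure t)"
      by (rule U.measurable_emeasure_Pair)
    moreover have "emeasure (law_given N T t r) B = emeasure ?U (Pair r -` Q)" if r: "r \<in> space (time_measure t)" for r
    proof -
      have "X r \<in> ?U \<rightarrow>\<^sub>M \<E>"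
        using measurable_X[of r] r U(1) by (simp add: space_time_measure cong: measurable_cong_sets)
      then have "emeasure (law_given N T t r) B = emeasure ?U (X r -` B \<inter> space ?U)"
        unfolding law_given_def using B by (rule emeasure_distr)
      also have "X r -` B \<inter> space ?U = Pair r -` Q"
        using r by (auto simp: Q_def space_pair_measure)
      finally show ?thesis .
    qed
    ultimately show ?thesis by (simp cong: measurable_cong)
  qed
qed

end

section \<open>Identification of the limit and convergence of averages\<close>

context boundary_setting
begin

text \<open>\<open>integral_alive_inf\<close> turns survival from the position at t for a further
  time T - t into survival until T, so the conditional law in the definition is the quotient of
  \<open>qker_limit\<close>.\<close>

lemma Q_process_qker: "Q_process lim.qker"
  unfolding Q_process_def
proof (intro ballI conjI)
  fix t x assume t: "t \<in> I" and x: "x \<in> E_inf"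
  show "lim.qker t x \<in> prob_measures E_inf"
    using lim.qker_prob[OF t x] by (simp add: prob_measures_def)
  fix B assume B: "B \<in> sets \<E>"
  show "((\<lambda>T. measure (law_given (P 0 x) tau_inf T t) B) \<longlongrightarrow> measure (lim.qker t x) B) time_top"
    unfolding time_top_eq
  proof (rule Lim_transform_eventually[OF lim.qker_limit[OF t x B]])
    show "\<forall>\<^sub>F T in to_infinity. (\<integral>y. indicator B y * inf.surv (T - t) y \<partial>kernel_inf t x) / inf.surv T x
        = measure (law_given (P 0 x) tau_inf T t) B"
      using eventually_time[of t]
    proof eventually_elim
      case (elim T)
      have L: "T - t \<in> I" by (rule time_diff) (use t elim in auto)
      have sets_lg: "sets (law_given (P 0 x) tau_inf T t) = sets \<E>" by (simp add: law_given_def)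
      have "measure (law_given (P 0 x) tau_inf T t) B = (\<integral>y. indicator B y \<partial>law_given (P 0 x) tau_inf T t)"
        using B sets_lg by simp
      also have "\<dots> = (\<integral>y. indicator B y \<partial>sub_law (P 0 x) (alive_inf 0 T) (X t)) / measure (P 0 x) (alive_inf 0 T)"
        by (rule integral_law_given[OF sets_P[OF time_0] alive_sets(2) measurable_X[OF t]])
          (use B in \<open>auto simp: alive_inf_def tau_inf_def prob_space.finite_measure[OF prob_P[OF time_0]]\<close>)
      also have "measure (P 0 x) (alive_inf 0 T) = inf.surv T x"
        using surv_inf elim by simp
      also have "(\<integral>y. indicator B y \<partial>sub_law (P 0 x) (alive_inf 0 T) (X t)) = (\<integral>y. indicator B y * inf.surv (T - t) y \<partial>kernel_inf t x)"
        using integral_alive_inf[OF t L, of "indicator B" 1 x] B by simp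
      finally show ?case by simp
    qed
  qed
qed

lemma invariant_beta: "invariant lim.qker lim.beta"
  unfolding invariant_def prob_measures_def
  using lim.beta_prob lim.beta_F lim.beta_invariant by simp

lemma invariant_unique: "invariant lim.qker \<beta>' \<Longrightarrow> \<beta>' = lim.beta"
  unfolding invariant_def prob_measures_def by (intro lim.beta_unique) auto

lemma average_converges:
  assumes sm: strong_markov and H': H'_inf and \<mu>: "\<mu> \<in> prob_measures (E 0)"
  shows "weakly_converges \<E> (average_law \<mu>) lim.beta time_top"
  unfolding weakly_converges_def time_top_eq
proof (intro allI impI)
  fix f :: "'e \<Rightarrow> real"
  assume "f \<in> borel_measurable \<E> \<and> continuous_on UNIV f \<and> bounded (range f)"
  then obtain c where f: "f \<in> borel_measurable \<E>" "\<And>y. \<bar>f y\<bar> \<le> c"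
    unfolding bounded_iff by auto
  have c: "0 \<le> c" using f(2)[of undefined] by linarith
  obtain s0 x where s0: "s0 \<in> I" "x \<in> E s0" and cost: "((\<lambda>s. boundary_cost s x) \<longlongrightarrow> 0) to_infinity"
    using H' unfolding H'_inf_def boundary_cost_def time_top_eq by blast
  have \<mu>p: "\<mu> \<in> space (prob_algebra \<E>)" using \<mu> by (simp add: prob_measures_def)
  define Q where "Q = law_from 0 \<mu>"
  have Q: "prob_space Q" "sets Q = sets M" unfolding Q_def by (rule law_from_prob[OF time_0 \<mu>p])+
  define \<rho> where "\<rho> t r = (\<integral>y. f y \<partial>law_given Q (tau_A 0) t r)" for t r
  define v where "v = (\<integral>y. f y \<partial>lim.beta)"
  have Z: "{\<omega>\<in>space M. ereal t < tau_A 0 \<omega>} \<in> sets M" for t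
    using alive_sets(1)[OF time_0, of t] by (simp add: alive_A_def tau_A_def)
  have pos: "0 < survival Q (tau_A 0) t" if t: "t \<in> I" for t
  proof -
    have "survival Q (tau_A 0) t = (\<integral>y. mov.surv 0 t y \<partial>\<mu>)"
      unfolding Q_def survival_law_from[OF time_0 \<mu>p Z] by (simp add: mov.surv_def measure_kernel_A[OF time_0 t])
    moreover have "0 < (\<integral>y. mov.surv 0 t y \<partial>\<mu>)"
      by (rule surv_initial_pos[OF \<mu> t])
    ultimately show ?thesis by simp
  qed
  have K: "law_given Q (tau_A 0) t \<in> time_measure t \<rightarrow>\<^sub>M subprob_algebra \<E>" if "t \<in> I" for t
    by (rule law_given_time_kernel[OF Q that Z pos[OF that]])
  have average: "(\<integral>y. f y \<partial>average_law \<mu> t) = 1 / t * (\<integral>r. \<rho> t r \<partial>time_measure t)" if t: "t \<in> I" for t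
  proof -
    interpret tm: finite_measure "time_measure t" by (rule time_measure_bounds(1)[OF t])
    have ne: "space (time_measure t) \<noteq> {}" using t by (auto simp: space_time_measure)
    have "sets (time_measure t \<bind> law_given Q (tau_A 0) t) = sets \<E>"
      by (rule sets_bind[OF _ ne]) (simp add: law_given_def)
    then have "(\<integral>y. f y \<partial>average_law \<mu> t) = 1 / t * (\<integral>y. f y \<partial>(time_measure t \<bind> law_given Q (tau_A 0) t))"
      unfolding average_law_def Q_def[symmetric]
      using time_nonneg[OF t] f(1) by (intro integral_scale_measure) (auto cong: measurable_cong_sets)
    also have "(\<integral>y. f y \<partial>(time_measure t \<bind> law_given Q (tau_A 0) t)) = (\<integral>r. \<rho> t r \<partial>time_measure t)"
      unfolding \<rho>_def
    proof (rule integral_bind[OF f(1) _ K[OF t] tm.finite_measure_axioms, where B = c and B' = 1])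
      show "AE r in time_measure t. emeasure (law_given Q (tau_A 0) t r) (space (law_given Q (tau_A 0) t r)) \<le> ennreal 1"
        using subprob_space_kernel[OF K[OF t]] by (auto simp: subprob_space.emeasure_space_le_1)
    qed (rule f(2))
    finally show ?thesis .
  qed
  have \<rho>_le: "\<bar>\<rho> t r\<bar> \<le> c" if "t \<in> I" "r \<in> space (time_measure t)" for t r
  proof -
    have sp: "law_given Q (tau_A 0) t r \<in> space (subprob_algebra \<E>)"
      by (rule measurable_space[OF K[OF that(1)] that(2)])
    have "\<bar>\<rho> t r\<bar> \<le> c * measure (law_given Q (tau_A 0) t r) (space \<E>)"
      unfolding \<rho>_def by (rule abs_integral_subprob_le[OF sp f(1)]) (rule f(2))
    also have "\<dots> \<le> c * 1"
      using c sp by (intro mult_left_mono subprob_space.subprob_measure_le_1) (auto simp: space_subprob_algebra)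
    finally show ?thesis by simp
  qed
  have \<rho>_meas: "\<rho> t \<in> borel_measurable (time_measure t)" if "t \<in> I" for t
    unfolding \<rho>_def[abs_def] by (rule measurable_compose[OF K[OF that] integral_measurable_subprob_algebra[OF f(1)]])
  have v_le: "\<bar>v\<bar> \<le> c"
  proof -
    interpret b: prob_space lim.beta using lim.beta_prob by (simp add: space_prob_algebra)
    have "lim.beta \<in> space (subprob_algebra \<E>)" by (simp add: space_subprob_algebra b.subprob_space_axioms)
    then have "\<bar>v\<bar> \<le> c * measure lim.beta (space \<E>)"
      unfolding v_def by (rule abs_integral_subprob_le[OF _ f(1)]) (rule f(2))
    then show ?thesis using b.prob_space sets_eq_imp_space_eq[OF lim.sets_beta] by simp
  qed
  have "((\<lambda>t. 1 / t * (\<integral>r. \<rho> t r \<partial>time_measure t)) \<longlongrightarrow> v) to_infinity"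
  proof (rule tendstoI)
    fix e :: real assume e: "0 < e"
    \<comment> \<open>The middle range and the end terms contribute at most \<delta> each, so the
      total is at most e / 2.\<close>
    define \<delta> where "\<delta> = e / 4"
    have \<delta>: "0 < \<delta>" using e by (simp add: \<delta>_def)
    obtain T where T: "\<forall>s\<in>I. \<forall>t\<in>I. T \<le> s \<longrightarrow> s + T \<le> t \<longrightarrow> \<bar>\<rho> t s - v\<bar> \<le> \<delta>"
      using law_limit[OF sm cost s0 \<mu> f \<delta>] unfolding \<rho>_def Q_def v_def lim.integral_beta[OF f(1)] by blast
    obtain m :: nat where m: "T \<le> real m" using real_arch_simple by blast
    \<comment> \<open>The terms of \<open>time_average_close\<close> that are divided by t; they
      drop below \<delta> once t \<ge> R / \<delta>.\<close>
    define R where "R = \<delta> + 4 * c * real m + c"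
    have R: "0 < R" using \<delta> c by (simp add: R_def add_pos_nonneg)
    show "\<forall>\<^sub>F t in to_infinity. dist (1 / t * (\<integral>r. \<rho> t r \<partial>time_measure t)) v < e"
      using eventually_time[of "max 1 (R / \<delta>)"]
    proof eventually_elim
      case (elim t)
      then have t: "t \<in> I" "0 < t" "R / \<delta> \<le> t" by auto
      have "\<bar>1 / t * (\<integral>r. \<rho> t r \<partial>time_measure t) - v\<bar> \<le> \<delta> + R / t"
        unfolding R_def
      proof (rule time_average_close[OF t(1,2) \<rho>_meas[OF t(1)] \<rho>_le[OF t(1)] v_le])
        fix r assume "r \<in> I" "real m \<le> r" "r + real m \<le> t"
        then show "\<bar>\<rho> t r - v\<bar> \<le> \<delta>" using T t(1) m by auto
      qed (use \<delta> in auto)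
      also have "R / t \<le> \<delta>" using t \<delta> R by (simp add: field_simps)
      finally show ?case using e by (simp add: dist_real_def \<delta>_def)
    qed
  qed
  then have "((\<lambda>t. \<integral>y. f y \<partial>average_law \<mu> t) \<longlongrightarrow> v) to_infinity"
    by (rule Lim_transform_eventually) (use eventually_time[of 0] average in \<open>auto elim!: eventually_mono\<close>)
  then show "((\<lambda>t. \<integral>y. f y \<partial>average_law \<mu> t) \<longlongrightarrow> (\<integral>y. f y \<partial>lim.beta)) to_infinity"
    by (simp add: v_def)
qed

end

theorem theorem9:
  fixes I :: "real set"
    and \<E> :: "'e::metric_space measure"
    and M :: "'w measure"
    and X :: "real \<Rightarrow> 'w \<Rightarrow> 'e"
    and P :: "real \<Rightarrow> 'e \<Rightarrow> 'w measure"
    and A :: "real \<Rightarrow> 'e set"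
  assumes "moving_boundary I \<E> M X P A"
    and "\<forall>s\<in>I. \<forall>t\<in>I. s \<le> t \<longrightarrow> A t \<subseteq> A s"
    and "moving_boundary.A_inf I A \<noteq> {}"
    and "moving_boundary.cond_A' I \<E> M X P A"
    and "moving_boundary.H_hom I \<E> M X P A"
    and "moving_boundary.H_inf I \<E> M X P A"
    and "moving_boundary.H'_inf I \<E> M X P A"
  shows "\<exists>Q \<beta>. moving_boundary.Q_process I \<E> M X P A Q \<and>
           moving_boundary.invariant I \<E> A Q \<beta> \<and>
           (\<forall>\<beta>'. moving_boundary.invariant I \<E> A Q \<beta>' \<longrightarrow> \<beta>' = \<beta>) \<and>
           (\<forall>\<mu>\<in>process.prob_measures \<E> (moving_boundary.E A 0).
              weakly_converges \<E> (moving_boundary.average_law I \<E> M X P A \<mu>) \<beta>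
                (process.time_top I))"
proof -
  interpret nonincreasing_boundary I \<E> M X P A
    using assms(1,2) by (simp add: nonincreasing_boundary_def nonincreasing_boundary_axioms_def)
  obtain C \<gamma> where lim: "exp_ergodic I \<E> E_inf kernel_inf alpha_inf C \<gamma>"
    using exp_ergodic_alpha_inf[OF assms(6)] by blast
  obtain \<nu> t0 c1 c2 where dob: "doeblin_propagator I \<E> E kernel_A \<nu> t0 c1 c2"
    using doeblin_of_cond_A'[OF assms(4)] by blast
  interpret boundary_setting I \<E> M X P A C \<gamma> \<nu> t0 c1 c2
    by (intro boundary_setting.intro nonincreasing_boundary_axioms lim dob)
  have sm: strong_markov using assms(5) by (simp add: H_hom_def)
  show ?thesis
    using Q_process_qker invariant_beta invariant_unique average_converges[OF sm assms(7)] by blast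
qed

end
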